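(* Let $m\ge1$ and let $G$ be a finite group with $\mathcal{X}_m\le G\le U(2^m,\mathbb{C})$. Then there exists a root of unity $\zeta\in\mathbb{C}$ such that $G=\langle\mathcal{X}_m,\zeta I_{2^m}\rangle$.
   Context: Let $\sigma_1=\begin{pmatrix}0&1\\1&0\end{pmatrix}$, $\sigma_2=\begin{pmatrix}1&0\\0&-1\end{pmatrix}$, $E(1)=\langle\sigma_1,\sigma_2\rangle$, and let $E(m)$ be the group of all $2^m\times2^m$ matrices $A_1\otimes\cdots\otimes A_m$ with $A_i\in E(1)$. Let $E(m)\,\mathsf{Y}\,Z_4$ denote the group generated by $E(m)$ and the scalar matrix $iI_{2^m}$ (a central product). Let $\zeta_8=e^{2\pi i/8}$ and let $U(2^m,\mathbb{Q}[\zeta_8])$ be the group of unitary $2^m\times 2^m$ matrices with entries in $\mathbb{Q}(\zeta_8)$. The complex Clifford group $\mathcal{X}_m$ is the normalizer of $E(m)\,\mathsf{Y}\,Z_4$ in $U(2^m,\mathbb{Q}[\zeta_8])$. *)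

theory Defs
  imports
    Complex_Main
    "HOL-Algebra.Group_Action"
    "HOL-Algebra.Generated_Groups"
    "HOL-Algebra.Generated_Fields"
    "Jordan_Normal_Form.Schur_Decomposition"
    "Jordan_Normal_Form.VS_Connect"
begin

text \<open>The group \<open>U(n, K)\<close> of unitary matrices with entries in \<open>K\<close>, for a subfield \<open>K\<close> of the
  complex numbers that is closed under conjugation (otherwise it need not be a group);
  \<open>unitary_group n UNIV\<close> is \<open>U(n, \<complex>)\<close>.\<close>

definition unitary_group :: "nat \<Rightarrow> complex set \<Rightarrow> complex mat monoid" where
  "unitary_group n K =
     \<lparr>carrier = {A \<in> carrier_mat n n. elements_mat A \<subseteq> K \<and> A * mat_adjoint A = 1\<^sub>m n},
      monoid.mult = (*), one = 1\<^sub>m n\<rparr>"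

definition zeta8 :: complex where
  "zeta8 = exp (2 * of_real pi * \<i> / 8)"

definition Q_zeta8 :: "complex set" where
  "Q_zeta8 = generate_field (class_ring :: complex ring) {zeta8}"

definition kronecker :: "complex mat \<Rightarrow> complex mat \<Rightarrow> complex mat" (infixr "\<otimes>\<^sub>k" 70) where
  "A \<otimes>\<^sub>k B = mat (dim_row A * dim_row B) (dim_col A * dim_col B)
     (\<lambda>(i, j). A $$ (i div dim_row B, j div dim_col B) * B $$ (i mod dim_row B, j mod dim_col B))"

definition sigma1 :: "complex mat" where
  "sigma1 = mat_of_rows_list 2 [[0, 1], [1, 0]]"

definition sigma2 :: "complex mat" where
  "sigma2 = mat_of_rows_list 2 [[1, 0], [0, -1]]"

definition E1 :: "complex mat set" where
  "E1 = generate (unitary_group 2 UNIV) {sigma1, sigma2}"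

text \<open>The \<open>1 \<times> 1\<close> identity matrix is the unit of the Kronecker product.\<close>

definition extraspecial :: "nat \<Rightarrow> complex mat set" where
  "extraspecial m = {foldr kronecker As (1\<^sub>m 1) | As. length As = m \<and> set As \<subseteq> E1}"

definition extraspecial_Z4 :: "nat \<Rightarrow> complex mat set" where
  "extraspecial_Z4 m =
     generate (unitary_group (2 ^ m) UNIV) (extraspecial m \<union> {\<i> \<cdot>\<^sub>m 1\<^sub>m (2 ^ m)})"

definition clifford_normalizer :: "nat \<Rightarrow> complex mat set" where
  "clifford_normalizer m = normalizer (unitary_group (2 ^ m) Q_zeta8) (extraspecial_Z4 m)"

text \<open>The full normalizer contains every scalar of absolute value 1 in \<open>\<rat>(\<zeta>\<^sub>8)\<close>, for instance
  \<open>(3 + 4\<i>) / 5\<close>, and is therefore infinite. The finite complex Clifford group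
  \<open>(2\<^bsup>1+2m\<^esup> Y Z\<^sub>8).Sp(2m, 2)\<close>, whose scalars are the powers of \<open>\<zeta>\<^sub>8\<close>, consists of
  the elements of finite order of the normalizer: each element of the normalizer is an element of
  the finite group times a scalar in \<open>\<rat>(\<zeta>\<^sub>8)\<close>, and the only scalars of finite order in
  \<open>\<rat>(\<zeta>\<^sub>8)\<close> are the powers of \<open>\<zeta>\<^sub>8\<close>.\<close>

definition finite_clifford :: "nat \<Rightarrow> complex mat set" where
  "finite_clifford m = {A \<in> clifford_normalizer m. \<exists>k>0. A ^\<^sub>m k = 1\<^sub>m (2 ^ m)}"

end

theory Submission
  imports Defs "HOL-Computational_Algebra.Polynomial_Factorial"
begin

text \<open>Let \<open>R = \<int>[\<zeta>]\<close> be a cyclotomic ring containing \<open>\<zeta>\<^sub>8\<close> and the traces of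
  all elements of \<open>G\<close>. The vectors \<open>v\<close> with \<open>(g v)\<^sub>0 \<in> R\<close> for all \<open>g \<in> G\<close> form a \<open>G\<close>-invariant
  \<open>R\<close>-lattice \<open>L\<close> of Barnes-Wall type. It contains \<open>\<surd>2\<^sup>m e\<^sub>0\<close>, because \<open>\<surd>2\<^sup>m\<close> times the projection to
  \<open>e\<^sub>0\<close> lies in the \<open>R\<close>-span of the Clifford group. Averaging the norm over the Galois conjugates makes
  the minimum of \<open>L\<close> equal to \<open>2\<^sup>m\<close>; up to units the Clifford group is transitive on the minimal
  vectors, and the minimal vectors congruent to \<open>\<surd>2\<^sup>m e\<^sub>0\<close> modulo \<open>\<surd>2 L\<close> are the \<open>\<i>\<^sup>k \<surd>2\<^sup>m e\<^sub>p\<close>.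
  Comparing minimal vectors modulo \<open>\<surd>2 L\<close> shows that the elements of \<open>G\<close> acting trivially on
  \<open>L / \<surd>2 L\<close> are exactly the Pauli matrices, so \<open>G\<close> normalizes the Pauli group. After multiplication
  by a Clifford element, \<open>g \<in> G\<close> fixes the line of \<open>e\<^sub>0\<close>; then \<open>g\<close> is a scalar times a monomial matrix
  whose non-zero entries are powers of \<open>\<i>\<close>, which lies in the Clifford group.\<close>

section \<open>The normalized trace of a cyclotomic ring\<close>

text \<open>The entries of \<open>G\<close> are not assumed to lie in Q(zeta8); finiteness only says
  that traces are sums of roots of unity, so \<open>R\<close> has to grow with \<open>G\<close>.
  Already Z[zeta8] is dense in the complex numbers, so the Hermitian norm alone has no positive
  minimum on an \<open>R\<close>-lattice; its average over all conjugates does, because a nonzero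
  algebraic integer has norm at least 1 in absolute value. Two lattices occur: \<open>latt\<close>
  is cut out by Clifford operators alone and suits induction on \<open>m\<close>, while
  \<open>inL\<close> is cut out by all of \<open>G\<close> and is invariant under \<open>G\<close>.
  As \<open>inL\<close> is contained in \<open>latt\<close>, what is proved about short vectors of
  \<open>latt\<close> holds for \<open>inL\<close>, and no further comparison is made. The factor
  \<open>s2 ^ m\<close> in \<open>e0\<close> is the price of isolating one matrix entry by
  \<open>m\<close> successive halvings of a trace, and it is just small enough for \<open>e0\<close>
  to be minimal. Scalars are removed by normalizing an element so that it fixes \<open>e0\<close>:
  its power by \<open>card G\<close> is then a scalar fixing \<open>e0\<close>, so the normalized
  element has finite order.\<close>

abbreviation ipoly :: "int poly \<Rightarrow> complex \<Rightarrow> complex" where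
  "ipoly p x \<equiv> poly (of_int_poly p) x"

lemma ipoly_cnj: "cnj (ipoly p x) = ipoly p (cnj x)"
  by (induction p) auto

lemma ipoly_pcompose: "ipoly (pcompose p q) x = ipoly p (ipoly q x)"
  by (induction p) (auto simp: hom_distribs pcompose_pCons algebra_simps)

text \<open>On n-th roots of unity conjugation is an integer polynomial, so it is compatible with
  replacing \<zeta> by a conjugate. This gives closure of R under \<open>cnj\<close> and the value
  of \<tau> on x * cnj x.\<close>

lemma ipoly_monom_cnj:
  assumes "n > 0" "r ^ n = 1"
  shows "ipoly (monom 1 (n - 1)) r = cnj r"
proof -
  have "norm r = 1"
    using assms power_eq_imp_eq_base[of "norm r" n 1] by (simp flip: norm_power)
  hence "r * cnj r = 1" by (simp flip: complex_norm_square)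
  moreover have "r * r ^ (n - 1) = 1" using assms by (cases n) auto
  moreover have "r \<noteq> 0" using \<open>norm r = 1\<close> by auto
  ultimately have "r ^ (n - 1) = cnj r" by (metis mult_left_cancel)
  thus ?thesis by (simp add: poly_monom hom_distribs)
qed

text \<open>Gauss's lemma: pseudo-division by a primitive polynomial of least degree leaves no
  remainder, and comparing contents with the monic x^n - 1 makes its leading coefficient a unit.
  Once monic, \<open>f\<close> divides over the integers, not merely up to a constant.\<close>

lemma root_of_unity_minimal_int_poly:
  assumes n: "n > 0" and z: "\<zeta> ^ n = 1"
  obtains f :: "int poly" where "lead_coeff f = 1" "ipoly f \<zeta> = 0" "degree f > 0"
    "\<And>p. ipoly p \<zeta> = 0 \<Longrightarrow> f dvd p"
    "\<And>p. p \<noteq> 0 \<Longrightarrow> ipoly p \<zeta> = 0 \<Longrightarrow> degree f \<le> degree p"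
proof -
  define X :: "int poly" where "X = monom 1 n - 1"
  have lX: "lead_coeff X = 1"
  proof -
    have "degree X = n" unfolding X_def using n
      by (metis degree_1 degree_add_eq_left degree_minus degree_monom_eq diff_conv_add_uminus zero_neq_one)
    thus ?thesis unfolding X_def using n by (simp)
  qed
  have X0: "X \<noteq> 0" using lX by auto
  have Xz: "ipoly X \<zeta> = 0" using z by (simp add: X_def hom_distribs poly_monom)
  define P where "P = (\<lambda>f. f \<noteq> 0 \<and> ipoly f \<zeta> = 0)"
  obtain g where g: "P g" "\<And>h. P h \<Longrightarrow> degree g \<le> degree h"
    using exists_least_lemma[of "\<lambda>d. \<exists>g. P g \<and> degree g = d"] X0 Xz
    by (metis (no_types, lifting) P_def arg_min_nat_lemma)
  define f0 where "f0 = primitive_part g"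
  have "g = smult (content g) f0" unfolding f0_def by simp
  hence "ipoly g \<zeta> = of_int (content g) * ipoly f0 \<zeta>" by (metis of_int_hom.map_poly_hom_smult poly_smult)
  moreover have "content g \<noteq> 0" using g(1) P_def by auto
  ultimately have f0: "ipoly f0 \<zeta> = 0" "f0 \<noteq> 0" "degree f0 = degree g" "content f0 = 1"
    using g(1) unfolding P_def f0_def by auto
  have pd: "\<exists>a q. a \<noteq> 0 \<and> smult a p = f0 * q" if p: "ipoly p \<zeta> = 0" for p
  proof -
    obtain a q where aq: "a \<noteq> 0" "smult a p = f0 * q + pseudo_mod p f0"
      using pseudo_mod(1)[OF f0(2)] by blast
    have d: "pseudo_mod p f0 = 0 \<or> degree (pseudo_mod p f0) < degree f0" using pseudo_mod(2)[OF f0(2)] .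
    have "ipoly (smult a p) \<zeta> = ipoly (f0 * q + pseudo_mod p f0) \<zeta>" using aq by simp
    hence "ipoly (pseudo_mod p f0) \<zeta> = 0" using p f0 by (simp add: hom_distribs)
    hence "pseudo_mod p f0 = 0" using g(2)[of "pseudo_mod p f0"] d f0(3) unfolding P_def by linarith
    thus ?thesis using aq by auto
  qed
  obtain a q where aq: "a \<noteq> 0" "smult a X = f0 * q" using pd[OF Xz] by auto
  have "content X = 1"
    using lX by (metis content_dvd_coeff is_unit_content_iff is_unit_normalize normalize_content)
  \<comment> \<open>\<open>a\<close> is the leading coefficient of \<open>f0\<close> times that of
    \<open>q\<close>, while the content of \<open>q\<close>, equal to the absolute value of
    \<open>a\<close>, divides the latter; only a unit is left for \<open>f0\<close>.\<close>
  hence "content q = \<bar>a\<bar>" using arg_cong[OF aq(2), of content] f0(4) by (simp add: content_mult)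
  hence "\<bar>a\<bar> dvd lead_coeff q" by (metis content_dvd_coeff)
  moreover have "a = lead_coeff f0 * lead_coeff q"
    using arg_cong[OF aq(2), of lead_coeff] lX aq(1) by (simp only: lead_coeff_mult lead_coeff_smult mult_1_right)
  ultimately have "lead_coeff f0 * lead_coeff q dvd 1 * lead_coeff q" by simp
  moreover have "lead_coeff q \<noteq> 0" using \<open>a = _\<close> aq(1) by auto
  ultimately have "lead_coeff f0 dvd 1" by (rule dvd_times_right_cancel_iff[THEN iffD1, rotated])
  hence lf: "lead_coeff f0 = 1 \<or> lead_coeff f0 = -1" by auto
  define f where "f = smult (lead_coeff f0) f0"
  have f: "lead_coeff f = 1" "ipoly f \<zeta> = 0" "f \<noteq> 0" "degree f = degree f0" "content f = 1"
    using lf f0 unfolding f_def by (auto simp: hom_distribs)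
  have dvd: "f dvd p" if p: "ipoly p \<zeta> = 0" for p
  proof (cases "p = 0")
    case False
    obtain q r where qr: "pseudo_divmod p f = (q, r)" by (cases "pseudo_divmod p f")
    from pseudo_divmod[OF f(3) qr] f(1) have e: "p = f * q + r" and d: "r = 0 \<or> degree r < degree f" by auto
    have "ipoly r \<zeta> = 0" using arg_cong[OF e, of "\<lambda>p. ipoly p \<zeta>"] p f(2) by (simp add: hom_distribs)
    hence "r = 0" using g(2)[of r] d f(4) f0(3) unfolding P_def by linarith
    thus ?thesis using e by simp
  qed auto
  have dg: "degree f > 0"
  proof (rule ccontr)
    assume "\<not> degree f > 0"
    then obtain c where "f = [:c:]" by (metis degree_eq_zeroE gr0I)
    hence "f = [:1:]" using f(1) by simp
    thus False using f(2) by simp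
  qed
  show ?thesis
    by (rule that[OF f(1,2) dg dvd]) (use g(2) f(4) f0(3) P_def in auto)
qed

text \<open>t - 1 - ln t is nonnegative and vanishes only at t = 1. Summing these terms gives the
  inequality between the means together with its equality case.\<close>

lemma am_gm_prod_ge_1:
  fixes t :: "'a \<Rightarrow> real"
  assumes "finite A" and pos: "\<And>r. r \<in> A \<Longrightarrow> t r > 0" and P: "prod t A \<ge> 1"
  shows "sum t A \<ge> card A" and "sum t A = card A \<Longrightarrow> r \<in> A \<Longrightarrow> t r = 1"
proof -
  have "0 \<le> ln (prod t A)" using P by simp
  also have "ln (prod t A) = (\<Sum>r\<in>A. ln (t r))"
    using pos[THEN less_imp_neq] assms(1) by (metis ln_prod)
  finally have l0: "0 \<le> (\<Sum>r\<in>A. ln (t r))" .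
  have "(\<Sum>r\<in>A. ln (t r)) \<le> (\<Sum>r\<in>A. t r - 1)" by (intro sum_mono ln_le_minus_one pos)
  with l0 show "sum t A \<ge> card A" by (simp add: sum_subtractf)
  assume e: "sum t A = card A" and r: "r \<in> A"
  have "(\<Sum>r\<in>A. t r - 1 - ln (t r)) \<le> 0" using e l0 by (simp add: sum_subtractf)
  moreover have nn: "\<And>r. r \<in> A \<Longrightarrow> 0 \<le> t r - 1 - ln (t r)" using ln_le_minus_one pos by fastforce
  ultimately have "t r - 1 - ln (t r) = 0" using sum_nonneg_eq_0_iff[OF assms(1) nn] r
    by (meson antisym nn sum_nonneg)
  thus "t r = 1" using ln_eq_minus_one[OF pos[OF r]] by simp
qed

text \<open>The product is the determinant of multiplication by \<open>p\<close> on \<open>\<int>[x]/(f)\<close>, which the Vandermonde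
  matrix of the roots of \<open>f\<close> diagonalizes.\<close>

lemma prod_ipoly_roots_int:
  fixes f p :: "int poly"
  assumes f: "lead_coeff f = 1" and d: "card {r. ipoly f r = 0} = degree f"
  shows "(\<Prod>r | ipoly f r = 0. ipoly p r) \<in> \<int>"
proof -
  define d where "d = degree f"
  have f0: "f \<noteq> 0" using f by auto
  have fin: "finite {r. ipoly f r = 0}" using f0 by (intro poly_roots_finite) auto
  obtain h where h: "bij_betw h {..<d} {r. ipoly f r = 0}"
    using ex_bij_betw_nat_finite[OF fin] d unfolding d_def by (metis atLeast0LessThan)
  \<comment> \<open>Row i of \<open>A\<close> will hold the coefficients of x^i * p reduced modulo
    \<open>f\<close>; as \<open>f\<close> is monic, pseudo-division is true division and the entries
    are integers.\<close>
  define s where "s = (\<lambda>i. snd (pseudo_divmod (monom 1 i * p) f))"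
  have s: "monom 1 i * p = f * fst (pseudo_divmod (monom 1 i * p) f) + s i"
    "s i = 0 \<or> degree (s i) < d" for i
    using pseudo_divmod[OF f0, of "monom 1 i * p" "fst (pseudo_divmod (monom 1 i * p) f)" "s i"] f
    unfolding s_def d_def by auto
  define A :: "int mat" where "A = mat d d (\<lambda>(i,j). coeff (s i) j)"
  define V :: "complex mat" where "V = mat d d (\<lambda>(j,l). h l ^ j)"
  define D :: "complex mat" where "D = mat d d (\<lambda>(i,l). if i = l then ipoly p (h l) else 0)"
  let ?A = "map_mat of_int A :: complex mat"
  have cA: "?A \<in> carrier_mat d d" and cV: "V \<in> carrier_mat d d" and cD: "D \<in> carrier_mat d d"
    unfolding A_def V_def D_def by auto
  have root: "ipoly f (h l) = 0" if "l < d" for l using h that by (auto simp: bij_betw_def)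
  have "?A * V = V * D"
  proof (rule eq_matI)
    fix i l assume "i < dim_row (V * D)" "l < dim_col (V * D)"
    hence i: "i < d" and l: "l < d" using cV cD by auto
    have "(?A * V) $$ (i,l) = (\<Sum>j<d. of_int (coeff (s i) j) * h l ^ j)"
      using i l unfolding A_def V_def by (auto simp: scalar_prod_def atLeast0LessThan intro!: sum.cong)
    also have "\<dots> = (\<Sum>j\<le>degree (s i). of_int (coeff (s i) j) * h l ^ j)"
      using s(2)[of i] i by (intro sum.mono_neutral_right) (auto simp: coeff_eq_0 not_le)
    also have "\<dots> = ipoly (s i) (h l)" by (simp add: poly_altdef)
    also have "\<dots> = ipoly (monom 1 i * p) (h l)" 
      by (subst s(1)[of i]) (simp add: hom_distribs root l)
    also have "\<dots> = h l ^ i * ipoly p (h l)" by (simp add: hom_distribs poly_monom)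
    also have "\<dots> = (\<Sum>j<d. h j ^ i * (if j = l then ipoly p (h l) else 0))"
      using l by (simp add: if_distrib cong: if_cong)
    also have "\<dots> = (V * D) $$ (i,l)"
      using i l unfolding D_def V_def by (auto simp: scalar_prod_def atLeast0LessThan intro!: sum.cong)
    finally show "(?A * V) $$ (i,l) = (V * D) $$ (i,l)" .
  qed (use cA cV cD in auto)
  hence "det ?A * det V = det V * det D" by (metis det_mult[OF cA cV] det_mult[OF cV cD])
  \<comment> \<open>A kernel vector of the transpose is a polynomial of degree below d vanishing at
    d distinct points.\<close>
  moreover have "det V \<noteq> 0"
  proof
    assume "det V = 0"
    hence "det (transpose_mat V) = 0" using det_transpose[OF cV] by simp
    then obtain v where v: "v \<in> carrier_vec d" "v \<noteq> 0\<^sub>v d" "transpose_mat V *\<^sub>v v = 0\<^sub>v d"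
      using det_0_iff_vec_prod_zero[of "transpose_mat V" d] cV by auto
    define q where "q = (\<Sum>j<d. monom (v $ j) j)"
    have cq: "coeff q j = (if j < d then v $ j else 0)" for j
      unfolding q_def by (auto simp: coeff_sum)
    have "poly q (h l) = 0" if l: "l < d" for l
    proof -
      have "0 = (transpose_mat V *\<^sub>v v) $ l" using v l by simp
      also have "\<dots> = (\<Sum>j<d. h l ^ j * v $ j)" using l v(1) unfolding V_def
        by (auto simp: scalar_prod_def atLeast0LessThan intro!: sum.cong)
      also have "\<dots> = poly q (h l)" unfolding q_def by (simp add: poly_sum poly_monom mult.commute)
      finally show ?thesis by simp
    qed
    hence "h ` {..<d} \<subseteq> {r. poly q r = 0}" by blast
    hence sub: "{r. ipoly f r = 0} \<subseteq> {r. poly q r = 0}" using bij_betw_imp_surj_on[OF h] by simp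
    obtain j where j: "j < d" "v $ j \<noteq> 0" using v by (metis carrier_vecD eq_vecI index_zero_vec)
    hence q0: "q \<noteq> 0" using cq[of j] by auto
    have "degree q < d" using j(1) cq by (intro le_less_trans[OF degree_le, of "d - 1"]) auto
    moreover have "d \<le> card {r. poly q r = 0}" 
      using card_mono[OF poly_roots_finite[OF q0] sub] assms(2) d_def by simp
    ultimately show False using card_poly_roots_bound[OF q0] by simp
  qed
  ultimately have "det D = of_int (det A)" by (metis mult.commute mult_left_cancel of_int_hom.hom_det)
  also have "det D = (\<Prod>i<d. ipoly p (h i))"
  proof -
    have "det D = prod_list (diag_mat D)"
      using cD by (intro det_upper_triangular[of _ d]) (auto simp: D_def)
    also have "\<dots> = (\<Prod>i<d. ipoly p (h i))" unfolding diag_mat_def using cD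
      by (simp add: D_def atLeast0LessThan flip: prod.distinct_set_conv_list)
    finally show ?thesis .
  qed
  also have "\<dots> = (\<Prod>r | ipoly f r = 0. ipoly p r)" by (rule prod.reindex_bij_betw[OF h])
  finally show ?thesis by simp
qed

text \<open>\<open>\<tau>\<close> is the average over the conjugates; the bound is the inequality of arithmetic and geometric
  means applied to the norm of \<open>x\<close>, a non-zero integer.\<close>

theorem cyclotomic_normalized_trace:
  fixes \<zeta> :: complex
  assumes n: "n > 0" and z: "\<zeta> ^ n = 1"
  defines "R \<equiv> range (\<lambda>p. ipoly p \<zeta>)"
  obtains \<tau> :: "complex \<Rightarrow> real" where
    "\<And>x y. x \<in> R \<Longrightarrow> y \<in> R \<Longrightarrow> \<tau> (x + y) = \<tau> x + \<tau> y"
    "\<tau> 1 = 1"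
    "\<And>x. x \<in> R \<Longrightarrow> x \<noteq> 0 \<Longrightarrow> \<tau> (x * cnj x) \<ge> 1"
    "\<And>x. x \<in> R \<Longrightarrow> \<tau> (x * cnj x) = 1 \<Longrightarrow> x * cnj x = 1"
proof -
  obtain f :: "int poly" where f: "lead_coeff f = 1" "ipoly f \<zeta> = 0" "degree f > 0"
    and fd: "\<And>p. ipoly p \<zeta> = 0 \<Longrightarrow> f dvd p"
    and fm: "\<And>p. p \<noteq> 0 \<Longrightarrow> ipoly p \<zeta> = 0 \<Longrightarrow> degree f \<le> degree p"
    by (rule root_of_unity_minimal_int_poly[OF n z]) (rule that)
  define C where "C = {r. ipoly f r = 0}"
  have f0: "f \<noteq> 0" using f by auto
  have finC: "finite C" unfolding C_def using f0 by (intro poly_roots_finite) auto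
  have zC: "\<zeta> \<in> C" using f C_def by simp
  define X :: "int poly" where "X = monom 1 n - 1"
  have Xr: "ipoly X r = r ^ n - 1" for r by (simp add: X_def hom_distribs poly_monom)
  have dX: "degree X = n" unfolding X_def using n
    by (metis degree_1 degree_add_eq_left degree_minus degree_monom_eq diff_conv_add_uminus zero_neq_one)
  have X0: "X \<noteq> 0" using dX n by auto
  obtain g where g: "X = f * g" using fd[of X] Xr z by (auto elim: dvdE)
  have g0: "g \<noteq> 0" using X0 g by auto
  have fg: "ipoly f r * ipoly g r = r ^ n - 1" for r
    using Xr[of r] unfolding g by (simp add: hom_distribs)
  have Cn: "r ^ n = 1" if "r \<in> C" for r
    using that fg[of r] unfolding C_def by simp
  \<comment> \<open>The roots of \<open>f\<close> are distinct by counting: x^n - 1 has n roots,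
    \<open>g\<close> accounts for at most its degree, so \<open>f\<close> has as many roots as its
    degree.\<close>
  have "{r::complex. r ^ n = 1} = C \<union> {r. ipoly g r = 0}"
  proof -
    have "r ^ n = 1 \<longleftrightarrow> ipoly f r = 0 \<or> ipoly g r = 0" for r
      using fg[of r] by (metis diff_eq_eq add_0 mult_eq_0_iff eq_iff_diff_eq_0)
    thus ?thesis unfolding C_def by blast
  qed
  hence "n \<le> card C + card {r. ipoly g r = 0}" using card_roots_unity_eq[OF n] by (metis card_Un_le)
  moreover have "card {r. ipoly g r = 0} \<le> degree g"
    using card_poly_roots_bound[of "of_int_poly g :: complex poly"] g0 by simp
  moreover have "card C \<le> degree f" unfolding C_def
    using card_poly_roots_bound[of "of_int_poly f :: complex poly"] f0 by simp
  moreover have "n = degree f + degree g" using dX g f0 g0 by (simp add: degree_mult_eq)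
  ultimately have cC: "card C = degree f" by linarith
  have C0: "card C > 0" using cC f by simp
  have wd: "ipoly p r = ipoly q r" if "ipoly p \<zeta> = ipoly q \<zeta>" "r \<in> C" for p q r
  proof -
    have "f dvd p - q" using that by (intro fd) (simp add: hom_distribs)
    then obtain k where "p - q = f * k" by (auto elim: dvdE)
    from arg_cong[OF this, of "\<lambda>p. ipoly p r"] show ?thesis using that(2) by (simp add: hom_distribs C_def)
  qed
  \<comment> \<open>The norm cannot vanish: r has its own minimal polynomial \<open>f'\<close>, a
    divisor of \<open>f\<close>. If \<open>f'\<close> missed \<zeta>, the cofactor would kill
    \<zeta> in too small a degree; hence \<open>f\<close> divides \<open>f'\<close>, which divides
    p.\<close>
  have nz: "ipoly p r \<noteq> 0" if p: "ipoly p \<zeta> \<noteq> 0" and r: "r \<in> C" for p r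
  proof
    assume pr: "ipoly p r = 0"
    obtain f' :: "int poly" where f': "lead_coeff f' = 1" "ipoly f' r = 0" "degree f' > 0"
      and fd': "\<And>p. ipoly p r = 0 \<Longrightarrow> f' dvd p"
      by (rule root_of_unity_minimal_int_poly[OF n Cn[OF r]]) (rule that)
    obtain k where k: "f = f' * k" using fd'[of f] r C_def by (auto elim: dvdE)
    have nk: "f' \<noteq> 0" "k \<noteq> 0" using f0 k by auto
    have "ipoly f' \<zeta> = 0"
    proof (rule ccontr)
      assume "ipoly f' \<zeta> \<noteq> 0"
      hence "ipoly k \<zeta> = 0" using arg_cong[OF k, of "\<lambda>p. ipoly p \<zeta>"] f by (simp add: hom_distribs)
      from fm[OF nk(2) this] show False using k f'(3) nk by (simp add: degree_mult_eq)
    qed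
    hence "f dvd p" using fd'[OF pr] fd[of f'] dvd_trans by blast
    thus False using p f by (auto simp: hom_distribs elim!: dvdE)
  qed
  \<comment> \<open>A chosen representative; by \<open>wd\<close> its values at the conjugates do
    not depend on the choice.\<close>
  define P where "P = (\<lambda>x. SOME p. ipoly p \<zeta> = x)"
  have P: "ipoly (P x) \<zeta> = x" if "x \<in> R" for x
    using that someI[of "\<lambda>p. ipoly p \<zeta> = x"] unfolding P_def R_def by auto
  define \<tau> where "\<tau> = (\<lambda>x. Re (\<Sum>r\<in>C. ipoly (P x) r) / card C)"
  have \<tau>: "\<tau> (ipoly p \<zeta>) = Re (\<Sum>r\<in>C. ipoly p r) / card C" for p
  proof -
    have "ipoly (P (ipoly p \<zeta>)) \<zeta> = ipoly p \<zeta>" by (rule P) (simp add: R_def)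
    hence "(\<Sum>r\<in>C. ipoly (P (ipoly p \<zeta>)) r) = (\<Sum>r\<in>C. ipoly p r)" by (rule sum.cong[OF refl wd])
    thus ?thesis unfolding \<tau>_def by simp
  qed
  have \<tau>n: "\<tau> (ipoly p \<zeta> * cnj (ipoly p \<zeta>)) = (\<Sum>r\<in>C. (cmod (ipoly p r))\<^sup>2) / card C" for p
  proof -
    \<comment> \<open>x * cnj x as one integer polynomial, valid at every n-th root of unity at
      once.\<close>
    define p' where "p' = p * pcompose p (monom 1 (n - 1))"
    have p': "ipoly p' r = ipoly p r * cnj (ipoly p r)" if "r ^ n = 1" for r
      unfolding p'_def of_int_poly_hom.hom_mult poly_mult ipoly_pcompose ipoly_monom_cnj[OF n that]
        ipoly_cnj ..
    have "\<tau> (ipoly p \<zeta> * cnj (ipoly p \<zeta>)) = Re (\<Sum>r\<in>C. ipoly p' r) / card C"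
      using \<tau>[of p'] p'[OF z] by simp
    also have "(\<Sum>r\<in>C. ipoly p' r) = (\<Sum>r\<in>C. of_real ((cmod (ipoly p r))\<^sup>2))"
      by (intro sum.cong) (simp_all only: p' Cn complex_norm_square)
    finally show ?thesis by (simp flip: of_real_power of_real_sum)
  qed
  have N: "(\<Prod>r\<in>C. (cmod (ipoly p r))\<^sup>2) \<ge> 1" if p: "ipoly p \<zeta> \<noteq> 0" for p
  proof -
    obtain k where k: "(\<Prod>r\<in>C. ipoly p r) = of_int k"
      using prod_ipoly_roots_int[OF f(1), of p] cC unfolding C_def by (auto elim: Ints_cases)
    have "(\<Prod>r\<in>C. ipoly p r) \<noteq> 0" using nz[OF p] finC by simp
    hence "k \<noteq> 0" using k by auto
    hence "cmod (\<Prod>r\<in>C. ipoly p r) \<ge> 1" unfolding k by simp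
    hence "(cmod (\<Prod>r\<in>C. ipoly p r))\<^sup>2 \<ge> 1" by simp
    thus ?thesis by (simp only: prod_power_distrib flip: prod_norm)
  qed
  show ?thesis
  proof (rule that[of \<tau>])
    fix x y assume "x \<in> R" "y \<in> R"
    then obtain p q where pq: "x = ipoly p \<zeta>" "y = ipoly q \<zeta>" unfolding R_def by auto
    hence "x + y = ipoly (p + q) \<zeta>" by (simp add: hom_distribs)
    thus "\<tau> (x + y) = \<tau> x + \<tau> y" unfolding pq
      by (simp only: \<tau>) (simp add: hom_distribs sum.distrib add_divide_distrib)
  next
    show "\<tau> 1 = 1" using \<tau>[of 1] C0 by simp
  next
    fix x assume "x \<in> R" "x \<noteq> 0"
    then obtain p where p: "x = ipoly p \<zeta>" "ipoly p \<zeta> \<noteq> 0" unfolding R_def by auto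
    show "\<tau> (x * cnj x) \<ge> 1" unfolding p(1) \<tau>n
      using am_gm_prod_ge_1(1)[OF finC _ N[OF p(2)]] nz[OF p(2)] C0 by (simp add: field_simps)
  next
    fix x assume "x \<in> R" and e: "\<tau> (x * cnj x) = 1"
    then obtain p where p: "x = ipoly p \<zeta>" unfolding R_def by auto
    have s: "(\<Sum>r\<in>C. (cmod (ipoly p r))\<^sup>2) = card C" using e C0 unfolding p \<tau>n by (simp add: field_simps)
    have "ipoly p \<zeta> \<noteq> 0"
    proof
      assume "ipoly p \<zeta> = 0"
      hence "(\<Sum>r\<in>C. (cmod (ipoly p r))\<^sup>2) = 0" using wd[of p 0] by simp
      thus False using s C0 by simp
    qed
    hence "(cmod (ipoly p \<zeta>))\<^sup>2 = 1"
      using am_gm_prod_ge_1(2)[OF finC _ N s zC] nz by simp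
    thus "x * cnj x = 1" unfolding p by (simp flip: complex_norm_square of_real_power)
  qed
qed

section \<open>Pauli and Clifford operators on sequences\<close>

abbreviation s2 :: complex where "s2 \<equiv> complex_of_real (sqrt 2)"

lemma s2_sq [simp]: "s2 * s2 = 2" "s2 * (s2 * z) = 2 * z" "s2 \<noteq> 0" "cnj s2 = s2" "s2\<^sup>2 = 2"
proof -
  show *: "s2 * s2 = 2" by (simp flip: of_real_mult)
  show "s2 * (s2 * z) = 2 * z" using * by (metis mult.assoc)
  show "s2\<^sup>2 = 2" using * by (simp add: power2_eq_square)
qed auto

lemma i_mult_i [simp]: "\<i> * (\<i> * z) = - z"
  by (simp flip: mult.assoc)

section \<open>Binary indices under xor and their sign characters\<close>

lemma xor_cancel [simp]: "xor (xor j a) a = (j::nat)" "xor a (xor a j) = (j::nat)" "xor a (xor j a) = (j::nat)"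
proof -
  show *: "xor (xor j a) a = j" for j by (simp add: xor.assoc)
  show "xor a (xor a j) = j" "xor a (xor j a) = j"
    using *[of j] by (simp_all add: xor.commute)
qed

lemma xor_less_2pow: "a < 2 ^ m \<Longrightarrow> b < 2 ^ m \<Longrightarrow> xor a b < (2::nat) ^ m"
  by (metis take_bit_nat_eq_self_iff take_bit_xor)

lemma xor_2pow_eq_add: "j < 2 ^ m \<Longrightarrow> xor j (2 ^ m) = j + (2::nat) ^ m"
proof -
  assume j: "j < 2 ^ m"
  have "and j (2 ^ m) = 0"
    using j by (intro bit_eqI) (auto simp: bit_simps, metis bit_take_bit_iff less_irrefl take_bit_nat_eq_self_iff)
  thus ?thesis by (metis disjunctive_add_eq_xor)
qed

lemma bij_xor: "a < 2 ^ m \<Longrightarrow> bij_betw (\<lambda>j. xor j a) {..<(2::nat) ^ m} {..<2 ^ m}"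
  by (rule bij_betwI[where g = "\<lambda>j. xor j a"]) (auto simp: xor_less_2pow)

lemma xor_eq_0_iff: "xor a b = 0 \<longleftrightarrow> a = (b::nat)"
  by (metis xor_cancel(1) xor_self_eq xor.left_neutral)

text \<open>Upper-half indices are written with xor instead of + so that the halves are swapped by a
  shift of the kind that Pauli operators use.\<close>

lemma sum_lessThan_2pow_Suc:
  fixes f :: "nat \<Rightarrow> 'a :: comm_monoid_add"
  shows "(\<Sum>j<2 ^ Suc m. f j) = (\<Sum>j<2 ^ m. f j) + (\<Sum>j<2 ^ m. f (xor j (2 ^ m)))"
proof -
  have "(\<Sum>j<2 ^ Suc m. f j) = (\<Sum>j<2 ^ m. f j) + (\<Sum>j=2 ^ m..<2 ^ m + 2 ^ m. f j)"
    using sum.union_disjoint[of "{..<(2::nat) ^ m}" "{2 ^ m..<2 ^ m + 2 ^ m}" f]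
    by (simp add: ivl_disj_un_one(2) mult_2 ivl_disj_int)
  also have "(\<Sum>j=2 ^ m..<2 ^ m + 2 ^ m. f j) = (\<Sum>j<2 ^ m. f (j + 2 ^ m))"
    using sum.shift_bounds_nat_ivl[of f 0 "2 ^ m" "2 ^ m"] by (simp add: atLeast0LessThan)
  finally show ?thesis by (simp add: xor_2pow_eq_add)
qed

lemma less_2pow_Suc_cases:
  assumes "J < (2::nat) ^ Suc m"
  obtains "J < 2 ^ m" | j where "j < 2 ^ m" "J = xor j (2 ^ m)"
proof (cases "J < 2 ^ m")
  case False
  hence "J - 2 ^ m < 2 ^ m" "J = (J - 2 ^ m) + 2 ^ m" using assms by auto
  thus ?thesis using that(2) xor_2pow_eq_add by metis
qed (use that in auto)

text \<open>A character of the bit vectors of length m, extended to all naturals by ignoring higher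
  bits; the same function is then a character at every higher level.\<close>

definition pm_character :: "nat \<Rightarrow> (nat \<Rightarrow> complex) \<Rightarrow> bool" where
  "pm_character m \<chi> \<longleftrightarrow> (\<forall>i j. \<chi> (xor i j) = \<chi> i * \<chi> j) \<and> range \<chi> \<subseteq> {1, -1} \<and> (\<forall>j. \<chi> (take_bit m j) = \<chi> j)"

lemma pm_characterD:
  assumes "pm_character m \<chi>"
  shows "\<chi> (xor i j) = \<chi> i * \<chi> j" "\<chi> j = 1 \<or> \<chi> j = -1" "\<chi> (take_bit m j) = \<chi> j"
    "\<chi> j * \<chi> j = 1" "\<chi> j * (\<chi> j * z) = z" "\<chi> 0 = 1" "cnj (\<chi> j) = \<chi> j" "\<chi> j \<noteq> 0"
proof -
  show c: "\<chi> (xor i j) = \<chi> i * \<chi> j" for i j using assms unfolding pm_character_def by simp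
  show pm: "\<chi> j = 1 \<or> \<chi> j = -1" for j using assms unfolding pm_character_def by blast
  show "\<chi> (take_bit m j) = \<chi> j" using assms unfolding pm_character_def by simp
  show *: "\<chi> j * \<chi> j = 1" using pm[of j] by auto
  show "\<chi> j * (\<chi> j * z) = z" using * by (simp flip: mult.assoc)
  show "\<chi> 0 = 1" using c[of 0 0] pm[of 0] by auto
  show "cnj (\<chi> j) = \<chi> j" "\<chi> j \<noteq> 0" using pm[of j] by auto
qed

lemma pm_character_Suc: "pm_character m \<chi> \<Longrightarrow> pm_character (Suc m) \<chi>"
  unfolding pm_character_def 
  by (metis take_bit_take_bit min.absorb1 le_SucI order_refl)

lemma pm_character_one: "pm_character m (\<lambda>_. 1)"
  unfolding pm_character_def by auto

lemma pm_character_bit: "n < m \<Longrightarrow> pm_character m (\<lambda>j. if bit j n then -1 else 1)"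
  unfolding pm_character_def by (auto simp: bit_simps)

lemma pm_character_exists:
  assumes "J \<noteq> 0" "J < 2 ^ m" "s = 1 \<or> s = -1"
  obtains \<chi> where "pm_character m \<chi>" "\<chi> J = s"
proof (cases "s = 1")
  case True thus ?thesis using that pm_character_one by blast
next
  case False
  obtain n where n: "bit J n" using assms(1) using bit_eqI[of J 0] by auto
  have "n < m" using assms(2) n by (metis bit_take_bit_iff take_bit_nat_eq_self_iff)
  thus ?thesis using that[OF pm_character_bit[of n m]] n False assms(3) by auto
qed

text \<open>The triple \<open>(k, a, \<chi>)\<close> stands for the Pauli operator sending the basis vector
  \<open>e\<^sub>j\<close> to \<open>\<i>\<^sup>k \<chi>(j) e\<^bsub>j xor a\<^esub>\<close>. Functions of level \<open>m\<close> act on each block of length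
  \<open>2\<^sup>m\<close>, which makes tensoring with an identity matrix invisible.\<close>

definition herm_pauli :: "nat \<Rightarrow> nat \<Rightarrow> nat \<Rightarrow> (nat \<Rightarrow> complex) \<Rightarrow> bool" where
  "herm_pauli m k a \<chi> \<longleftrightarrow> pm_character m \<chi> \<and> a < 2 ^ m \<and> (-1) ^ k * \<chi> a = 1"

definition pauli_act :: "nat \<Rightarrow> nat \<Rightarrow> (nat \<Rightarrow> complex) \<Rightarrow> (nat \<Rightarrow> complex) \<Rightarrow> nat \<Rightarrow> complex" where
  "pauli_act k a \<chi> v j = \<i> ^ k * \<chi> (xor j a) * v (xor j a)"

text \<open>For P with P^2 = 1 this is exp(i pi P / 4). Its square is i P, and replacing k by k + 2
  replaces P by -P and so gives the inverse.\<close>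

definition tgate :: "nat \<Rightarrow> nat \<Rightarrow> (nat \<Rightarrow> complex) \<Rightarrow> (nat \<Rightarrow> complex) \<Rightarrow> nat \<Rightarrow> complex" where
  "tgate k a \<chi> v j = (v j + \<i> * pauli_act k a \<chi> v j) / s2"

lemma herm_pauliD:
  assumes "herm_pauli m k a \<chi>"
  shows "pm_character m \<chi>" "a < 2 ^ m" "\<chi> a = (-1) ^ k" "\<i> ^ k * \<i> ^ k = (-1) ^ k"
    "\<i> ^ k * \<i> ^ k * \<chi> a = 1"
proof -
  show "pm_character m \<chi>" "a < 2 ^ m" using assms unfolding herm_pauli_def by auto
  have "\<chi> a = (-1) ^ k * ((-1) ^ k * \<chi> a)" by (simp flip: mult.assoc power_mult_distrib)
  thus *: "\<chi> a = (-1) ^ k" using assms unfolding herm_pauli_def by simp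
  show **: "\<i> ^ k * \<i> ^ k = (-1) ^ k" by (simp flip: power_mult_distrib)
  show "\<i> ^ k * \<i> ^ k * \<chi> a = 1" unfolding * ** by (simp flip: power_mult_distrib)
qed

lemma herm_pauli_Suc: "herm_pauli m k a \<chi> \<Longrightarrow> herm_pauli (Suc m) k a \<chi>"
  unfolding herm_pauli_def using pm_character_Suc[of m \<chi>] by auto

lemma herm_pauli_add2: "herm_pauli m k a \<chi> \<Longrightarrow> herm_pauli m (k + 2) a \<chi>"
  unfolding herm_pauli_def by auto

text \<open>The square multiplies by (-1)^k * \<chi> a, so the last condition in
  \<open>herm_pauli\<close> says exactly that P is an involution, equivalently Hermitian.\<close>

lemma pauli_act_twice:
  assumes "herm_pauli m k a \<chi>"
  shows "pauli_act k a \<chi> (pauli_act k a \<chi> v) = v"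
proof
  fix j
  note h = herm_pauliD[OF assms]
  have "pauli_act k a \<chi> (pauli_act k a \<chi> v) j = (\<i> ^ k * \<i> ^ k) * (\<chi> (xor j a) * \<chi> j) * v j"
    unfolding pauli_act_def by simp
  also have "\<chi> (xor j a) * \<chi> j = \<chi> a"
    using pm_characterD(1,4)[OF h(1), of j] by (simp add: mult_ac)
  finally show "pauli_act k a \<chi> (pauli_act k a \<chi> v) j = v j" using h(5) by simp
qed

lemma pauli_act_linear:
  "pauli_act k a \<chi> (\<lambda>j. x * u j + y * v j) = (\<lambda>j. x * pauli_act k a \<chi> u j + y * pauli_act k a \<chi> v j)"
  by (auto simp: pauli_act_def algebra_simps)

lemma tgate_linear:
  "tgate k a \<chi> (\<lambda>j. x * u j + y * v j) = (\<lambda>j. x * tgate k a \<chi> u j + y * tgate k a \<chi> v j)"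
  by (auto simp: tgate_def pauli_act_linear field_simps)

lemma pauli_act_tgate:
  assumes "herm_pauli m k a \<chi>"
  shows "pauli_act k a \<chi> (tgate k a \<chi> v) j = (pauli_act k a \<chi> v j + \<i> * v j) / s2"
proof -
  have "pauli_act k a \<chi> (tgate k a \<chi> v) j = (pauli_act k a \<chi> v j + \<i> * pauli_act k a \<chi> (pauli_act k a \<chi> v) j) / s2"
    unfolding tgate_def by (simp add: pauli_act_def field_simps)
  thus ?thesis by (simp add: pauli_act_twice[OF assms])
qed

lemma tgate_twice:
  assumes "herm_pauli m k a \<chi>"
  shows "tgate k a \<chi> (tgate k a \<chi> v) j = \<i> * pauli_act k a \<chi> v j"
proof -
  have "tgate k a \<chi> (tgate k a \<chi> v) j
      = ((v j + \<i> * pauli_act k a \<chi> v j) / s2 + \<i> * ((pauli_act k a \<chi> v j + \<i> * v j) / s2)) / s2"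
    unfolding tgate_def[of _ _ _ "tgate k a \<chi> v"] pauli_act_tgate[OF assms] by (simp add: tgate_def)
  also have "\<dots> = \<i> * pauli_act k a \<chi> v j" by (simp add: field_simps)
  finally show ?thesis .
qed

lemma tgate_inverse:
  assumes "herm_pauli m k a \<chi>"
  shows "tgate (k + 2) a \<chi> (tgate k a \<chi> v) = v"
proof
  fix j
  have "pauli_act (k + 2) a \<chi> w j = - pauli_act k a \<chi> w j" for w
    by (simp add: pauli_act_def power_add)
  hence "tgate (k + 2) a \<chi> (tgate k a \<chi> v) j
      = ((v j + \<i> * pauli_act k a \<chi> v j) / s2 - \<i> * ((pauli_act k a \<chi> v j + \<i> * v j) / s2)) / s2"
    unfolding tgate_def[of _ _ _ "tgate k a \<chi> v"] by (simp add: pauli_act_tgate[OF assms]) (simp add: tgate_def)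
  also have "\<dots> = v j" by (simp add: field_simps)
  finally show "tgate (k + 2) a \<chi> (tgate k a \<chi> v) j = v j" .
qed

lemma tgate_sum_squares:
  assumes "herm_pauli m k a \<chi>"
  shows "(\<Sum>j<2 ^ m. tgate k a \<chi> v j * cnj (tgate k a \<chi> v j)) = (\<Sum>j<2 ^ m. v j * cnj (v j))"
proof -
  note h = herm_pauliD[OF assms]
  define p where "p = pauli_act k a \<chi> v"
  have ik: "\<i> ^ k * cnj (\<i> ^ k) = 1" by (simp flip: power_mult_distrib)
  have pp: "(\<Sum>j<2 ^ m. p j * cnj (p j)) = (\<Sum>j<2 ^ m. v j * cnj (v j))"
  proof -
    have "p j * cnj (p j) = v (xor j a) * cnj (v (xor j a))" for j
    proof -
      have "p j * cnj (p j) = (\<i> ^ k * cnj (\<i> ^ k)) * (\<chi> (xor j a) * cnj (\<chi> (xor j a))) * (v (xor j a) * cnj (v (xor j a)))"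
        unfolding p_def pauli_act_def by (simp add: mult_ac)
      thus ?thesis unfolding ik pm_characterD(4,7)[OF h(1)] by simp
    qed
    thus ?thesis using sum.reindex_bij_betw[OF bij_xor[OF h(2)], of "\<lambda>j. v j * cnj (v j)"] by simp
  qed
  \<comment> \<open>Hermitian symmetry of P, which makes the cross terms cancel after
    summation.\<close>
  have pv: "(\<Sum>j<2 ^ m. p j * cnj (v j)) = (\<Sum>j<2 ^ m. v j * cnj (p j))"
  proof -
    have "p (xor j a) * cnj (v (xor j a)) = v j * cnj (p j)" for j
    proof -
      have "\<i> ^ k * \<chi> j = cnj (\<i> ^ k) * \<chi> (xor j a)"
      proof -
        have "cnj (\<i> ^ k) * \<chi> (xor j a) = cnj (\<i> ^ k) * (\<i> ^ k * \<i> ^ k * \<chi> a) * \<chi> (xor j a)" using h(5) by simp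
        also have "\<dots> = (\<i> ^ k * cnj (\<i> ^ k)) * \<i> ^ k * (\<chi> a * \<chi> a) * \<chi> j"
          by (simp add: pm_characterD(1)[OF h(1)] mult_ac)
        finally show ?thesis unfolding ik pm_characterD(4)[OF h(1)] by simp
      qed
      thus ?thesis unfolding p_def pauli_act_def by (simp add: pm_characterD(7)[OF h(1)])
    qed
    thus ?thesis using sum.reindex_bij_betw[OF bij_xor[OF h(2)], of "\<lambda>j. p j * cnj (v j)"] by simp
  qed
  have "tgate k a \<chi> v j * cnj (tgate k a \<chi> v j)
     = (v j * cnj (v j) + p j * cnj (p j) + \<i> * (p j * cnj (v j) - v j * cnj (p j))) / 2" for j
    unfolding tgate_def p_def[symmetric] by (simp add: field_simps)
  hence "(\<Sum>j<2 ^ m. tgate k a \<chi> v j * cnj (tgate k a \<chi> v j))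
      = (\<Sum>j<2 ^ m. (v j * cnj (v j) + p j * cnj (p j) + \<i> * (p j * cnj (v j) - v j * cnj (p j))) / 2)"
    by (simp only:)
  also have "\<dots> = ((\<Sum>j<2 ^ m. v j * cnj (v j)) + (\<Sum>j<2 ^ m. p j * cnj (p j))
          + \<i> * ((\<Sum>j<2 ^ m. p j * cnj (v j)) - (\<Sum>j<2 ^ m. v j * cnj (p j)))) / 2"
    by (simp only: sum.distrib sum_subtractf flip: sum_divide_distrib sum_distrib_left)
  finally show ?thesis unfolding pp pv by simp
qed

text \<open>Operators on sequences instead of matrices: an operator of level m is literally one of
  level Suc m, acting on both halves alike. The inductions on m rely on this.\<close>

inductive clifford_op :: "nat \<Rightarrow> ((nat \<Rightarrow> complex) \<Rightarrow> nat \<Rightarrow> complex) \<Rightarrow> bool" for m where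
  id: "clifford_op m (\<lambda>v. v)"
| step: "clifford_op m W \<Longrightarrow> herm_pauli m k a \<chi> \<Longrightarrow> clifford_op m (\<lambda>v. tgate k a \<chi> (W v))"

lemma clifford_op_tgate: "herm_pauli m k a \<chi> \<Longrightarrow> clifford_op m (tgate k a \<chi>)"
  using clifford_op.step[OF clifford_op.id] by simp

lemma clifford_op_compose:
  "clifford_op m W \<Longrightarrow> clifford_op m W' \<Longrightarrow> clifford_op m (\<lambda>v. W (W' v))"
  by (induction rule: clifford_op.induct) (auto intro: clifford_op.step)

lemma clifford_op_Suc: "clifford_op m W \<Longrightarrow> clifford_op (Suc m) W"
  by (induction rule: clifford_op.induct) (auto intro: clifford_op.intros herm_pauli_Suc)

lemma clifford_op_linear:
  "clifford_op m W \<Longrightarrow> W (\<lambda>j. x * u j + y * v j) = (\<lambda>j. x * W u j + y * W v j)"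
  by (induction rule: clifford_op.induct) (auto simp: tgate_linear)

lemma clifford_op_scale: "clifford_op m W \<Longrightarrow> W (\<lambda>j. x * u j) = (\<lambda>j. x * W u j)"
  using clifford_op_linear[of m W x u 0 u] by simp

lemma clifford_op_cong:
  "clifford_op m W \<Longrightarrow> (\<And>j. j < 2 ^ m \<Longrightarrow> u j = v j) \<Longrightarrow> j < 2 ^ m \<Longrightarrow> W u j = W v j"
proof (induction arbitrary: j rule: clifford_op.induct)
  case (step W k a \<chi>)
  have "xor j a < 2 ^ m" using herm_pauliD(2)[OF step(2)] step by (intro xor_less_2pow)
  thus ?case using step unfolding tgate_def pauli_act_def by simp
qed auto

text \<open>A shift by a multiple of 2^m only permutes blocks, and operators of level m treat all
  blocks alike. For b = 2^m it says that W acts on the upper half as on the lower.\<close>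

lemma clifford_op_shift:
  assumes "take_bit m b = 0"
  shows "clifford_op m W \<Longrightarrow> W (\<lambda>j. v (xor j b)) = (\<lambda>j. W v (xor j b))"
proof (induction rule: clifford_op.induct)
  case (step W k a \<chi>)
  note h = herm_pauliD[OF step(2)]
  have "\<chi> (xor j b) = \<chi> j" for j
    using pm_characterD(3)[OF h(1), of "xor j b"] pm_characterD(3)[OF h(1), of j] assms by simp
  hence "\<chi> (xor (xor j b) a) = \<chi> (xor j a)" for j by (metis xor.assoc xor.commute)
  moreover have "xor (xor j b) a = xor (xor j a) b" for j by (metis xor.assoc xor.commute)
  ultimately show ?case using step unfolding tgate_def[abs_def] pauli_act_def by auto
qed auto

definition e0 :: "nat \<Rightarrow> nat \<Rightarrow> complex" where "e0 m j = (if j = 0 then s2 ^ m else 0)"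

lemma tgate_e0:
  assumes "J \<noteq> 0" "J < 2 ^ m"
  obtains l \<chi> where "herm_pauli m l J \<chi>"
    "\<And>j. tgate l J \<chi> (e0 m) j = (e0 m j + \<i> ^ k * e0 m (xor j J)) / s2"
proof -
  \<comment> \<open>The exponent k + 3 absorbs the factor i of the gate, as i^(k + 4) = i^k. The
    sign at J is then forced by Hermitian symmetry, and J \<noteq> 0 makes it available.\<close>
  obtain \<chi> where c: "pm_character m \<chi>" "\<chi> J = (-1) ^ (k + 3)"
    using pm_character_exists[OF assms, of "(-1) ^ (k + 3)"] by (metis neg_one_even_power neg_one_odd_power)
  have "herm_pauli m (k + 3) J \<chi>" unfolding herm_pauli_def c(2) using c assms
    by (simp flip: power_mult_distrib)
  moreover have "\<i> * pauli_act (k + 3) J \<chi> (e0 m) j = \<i> ^ k * e0 m (xor j J)" for j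
    unfolding pauli_act_def e0_def using pm_characterD(6)[OF c(1)] by (auto simp: power_add eval_nat_numeral simp flip: mult.assoc)
  ultimately show ?thesis using that[of "k + 3" \<chi>] unfolding tgate_def[abs_def] by simp
qed

section \<open>The lattice of a cyclotomic ring\<close>

text \<open>What is used of the cyclotomic ring. The lower bound for \<tau> and its equality case
  stand in for the Galois conjugates, which do not appear again.\<close>

locale trace_ring =
  fixes R :: "complex set" and \<tau> :: "complex \<Rightarrow> real"
  assumes one_R [simp]: "1 \<in> R"
    and add_R [simp]: "x \<in> R \<Longrightarrow> y \<in> R \<Longrightarrow> x + y \<in> R"
    and mult_R [simp]: "x \<in> R \<Longrightarrow> y \<in> R \<Longrightarrow> x * y \<in> R"
    and uminus_R [simp]: "x \<in> R \<Longrightarrow> - x \<in> R"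
    and cnj_R [simp]: "x \<in> R \<Longrightarrow> cnj x \<in> R"
    and zeta8_R [simp]: "zeta8 \<in> R"
    and \<tau>_add: "x \<in> R \<Longrightarrow> y \<in> R \<Longrightarrow> \<tau> (x + y) = \<tau> x + \<tau> y"
    and \<tau>_one [simp]: "\<tau> 1 = 1"
    and \<tau>_ge: "x \<in> R \<Longrightarrow> x \<noteq> 0 \<Longrightarrow> \<tau> (x * cnj x) \<ge> 1"
    and \<tau>_eq: "x \<in> R \<Longrightarrow> \<tau> (x * cnj x) = 1 \<Longrightarrow> x * cnj x = 1"

lemma zeta8_alt: "zeta8 = (1 + \<i>) / s2"
proof -
  have "zeta8 = cis (pi / 4)" unfolding zeta8_def cis_conv_exp by (simp add: mult_ac)
  also have "\<dots> = (1 + \<i>) / s2"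
    by (auto simp: complex_eq_iff cos_45 sin_45 Re_divide Im_divide power2_eq_square field_simps)
  finally show ?thesis .
qed

context trace_ring
begin

lemma zero_R [simp]: "0 \<in> R"
  using add_R[OF one_R uminus_R[OF one_R]] by simp

lemma diff_R [simp]: "x \<in> R \<Longrightarrow> y \<in> R \<Longrightarrow> x - y \<in> R"
  using add_R[of x "- y"] by simp

lemma i_R [simp]: "\<i> \<in> R"
proof -
  have "zeta8 * zeta8 = \<i>" unfolding zeta8_alt by (simp add: field_simps)
  thus ?thesis using mult_R[OF zeta8_R zeta8_R] by simp
qed

lemma s2_R [simp]: "s2 \<in> R"
proof -
  have "zeta8 + cnj zeta8 = s2" unfolding zeta8_alt by (simp add: field_simps)
  thus ?thesis using add_R[OF zeta8_R cnj_R[OF zeta8_R]] by simp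
qed

lemma one_plus_i_R: "(1 + \<i>) / s2 \<in> R" using zeta8_R unfolding zeta8_alt .

lemma power_R [simp]: "x \<in> R \<Longrightarrow> x ^ n \<in> R"
  by (induction n) auto

lemma sum_R: "(\<And>j. j \<in> A \<Longrightarrow> f j \<in> R) \<Longrightarrow> sum f A \<in> R"
  by (induction A rule: infinite_finite_induct) auto

lemma \<tau>_zero [simp]: "\<tau> 0 = 0"
  using \<tau>_add[of 0 0] by simp

lemma \<tau>_double: "x \<in> R \<Longrightarrow> \<tau> (2 * x) = 2 * \<tau> x"
  using \<tau>_add[of x x] by simp

lemma \<tau>_nonneg: "x \<in> R \<Longrightarrow> \<tau> (x * cnj x) \<ge> 0"
  using \<tau>_ge[of x] by (cases "x = 0") auto

lemma \<tau>_sum: "(\<And>j. j \<in> A \<Longrightarrow> f j \<in> R) \<Longrightarrow> \<tau> (sum f A) = (\<Sum>j\<in>A. \<tau> (f j))"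
  by (induction A rule: infinite_finite_induct) (auto simp: \<tau>_add sum_R)

lemma \<tau>_two_power: "\<tau> (2 ^ m) = 2 ^ m"
  by (induction m) (use \<tau>_double[of "2 ^ _"] add_R[OF one_R one_R] in auto)

text \<open>Defining the lattice by integrality of the zeroth coordinate of all Clifford images makes it
  invariant by construction. The step from \<open>Suc m\<close> to \<open>m\<close> below, which sends \<open>(x, y)\<close> to \<open>y\<close> and
  \<open>(x - y) / \<surd>2\<close>, is one half of the recursive Barnes-Wall construction; the converse is never
  needed.\<close>

definition latt :: "nat \<Rightarrow> (nat \<Rightarrow> complex) \<Rightarrow> bool" where
  "latt m v \<longleftrightarrow> (\<forall>W. clifford_op m W \<longrightarrow> W v 0 \<in> R)"

definition nrm :: "nat \<Rightarrow> (nat \<Rightarrow> complex) \<Rightarrow> real" where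
  "nrm m v = (\<Sum>j<2 ^ m. \<tau> (v j * cnj (v j)))"

lemma latt_cong: "(\<And>j. j < 2 ^ m \<Longrightarrow> u j = v j) \<Longrightarrow> latt m u \<Longrightarrow> latt m v"
  unfolding latt_def using clifford_op_cong[of m _ u v 0] by (metis zero_less_power zero_less_numeral)

lemma latt_linear:
  "latt m u \<Longrightarrow> latt m v \<Longrightarrow> x \<in> R \<Longrightarrow> y \<in> R \<Longrightarrow> latt m (\<lambda>j. x * u j + y * v j)"
  unfolding latt_def by (auto simp: clifford_op_linear)

lemma latt_add: "latt m u \<Longrightarrow> latt m v \<Longrightarrow> latt m (\<lambda>j. u j + v j)"
  using latt_linear[of m u v 1 1] by simp

lemma latt_scale: "latt m u \<Longrightarrow> x \<in> R \<Longrightarrow> latt m (\<lambda>j. x * u j)"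
  using latt_linear[of m u u x 0] by simp

lemma latt_clifford_op: "clifford_op m W \<Longrightarrow> latt m v \<Longrightarrow> latt m (W v)"
  unfolding latt_def using clifford_op_compose by blast

text \<open>The gate of the plain shift by b, applied twice, is i times that shift; it carries
  coordinate b to coordinate 0, where integrality is known by definition.\<close>

lemma latt_pauli_shift:
  assumes v: "latt m v" and b: "b < 2 ^ m" and W: "clifford_op m W"
  shows "W v b \<in> R"
proof -
  have h: "herm_pauli m 0 b (\<lambda>_. 1)" using b pm_character_one unfolding herm_pauli_def by simp
  have "tgate 0 b (\<lambda>_. 1) (tgate 0 b (\<lambda>_. 1) (W v)) 0 \<in> R"
    using clifford_op.step[OF clifford_op.step[OF W h] h] v unfolding latt_def by blast
  hence "\<i> * W v b \<in> R" unfolding tgate_twice[OF h] by (simp add: pauli_act_def)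
  from mult_R[OF uminus_R[OF i_R] this] have "- \<i> * (\<i> * W v b) \<in> R" .
  thus ?thesis by (simp only: i_mult_i minus_mult_left [symmetric] minus_minus)
qed

lemma latt_R: "latt m v \<Longrightarrow> j < 2 ^ m \<Longrightarrow> v j \<in> R"
  using latt_pauli_shift[OF _ _ clifford_op.id] .

lemma latt_upper: "latt (Suc m) v \<Longrightarrow> latt m (\<lambda>j. v (xor j (2 ^ m)))"
  unfolding latt_def[of m]
  using clifford_op_shift[of m "2 ^ m"] latt_pauli_shift[of "Suc m" v "2 ^ m"] clifford_op_Suc
  by (auto simp: take_bit_eq_mod)

lemma latt_half_diff:
  assumes "latt (Suc m) v"
  shows "latt m (\<lambda>j. (v j - v (xor j (2 ^ m))) / s2)"
  unfolding latt_def
proof safe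
  fix W assume W: "clifford_op m W"
  define \<chi> :: "nat \<Rightarrow> complex" where "\<chi> = (\<lambda>j. if bit j m then -1 else 1)"
  \<comment> \<open>The exponent 3 cancels the factor i of the gate, and \<chi> (2^m) = -1 turns its
    sum into a difference at coordinate 0; the same sign makes the triple Hermitian.\<close>
  have h: "herm_pauli (Suc m) 3 (2 ^ m) \<chi>" unfolding herm_pauli_def \<chi>_def
    using pm_character_bit[of m "Suc m"] by (auto simp: bit_simps)
  have "W (\<lambda>j. (v j - v (xor j (2 ^ m))) / s2) 0 = W (\<lambda>j. (1 / s2) * v j + (- 1 / s2) * v (xor j (2 ^ m))) 0"
    by (simp add: diff_divide_distrib)
  also have "\<dots> = (1 / s2) * W v 0 + (- 1 / s2) * W v (2 ^ m)"
    using clifford_op_shift[OF _ W, of "2 ^ m"]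
    by (simp only: clifford_op_linear[OF W]) (simp add: take_bit_eq_mod)
  also have "\<dots> = tgate 3 (2 ^ m) \<chi> (W v) 0"
    unfolding tgate_def pauli_act_def \<chi>_def by (simp add: bit_simps diff_divide_distrib power3_eq_cube)
  also have "\<dots> \<in> R" using clifford_op.step[OF clifford_op_Suc[OF W] h] assms unfolding latt_def by blast
  finally show "W (\<lambda>j. (v j - v (xor j (2 ^ m))) / s2) 0 \<in> R" .
qed

lemma latt_lower:
  assumes "latt (Suc m) v" shows "latt m v"
proof -
  have "latt m (\<lambda>j. s2 * ((v j - v (xor j (2 ^ m))) / s2) + 1 * v (xor j (2 ^ m)))"
    using latt_linear[OF latt_half_diff[OF assms] latt_upper[OF assms] s2_R one_R] .
  thus ?thesis by simp
qed

section \<open>Minimum and minimal vectors of the lattice\<close>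

lemma nrm_Suc: "nrm (Suc m) v = nrm m v + nrm m (\<lambda>j. v (xor j (2 ^ m)))"
  unfolding nrm_def by (rule sum_lessThan_2pow_Suc)

lemma nrm_eq_\<tau>:
  "(\<And>j. j < 2 ^ m \<Longrightarrow> v j \<in> R) \<Longrightarrow> nrm m v = \<tau> (\<Sum>j<2 ^ m. v j * cnj (v j))"
  unfolding nrm_def by (subst \<tau>_sum) auto

lemma nrm_nonneg: "latt m v \<Longrightarrow> nrm m v \<ge> 0"
  unfolding nrm_def by (intro sum_nonneg \<tau>_nonneg latt_R) auto

lemma nrm_zero: "(\<And>j. j < 2 ^ m \<Longrightarrow> v j = 0) \<Longrightarrow> nrm m v = 0"
  unfolding nrm_def by simp

lemma nrm_scale_s2:
  assumes "\<And>j. j < 2 ^ m \<Longrightarrow> v j = s2 * w j \<or> v j = - (s2 * w j)" "\<And>j. j < 2 ^ m \<Longrightarrow> w j \<in> R"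
  shows "nrm m v = 2 * nrm m w"
proof -
  have "\<tau> (v j * cnj (v j)) = 2 * \<tau> (w j * cnj (w j))" if "j < 2 ^ m" for j
  proof -
    have "v j * cnj (v j) = 2 * (w j * cnj (w j))" using assms(1)[OF that] by (auto simp: mult_ac)
    thus ?thesis using \<tau>_double[of "w j * cnj (w j)"] assms(2)[OF that] by simp
  qed
  thus ?thesis unfolding nrm_def by (simp add: sum_distrib_left)
qed

lemma nrm_clifford_op:
  assumes "clifford_op m W" "latt m v"
  shows "nrm m (W v) = nrm m v"
proof -
  have "(\<Sum>j<2 ^ m. W v j * cnj (W v j)) = (\<Sum>j<2 ^ m. v j * cnj (v j))"
    using assms(1) by (induction rule: clifford_op.induct) (auto simp: tgate_sum_squares)
  thus ?thesis using nrm_eq_\<tau>[of m v] nrm_eq_\<tau>[of m "W v"] latt_R[OF assms(2)]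
      latt_R[OF latt_clifford_op[OF assms]] by simp
qed

text \<open>If both halves are nonzero, each contributes 2^m by induction. If one vanishes, the
  other is up to sign sqrt 2 times the half difference, a lattice vector of level m, so its norm is
  twice that of a nonzero lattice vector.\<close>

lemma nrm_ge:
  assumes "latt m v" "j < 2 ^ m" "v j \<noteq> 0"
  shows "nrm m v \<ge> 2 ^ m"
  using assms
proof (induction m arbitrary: v j)
  case 0
  thus ?case using \<tau>_ge[of "v 0"] latt_R[of 0 v 0] by (simp add: nrm_def)
next
  case (Suc m)
  define y where "y = (\<lambda>j. v (xor j (2 ^ m)))"
  define a where "a = (\<lambda>j. (v j - y j) / s2)"
  have l: "latt m v" "latt m y" "latt m a" unfolding y_def a_def
    using latt_lower latt_upper latt_half_diff Suc.prems(1) by auto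
  have n: "nrm (Suc m) v = nrm m v + nrm m y" unfolding y_def by (rule nrm_Suc)
  have ex: "(\<exists>j<2 ^ m. v j \<noteq> 0) \<or> (\<exists>j<2 ^ m. y j \<noteq> 0)"
    using Suc.prems(2,3) by (elim less_2pow_Suc_cases) (auto simp: y_def)
  have nn: "nrm m v \<ge> 0" "nrm m y \<ge> 0" using nrm_nonneg l by auto
  consider "\<exists>j<2 ^ m. v j \<noteq> 0" "\<exists>j<2 ^ m. y j \<noteq> 0" | "\<exists>j<2 ^ m. v j \<noteq> 0" "\<forall>j<2 ^ m. y j = 0"
    | "\<exists>j<2 ^ m. y j \<noteq> 0" "\<forall>j<2 ^ m. v j = 0" using ex by auto
  thus ?case
  proof cases
    case 1
    then obtain i j where "i < 2 ^ m" "v i \<noteq> 0" "j < 2 ^ m" "y j \<noteq> 0" by auto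
    thus ?thesis using Suc.IH[OF l(1)] Suc.IH[OF l(2)] n by fastforce
  next
    case 2
    have "nrm m v = 2 * nrm m a" using 2 latt_R[OF l(3)] by (intro nrm_scale_s2) (auto simp: a_def)
    moreover obtain i where "i < 2 ^ m" "a i \<noteq> 0" using 2 unfolding a_def by auto
    ultimately show ?thesis using Suc.IH[OF l(3)] n nn by fastforce
  next
    case 3
    have "nrm m y = 2 * nrm m a" using 3 latt_R[OF l(3)] by (intro nrm_scale_s2) (auto simp: a_def)
    moreover obtain i where "i < 2 ^ m" "a i \<noteq> 0" using 3 unfolding a_def by auto
    ultimately show ?thesis using Suc.IH[OF l(3)] n nn by fastforce
  qed
qed

text \<open>For u = 1 and u = i both (y - u) / sqrt 2 and (y + u) / sqrt 2 lie in R, with squared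
  absolute values adding up to 2. If none of them vanishes, all have absolute value 1, so y has
  distance sqrt 2 from 1 and from i, which no point of the unit circle has.\<close>

lemma fourth_root_of_unity:
  assumes y: "y \<in> R" and t: "\<tau> (y * cnj y) = 1" and d: "(y - 1) / s2 \<in> R"
  shows "\<exists>k. y = \<i> ^ k"
proof (rule ccontr)
  assume "\<nexists>k. y = \<i> ^ k"
  hence ne: "y \<noteq> \<i> ^ k" for k by blast
  have n: "y * cnj y = 1" using \<tau>_eq[OF y t] .
  have z1: "(y - u) / s2 * cnj ((y - u) / s2) = 1" if u: "u = 1 \<or> u = \<i>" for u
  proof -
    define A where "A = (y - u) / s2"
    define B where "B = (y + u) / s2"
    \<comment> \<open>This is 0 for u = 1 and the conjugate of \<open>zeta8\<close> for u = i, so y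
      is also congruent to i modulo sqrt 2.\<close>
    have "(1 - u) / s2 \<in> R" using u one_plus_i_R cnj_R[OF one_plus_i_R] by auto
    moreover have "A = (y - 1) / s2 + (1 - u) / s2" unfolding A_def by (simp flip: add_divide_distrib)
    ultimately have A: "A \<in> R" using add_R[OF d] by simp
    have uR: "u \<in> R" using u by auto
    have B: "B \<in> R" using add_R[OF A mult_R[OF uR s2_R]] unfolding A_def B_def by (simp add: field_simps)
    have "A \<noteq> 0" using ne[of 0] ne[of 1] u unfolding A_def by auto
    hence A1: "\<tau> (A * cnj A) \<ge> 1" using \<tau>_ge A by auto
    have "B \<noteq> 0" using ne[of 2] ne[of 3] u unfolding B_def by (auto simp: power3_eq_cube add_eq_0_iff2)
    hence B1: "\<tau> (B * cnj B) \<ge> 1" using \<tau>_ge B by auto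
    have "u * cnj u = 1" using u by auto
    hence "A * cnj A + B * cnj B = 2" unfolding A_def B_def using n by (simp add: field_simps)
    hence "\<tau> (A * cnj A) + \<tau> (B * cnj B) = 2"
      using \<tau>_add[of "A * cnj A" "B * cnj B"] A B \<tau>_two_power[of 1] by simp
    hence "\<tau> (A * cnj A) = 1" using A1 B1 by simp
    thus ?thesis using \<tau>_eq[OF A] unfolding A_def by simp
  qed
  have q: "(Re y)\<^sup>2 + (Im y)\<^sup>2 = 1" using n by (simp add: complex_eq_iff power2_eq_square)
  have "(y - u) * cnj (y - u) = 2 * ((y - u) / s2 * cnj ((y - u) / s2))" for u
    by (simp only: complex_cnj_divide s2_sq times_divide_times_eq) simp
  hence "(y - u) * cnj (y - u) = 2" if u: "u = 1 \<or> u = \<i>" for u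
    by (simp only: z1[OF u] mult_1_right)
  hence "(y - 1) * cnj (y - 1) = 2" "(y - \<i>) * cnj (y - \<i>) = 2" by blast+
  from this[THEN arg_cong, of Re] have "(Re y - 1)\<^sup>2 + (Im y)\<^sup>2 = 2" "(Re y)\<^sup>2 + (Im y - 1)\<^sup>2 = 2"
    by (simp_all add: power2_eq_square algebra_simps)
  hence "Re y = 0" "Im y = 0" using q by (auto simp: power2_eq_square algebra_simps)
  thus False using q by simp
qed

lemma latt_e0_lower: "latt (Suc m) (e0 (Suc m)) \<Longrightarrow> latt m (e0 m)"
  by (rule latt_cong[OF _ latt_half_diff[of m "e0 (Suc m)"]]) (auto simp: e0_def xor_2pow_eq_add)

text \<open>Congruence to \<open>e0\<close> modulo sqrt 2 makes both halves of y divisible by sqrt 2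
  within the lattice of level m. The quotients have norms adding up to 2^m, so by
  \<open>nrm_ge\<close> one of them is zero; the other is minimal and again congruent to
  \<open>e0\<close>.\<close>

lemma frame:
  assumes "latt m (e0 m)" "latt m y" "nrm m y = 2 ^ m" "latt m (\<lambda>j. (y j - e0 m j) / s2)"
  shows "\<exists>p<2 ^ m. \<exists>k. \<forall>j<2 ^ m. y j = (if j = p then \<i> ^ k * s2 ^ m else 0)"
  using assms
proof (induction m arbitrary: y)
  case 0
  have "\<exists>k. y 0 = \<i> ^ k"
    using 0 latt_R[OF 0(2), of 0] latt_R[OF 0(4), of 0] by (intro fourth_root_of_unity) (auto simp: nrm_def e0_def)
  thus ?case by auto
next
  case (Suc m)
  define q where "q = (\<lambda>j. y (xor j (2 ^ m)))"
  define p2 where "p2 = (\<lambda>j. y j / s2)"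
  define q2 where "q2 = (\<lambda>j. q j / s2)"
  \<comment> \<open>The half difference of (y - e0) / sqrt 2; it recovers \<open>p2\<close> as s2 *
    d + e0 + q2.\<close>
  define d where "d = (\<lambda>j. (p2 j - e0 m j - q2 j) / s2)"
  have e: "latt m (e0 m)" using latt_e0_lower Suc.prems(1) .
  have e0S: "e0 (Suc m) j = s2 * e0 m j" "e0 (Suc m) (xor j (2 ^ m)) = 0" if "j < 2 ^ m" for j
    using that by (auto simp: e0_def xor_2pow_eq_add)
  have l2: "latt m q2"
    by (rule latt_cong[OF _ latt_upper[OF Suc.prems(4)]]) (auto simp: q2_def q_def e0S)
  have ld: "latt m d"
    by (rule latt_cong[OF _ latt_half_diff[OF Suc.prems(4)]]) (auto simp: d_def p2_def q2_def q_def e0S field_simps)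
  have lp2: "latt m p2"
    by (rule latt_cong[OF _ latt_add[OF latt_add[OF latt_scale[OF ld s2_R] e] l2]]) (auto simp: d_def)
  have n: "nrm (Suc m) y = nrm m y + nrm m q" unfolding q_def by (rule nrm_Suc)
  have np: "nrm m y = 2 * nrm m p2" using latt_R[OF lp2] by (intro nrm_scale_s2) (auto simp: p2_def)
  have nq: "nrm m q = 2 * nrm m q2" using latt_R[OF l2] by (intro nrm_scale_s2) (auto simp: q2_def)
  have s: "nrm m p2 + nrm m q2 = 2 ^ m" using n np nq Suc.prems(3) by simp
  have nn: "nrm m p2 \<ge> 0" "nrm m q2 \<ge> 0" using nrm_nonneg lp2 l2 by auto
  have "(\<forall>j<2 ^ m. p2 j = 0) \<or> (\<forall>j<2 ^ m. q2 j = 0)"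
  proof (rule ccontr)
    assume "\<not> ?thesis"
    then obtain i j where "i < 2 ^ m" "p2 i \<noteq> 0" "j < 2 ^ m" "q2 j \<noteq> 0" by auto
    hence "nrm m p2 \<ge> 2 ^ m" "nrm m q2 \<ge> 2 ^ m" using nrm_ge lp2 l2 by auto
    moreover have "(2::real) ^ m > 0" by simp
    ultimately show False using s by linarith
  qed
  thus ?case
  proof
    assume z: "\<forall>j<2 ^ m. q2 j = 0"
    hence "nrm m p2 = 2 ^ m" using s nrm_zero[of m q2] by simp
    moreover have "latt m (\<lambda>j. (p2 j - e0 m j) / s2)"
      by (rule latt_cong[OF _ ld]) (use z in \<open>auto simp: d_def\<close>)
    ultimately obtain p k where pk: "p < 2 ^ m" "\<forall>j<2 ^ m. p2 j = (if j = p then \<i> ^ k * s2 ^ m else 0)"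
      using Suc.IH[OF e lp2] by blast
    have "y j = (if j = p then \<i> ^ k * s2 ^ Suc m else 0)" if "j < 2 ^ Suc m" for j
      using that
    proof (cases rule: less_2pow_Suc_cases)
      case 1
      have "y j = s2 * p2 j" by (simp add: p2_def)
      thus ?thesis using pk(2) 1 by simp
    next
      case (2 i)
      have "y j = s2 * q2 i" by (simp add: q2_def q_def 2)
      thus ?thesis using z 2 pk(1) by (auto simp: xor_2pow_eq_add)
    qed
    thus ?thesis using pk(1) by (intro exI[of _ p] exI[of _ k]) auto
  next
    assume z: "\<forall>j<2 ^ m. p2 j = 0"
    hence "nrm m q2 = 2 ^ m" using s nrm_zero[of m p2] by simp
    moreover have "latt m (\<lambda>j. (q2 j - e0 m j) / s2)"
      \<comment> \<open>With \<open>p2\<close> zero, (q2 - e0) / sqrt 2 equals - d - sqrt 2 *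
        e0.\<close>
      by (rule latt_cong[OF _ latt_linear[OF ld e, of "-1" "- s2"]])
        (use z in \<open>auto simp: d_def field_simps\<close>)
    ultimately obtain p k where pk: "p < 2 ^ m" "\<forall>j<2 ^ m. q2 j = (if j = p then \<i> ^ k * s2 ^ m else 0)"
      using Suc.IH[OF e l2] by blast
    have "y j = (if j = xor p (2 ^ m) then \<i> ^ k * s2 ^ Suc m else 0)" if "j < 2 ^ Suc m" for j
      using that
    proof (cases rule: less_2pow_Suc_cases)
      case 1
      have "y j = s2 * p2 j" by (simp add: p2_def)
      thus ?thesis using z 1 pk(1) by (auto simp: xor_2pow_eq_add)
    next
      case (2 i)
      have "y j = s2 * q2 i" by (simp add: q2_def q_def 2)
      thus ?thesis using pk 2 by (auto dest: arg_cong[where f = "\<lambda>x. xor x (2 ^ m)"])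
    qed
    moreover have "xor p (2 ^ m) < 2 ^ Suc m" using pk(1) by (simp add: xor_2pow_eq_add)
    ultimately show ?thesis by (intro exI[of _ "xor p (2 ^ m)"] exI[of _ k]) auto
  qed
qed

text \<open>If one half of v vanishes, the other is up to sign sqrt 2 times a minimal vector of
  level m. Otherwise both are minimal: once the lower half is moved to c * e0, the upper half is
  congruent to it modulo sqrt 2, so \<open>frame\<close> puts it on a coordinate axis and a single
  gate merges the two.\<close>

lemma minimal_transitive:
  assumes "latt m (e0 m)" "latt m v" "nrm m v = 2 ^ m"
  shows "\<exists>W c. clifford_op m W \<and> c \<in> R \<and> c * cnj c = 1 \<and> (\<forall>j<2 ^ m. W v j = c * e0 m j)"
  using assms
proof (induction m arbitrary: v)
  case 0
  have "v 0 \<in> R" using latt_R[OF 0(2), of 0] by simp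
  thus ?case using 0 \<tau>_eq[of "v 0"]
    by (intro exI[of _ "\<lambda>v. v"] exI[of _ "v 0"]) (auto intro: clifford_op.id simp: e0_def nrm_def)
next
  case (Suc m)
  define y where "y = (\<lambda>j. v (xor j (2 ^ m)))"
  define a where "a = (\<lambda>j. (v j - y j) / s2)"
  have e: "latt m (e0 m)" using latt_e0_lower Suc.prems(1) .
  have e0S: "e0 (Suc m) j = s2 * e0 m j" "e0 (Suc m) (xor j (2 ^ m)) = 0" if "j < 2 ^ m" for j
    using that by (auto simp: e0_def xor_2pow_eq_add)
  have l: "latt m v" "latt m y" "latt m a" unfolding y_def a_def
    using latt_lower latt_upper latt_half_diff Suc.prems(2) by auto
  have n: "nrm (Suc m) v = nrm m v + nrm m y" unfolding y_def by (rule nrm_Suc)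
  have Wy: "W v (xor j (2 ^ m)) = W y j" if "clifford_op m W" for W j
    unfolding y_def using clifford_op_shift[OF _ that, of "2 ^ m" v] by (simp add: take_bit_eq_mod)
  consider "\<forall>j<2 ^ m. y j = 0" | "\<forall>j<2 ^ m. v j = 0"
    | "\<exists>j<2 ^ m. v j \<noteq> 0" "\<exists>j<2 ^ m. y j \<noteq> 0" by auto
  thus ?case
  proof cases
    case 1
    have va: "nrm m v = 2 * nrm m a" using 1 latt_R[OF l(3)] by (intro nrm_scale_s2) (auto simp: a_def)
    hence "nrm m a = 2 ^ m" using n nrm_zero[of m y] 1 Suc.prems(3) by simp
    then obtain W c where W: "clifford_op m W" "c \<in> R" "c * cnj c = 1" "\<forall>j<2 ^ m. W a j = c * e0 m j"
      using Suc.IH[OF e l(3)] by blast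
    have "W v j = c * e0 (Suc m) j" if "j < 2 ^ Suc m" for j
      using that
    proof (cases rule: less_2pow_Suc_cases)
      case A: 1
      have "W v j = W (\<lambda>j. s2 * a j) j"
        by (rule clifford_op_cong[OF W(1) _ A]) (use 1 in \<open>auto simp: a_def\<close>)
      thus ?thesis using W(4) A by (simp add: clifford_op_scale[OF W(1)] e0S)
    next
      case (2 i)
      have "W y i = W (\<lambda>j. 0 * y j) i" by (rule clifford_op_cong[OF W(1) _ 2(1)]) (use 1 in auto)
      hence "W y i = 0" by (simp only: clifford_op_scale[OF W(1)]) simp
      thus ?thesis using 2 Wy[OF W(1)] by (simp add: e0S)
    qed
    thus ?thesis using W(2,3) clifford_op_Suc[OF W(1)] by blast
  next
    case 2
    have va: "nrm m y = 2 * nrm m a" using 2 latt_R[OF l(3)] by (intro nrm_scale_s2) (auto simp: a_def)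
    hence "nrm m a = 2 ^ m" using n nrm_zero[of m v] 2 Suc.prems(3) by simp
    then obtain W c where W: "clifford_op m W" "c \<in> R" "c * cnj c = 1" "\<forall>j<2 ^ m. W a j = c * e0 m j"
      using Suc.IH[OF e l(3)] by blast
    have h: "herm_pauli (Suc m) 0 (2 ^ m) (\<lambda>_. 1)" using pm_character_one unfolding herm_pauli_def by simp
    \<comment> \<open>Applied twice, this gate swaps the two halves up to the factor i.\<close>
    define T where "T = tgate 0 (2 ^ m) (\<lambda>_. 1)"
    have Tv: "T (T (W v)) j = \<i> * W v (xor j (2 ^ m))" for j
      unfolding T_def tgate_twice[OF h] by (simp add: pauli_act_def)
    have "T (T (W v)) j = (- \<i> * c) * e0 (Suc m) j" if "j < 2 ^ Suc m" for j
      using that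
    proof (cases rule: less_2pow_Suc_cases)
      case A: 1
      have "y j = - s2 * a j" if "j < 2 ^ m" for j using 2 that by (simp add: a_def)
      hence "W y j = W (\<lambda>j. - s2 * a j) j" by (rule clifford_op_cong[OF W(1) _ A])
      also have "\<dots> = - s2 * (c * e0 m j)" using W(4) A clifford_op_scale[OF W(1), of "- s2" a] by simp
      finally show ?thesis using A Wy[OF W(1)] by (simp add: Tv e0S)
    next
      case B: (2 i)
      have "W v i = W (\<lambda>j. 0 * v j) i" by (rule clifford_op_cong[OF W(1) _ B(1)]) (use 2 in auto)
      hence "W v i = 0" by (simp only: clifford_op_scale[OF W(1)]) simp
      thus ?thesis using B by (simp add: Tv e0S)
    qed
    moreover have "clifford_op (Suc m) (\<lambda>v. T (T (W v)))" unfolding T_def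
      by (intro clifford_op.step clifford_op_Suc W(1) h)
    moreover have "(- \<i> * c) * cnj (- \<i> * c) = c * cnj c" by (simp add: complex_eq_iff)
    hence "- \<i> * c \<in> R" "(- \<i> * c) * cnj (- \<i> * c) = 1" using W(2,3) by (simp_all add: mult.assoc)
    ultimately show ?thesis by blast
  next
    case 3
    then obtain i j where "i < 2 ^ m" "v i \<noteq> 0" "j < 2 ^ m" "y j \<noteq> 0" by auto
    hence "nrm m v \<ge> 2 ^ m" "nrm m y \<ge> 2 ^ m" using nrm_ge l by auto
    hence nv: "nrm m v = 2 ^ m" "nrm m y = 2 ^ m" using n Suc.prems(3) by auto
    obtain W c where W: "clifford_op m W" "c \<in> R" "c * cnj c = 1" "\<forall>j<2 ^ m. W v j = c * e0 m j"
      using Suc.IH[OF e l(1) nv(1)] by blast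
    have c1: "cnj c * c = 1" using W(3) by (simp add: mult.commute)
    define u where "u = (\<lambda>j. cnj c * W y j)"
    have lu: "latt m u" unfolding u_def
      by (rule latt_scale[OF latt_clifford_op[OF W(1) l(2)] cnj_R[OF W(2)]])
    have "u j * cnj (u j) = W y j * cnj (W y j)" for j
    proof -
      have "u j * cnj (u j) = (c * cnj c) * (W y j * cnj (W y j))" by (simp add: u_def mult_ac)
      thus ?thesis by (simp add: W(3))
    qed
    hence nu: "nrm m u = 2 ^ m" using nrm_clifford_op[OF W(1) l(2)] nv(2) unfolding nrm_def by simp
    have "latt m (\<lambda>j. (u j - e0 m j) / s2)"
    proof (rule latt_cong[OF _ latt_scale[OF latt_clifford_op[OF W(1) l(3)], of "- cnj c"]])
      fix j :: nat assume j: "j < 2 ^ m"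
      have "W a = W (\<lambda>j. (1 / s2) * v j + (- 1 / s2) * y j)"
        by (rule arg_cong[of _ _ W]) (auto simp: a_def field_simps)
      hence "W a j = (1 / s2) * W v j + (- 1 / s2) * W y j" by (simp only: clifford_op_linear[OF W(1)])
      hence Wa: "W a j = (c * e0 m j - W y j) / s2" using W(4) j by (simp add: diff_divide_distrib)
      have "- cnj c * W a j = ((cnj c * W y j) - (cnj c * c) * e0 m j) / s2"
        unfolding Wa by (simp add: diff_divide_distrib right_diff_distrib)
      thus "- cnj c * W a j = (u j - e0 m j) / s2" unfolding c1 u_def by simp
    qed (use W(2) in auto)
    then obtain p k where pk: "p < 2 ^ m" "\<forall>j<2 ^ m. u j = (if j = p then \<i> ^ k * s2 ^ m else 0)"
      using frame[OF e lu nu] by blast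
    \<comment> \<open>p moved to the upper half: W v is then c times a gate image of
      \<open>e0 (Suc m)\<close>, and the inverse gate, with exponent l + 2, undoes it.\<close>
    define J where "J = xor p (2 ^ m)"
    have J: "J \<noteq> 0" "J < 2 ^ Suc m" using pk(1) unfolding J_def by (auto simp: xor_2pow_eq_add)
    obtain l \<chi> where T: "herm_pauli (Suc m) l J \<chi>"
      "\<And>j. tgate l J \<chi> (e0 (Suc m)) j = (e0 (Suc m) j + \<i> ^ k * e0 (Suc m) (xor j J)) / s2"
      by (rule tgate_e0[OF J, of k]) (rule that)
    have Wv: "W v j = c * tgate l J \<chi> (e0 (Suc m)) j" if "j < 2 ^ Suc m" for j
      using that
    proof (cases rule: less_2pow_Suc_cases)
      case 1
      have "xor j J \<noteq> 0" using J 1 pk(1) unfolding xor_eq_0_iff J_def by (auto simp: xor_2pow_eq_add)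
      thus ?thesis using W(4) 1 unfolding T(2) by (simp add: e0_def)
    next
      case (2 i)
      have "xor j J = xor i p" unfolding 2 J_def by (metis xor.assoc xor.commute xor_cancel(1))
      moreover have "W v j = c * u i" using c1 Wy[OF W(1)] unfolding 2 u_def
        by (simp add: W(3) flip: mult.assoc)
      ultimately show ?thesis using pk(2) 2 unfolding T(2) by (auto simp: e0_def xor_eq_0_iff xor_2pow_eq_add)
    qed
    have h: "herm_pauli (Suc m) (l + 2) J \<chi>" using herm_pauli_add2[OF T(1)] .
    have "tgate (l + 2) J \<chi> (W v) j = c * e0 (Suc m) j" if "j < 2 ^ Suc m" for j
    proof -
      have "tgate (l + 2) J \<chi> (W v) j = tgate (l + 2) J \<chi> (\<lambda>j. c * tgate l J \<chi> (e0 (Suc m)) j) j"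
        by (rule clifford_op_cong[OF clifford_op_tgate[OF h] Wv that])
      also have "\<dots> = c * tgate (l + 2) J \<chi> (tgate l J \<chi> (e0 (Suc m))) j"
        using clifford_op_scale[OF clifford_op_tgate[OF h]] by metis
      finally show ?thesis unfolding tgate_inverse[OF T(1)] .
    qed
    moreover have "clifford_op (Suc m) (\<lambda>v. tgate (l + 2) J \<chi> (W v))"
      by (intro clifford_op.step clifford_op_Suc W(1) h)
    ultimately show ?thesis using W(2,3) by blast
  qed
qed

lemma nrm_less_zero:
  "latt m v \<Longrightarrow> nrm m v < 2 ^ m \<Longrightarrow> j < 2 ^ m \<Longrightarrow> v j = 0"
  using nrm_ge by (metis not_le)

end

section \<open>Unitary groups and Pauli matrices\<close>

lemma mat_adjoint_carrier [simp]: "A \<in> carrier_mat n k \<Longrightarrow> mat_adjoint A \<in> carrier_mat k n"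
  unfolding mat_adjoint_def by auto

lemma mat_adjoint_index [simp]:
  "i < dim_col A \<Longrightarrow> j < dim_row A \<Longrightarrow> mat_adjoint (A :: complex mat) $$ (i, j) = cnj (A $$ (j, i))"
  unfolding mat_adjoint_def by (simp add: mat_of_rows_index)

lemma mat_adjoint_dim [simp]: "dim_row (mat_adjoint A) = dim_col A" "dim_col (mat_adjoint A) = dim_row A"
  unfolding mat_adjoint_def by auto

lemma mat_adjoint_adjoint [simp]: "mat_adjoint (mat_adjoint A) = (A :: complex mat)"
  by (rule eq_matI) auto

lemma mat_adjoint_mult:
  assumes "A \<in> carrier_mat n k" "B \<in> carrier_mat k l"
  shows "mat_adjoint (A * B) = mat_adjoint B * mat_adjoint (A :: complex mat)"
  using assms by (intro eq_matI) (auto simp: scalar_prod_def mult.commute intro!: sum.cong)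

lemma mat_adjoint_one [simp]: "mat_adjoint (1\<^sub>m n :: complex mat) = 1\<^sub>m n"
  by (rule eq_matI) auto

lemma mat_adjoint_smult: "mat_adjoint (c \<cdot>\<^sub>m A) = cnj c \<cdot>\<^sub>m mat_adjoint (A :: complex mat)"
  by (rule eq_matI) auto

lemma elements_mat_iff: "A \<in> carrier_mat n k \<Longrightarrow> elements_mat A \<subseteq> K \<longleftrightarrow> (\<forall>i<n. \<forall>j<k. A $$ (i, j) \<in> K)"
  unfolding elements_mat_def by (auto simp: UN_subset_iff image_subset_iff)

lemma unitary_group_carrier_iff:
  "A \<in> carrier (unitary_group n K) \<longleftrightarrow>
    A \<in> carrier_mat n n \<and> (\<forall>i<n. \<forall>j<n. A $$ (i, j) \<in> K) \<and> A * mat_adjoint A = 1\<^sub>m n"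
  unfolding unitary_group_def using elements_mat_iff[of A n n K] by auto

lemma unitary_group_simps [simp]:
  "monoid.mult (unitary_group n K) = (*)" "one (unitary_group n K) = 1\<^sub>m n"
  unfolding unitary_group_def by auto

lemma unitary_adjoint_left:
  assumes "A \<in> carrier (unitary_group n K)"
  shows "mat_adjoint A * A = 1\<^sub>m n"
  using assms mat_mult_left_right_inverse[of A n "mat_adjoint A"]
  unfolding unitary_group_carrier_iff by auto

text \<open>Sums, products and conjugates suffice for a group, since the inverse of a unitary matrix
  is its adjoint. The instances are the complex numbers and Q(zeta8).\<close>

locale cnj_subring =
  fixes K :: "complex set"
  assumes K01: "0 \<in> K" "1 \<in> K"
    and K_add: "x \<in> K \<Longrightarrow> y \<in> K \<Longrightarrow> x + y \<in> K"
    and K_mult: "x \<in> K \<Longrightarrow> y \<in> K \<Longrightarrow> x * y \<in> K"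
    and K_cnj: "x \<in> K \<Longrightarrow> cnj x \<in> K"
begin

lemma K_sum: "(\<And>i. i \<in> A \<Longrightarrow> f i \<in> K) \<Longrightarrow> sum f A \<in> K"
  by (induction A rule: infinite_finite_induct) (auto simp: K01 K_add)

lemma unitary_group_mult:
  assumes "A \<in> carrier (unitary_group n K)" "B \<in> carrier (unitary_group n K)"
  shows "A * B \<in> carrier (unitary_group n K)"
proof -
  have c: "A \<in> carrier_mat n n" "B \<in> carrier_mat n n" "mat_adjoint A \<in> carrier_mat n n"
    "mat_adjoint B \<in> carrier_mat n n"
    using assms unfolding unitary_group_carrier_iff by auto
  have "A * B * mat_adjoint (A * B) = A * B * (mat_adjoint B * mat_adjoint A)"
    using mat_adjoint_mult c by metis
  also have "\<dots> = A * (B * (mat_adjoint B * mat_adjoint A))"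
    by (rule assoc_mult_mat[of _ n n _ n _ n]) (use c in auto)
  also have "B * (mat_adjoint B * mat_adjoint A) = B * mat_adjoint B * mat_adjoint A"
    by (rule assoc_mult_mat[of _ n n _ n _ n, symmetric]) (use c in auto)
  also have "\<dots> = mat_adjoint A" using assms c unfolding unitary_group_carrier_iff by auto
  finally have "A * B * mat_adjoint (A * B) = 1\<^sub>m n" using assms unfolding unitary_group_carrier_iff by auto
  moreover have "(A * B) $$ (i, j) \<in> K" if "i < n" "j < n" for i j
    using that c assms unfolding unitary_group_carrier_iff
    by (auto simp: scalar_prod_def intro!: K_sum K_mult)
  ultimately show ?thesis using c unfolding unitary_group_carrier_iff by auto
qed

lemma unitary_group_adjoint:
  assumes "A \<in> carrier (unitary_group n K)"
  shows "mat_adjoint A \<in> carrier (unitary_group n K)"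
  using assms unitary_adjoint_left[OF assms] unfolding unitary_group_carrier_iff by (auto intro!: K_cnj)

sublocale unitary: group "unitary_group n K" for n
proof (rule groupI)
  fix A assume A: "A \<in> carrier (unitary_group n K)"
  show "\<exists>B\<in>carrier (unitary_group n K). B \<otimes>\<^bsub>unitary_group n K\<^esub> A = \<one>\<^bsub>unitary_group n K\<^esub>"
    using unitary_group_adjoint[OF A] unitary_adjoint_left[OF A] by (intro bexI[of _ "mat_adjoint A"]) auto
  show "\<one>\<^bsub>unitary_group n K\<^esub> \<otimes>\<^bsub>unitary_group n K\<^esub> A = A"
    using A unfolding unitary_group_carrier_iff by auto
next
  fix A B C assume "A \<in> carrier (unitary_group n K)" "B \<in> carrier (unitary_group n K)" "C \<in> carrier (unitary_group n K)"
  thus "A \<otimes>\<^bsub>unitary_group n K\<^esub> B \<otimes>\<^bsub>unitary_group n K\<^esub> C = A \<otimes>\<^bsub>unitary_group n K\<^esub> (B \<otimes>\<^bsub>unitary_group n K\<^esub> C)"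
    unfolding unitary_group_carrier_iff by (auto intro: assoc_mult_mat)
qed (simp_all add: unitary_group_mult, auto simp: unitary_group_carrier_iff K01)

lemma unitary_inv:
  assumes "A \<in> carrier (unitary_group n K)"
  shows "inv\<^bsub>unitary_group n K\<^esub> A = mat_adjoint A"
  by (rule unitary.inv_equality) (use assms unitary_group_adjoint[OF assms] unitary_adjoint_left[OF assms] in auto)

end

interpretation UNIV_ring: cnj_subring UNIV by unfold_locales auto

section \<open>The field Q(zeta8)\<close>

lemma class_ring_m_inv: "x \<noteq> 0 \<Longrightarrow> inv\<^bsub>(class_ring :: complex ring)\<^esub> x = inverse x"
  by (rule comm_monoid.comm_inv_char[of "class_ring :: complex ring"])
    (auto simp: class_ring_simps intro!: comm_monoidI)

lemma class_ring_a_inv: "\<ominus>\<^bsub>(class_ring :: complex ring)\<^esub> x = - x"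
  by (simp add: class_ring_simps)

lemma zeta8_cnj: "cnj zeta8 = inverse zeta8" "zeta8 \<noteq> 0"
proof -
  show "zeta8 \<noteq> 0" unfolding zeta8_def by simp
  have "zeta8 * cnj zeta8 = 1" unfolding zeta8_alt by (simp add: field_simps)
  thus "cnj zeta8 = inverse zeta8" by (metis inverse_unique)
qed

text \<open>Conjugation sends the generator to its inverse, hence preserves the generated
  field.\<close>

interpretation Q8: cnj_subring Q_zeta8
proof
  show 1: "1 \<in> Q_zeta8" unfolding Q_zeta8_def using generate_field.one[of "class_ring :: complex ring"] by simp
  show add: "x + y \<in> Q_zeta8" if "x \<in> Q_zeta8" "y \<in> Q_zeta8" for x y
    using that generate_field.eng_add[of _ "class_ring :: complex ring"] unfolding Q_zeta8_def by simp
  show "x * y \<in> Q_zeta8" if "x \<in> Q_zeta8" "y \<in> Q_zeta8" for x y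
    using that generate_field.eng_mult[of _ "class_ring :: complex ring"] unfolding Q_zeta8_def by simp
  have neg: "- x \<in> Q_zeta8" if "x \<in> Q_zeta8" for x
    using generate_field.a_inv[OF that[unfolded Q_zeta8_def]] unfolding Q_zeta8_def class_ring_a_inv .
  show "0 \<in> Q_zeta8" using add[OF 1 neg[OF 1]] by simp
  show "cnj x \<in> Q_zeta8" if "x \<in> Q_zeta8" for x
    using that unfolding Q_zeta8_def
  proof (induction rule: generate_field.induct)
    case (incl h)
    thus ?case using generate_field.m_inv[OF generate_field.incl, of zeta8 "{zeta8}" "class_ring :: complex ring"]
      zeta8_cnj class_ring_m_inv by simp
  next
    case (m_inv h)
    thus ?case using generate_field.m_inv[OF m_inv.IH] class_ring_m_inv by simp
  qed (use generate_field.intros[where R = "class_ring :: complex ring"] class_ring_a_inv in \<open>force+\<close>)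
qed

lemma Q8_minus: "x \<in> Q_zeta8 \<Longrightarrow> - x \<in> Q_zeta8"
  using generate_field.a_inv[where R = "class_ring :: complex ring"] unfolding Q_zeta8_def class_ring_a_inv .

lemma Q8_i_power: "\<i> ^ k \<in> Q_zeta8"
proof (induction k)
  case (Suc k)
  have z: "zeta8 \<in> Q_zeta8" unfolding Q_zeta8_def by (auto intro: generate_field.incl)
  have "zeta8 * zeta8 = \<i>" unfolding zeta8_alt by (simp add: field_simps)
  hence "\<i> \<in> Q_zeta8" using Q8.K_mult[OF z z] by simp
  thus ?case using Q8.K_mult[OF _ Suc, of \<i>] by simp
qed (simp add: Q8.K01)

lemma Q8_inverse_s2: "1 / s2 \<in> Q_zeta8"
proof -
  have z: "zeta8 \<in> Q_zeta8" unfolding Q_zeta8_def by (auto intro: generate_field.incl)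
  have "zeta8 + cnj zeta8 = s2" unfolding zeta8_alt by (simp add: field_simps)
  hence "s2 \<in> Q_zeta8" using Q8.K_add[OF z Q8.K_cnj[OF z]] by simp
  hence "inv\<^bsub>(class_ring :: complex ring)\<^esub> s2 \<in> Q_zeta8"
    unfolding Q_zeta8_def by (rule generate_field.m_inv) simp
  hence "inverse s2 \<in> Q_zeta8" using class_ring_m_inv[of s2] by simp
  thus ?thesis by (simp add: inverse_eq_divide)
qed

text \<open>The bridge from operators on sequences to matrices: basis vectors show that the first n
  values of F determine the matrix, so matrix identities reduce to operator identities.\<close>

definition represents :: "nat \<Rightarrow> complex mat \<Rightarrow> ((nat \<Rightarrow> complex) \<Rightarrow> nat \<Rightarrow> complex) \<Rightarrow> bool" where
  "represents n A F \<longleftrightarrow> A \<in> carrier_mat n n \<and> (\<forall>v. A *\<^sub>v vec n v = vec n (F v))"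

lemma represents_unique:
  assumes "represents n A F" "represents n B G" "\<And>v j. j < n \<Longrightarrow> F v j = G v j"
  shows "A = B"
proof (rule eq_matI)
  have c: "A \<in> carrier_mat n n" "B \<in> carrier_mat n n" using assms unfolding represents_def by auto
  thus "dim_row A = dim_row B" "dim_col A = dim_col B" by auto
  fix i j assume "i < dim_row B" "j < dim_col B"
  hence ij: "i < n" "j < n" using c by auto
  define v :: "nat \<Rightarrow> complex" where "v = (\<lambda>l. if l = j then 1 else 0)"
  have col: "(M *\<^sub>v vec n v) $ i = M $$ (i, j)" if "M \<in> carrier_mat n n" for M
    using that ij by (auto simp: v_def scalar_prod_def if_distrib cong: if_cong)
  have "A *\<^sub>v vec n v = B *\<^sub>v vec n v"
    using assms unfolding represents_def by (auto intro!: eq_vecI)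
  thus "A $$ (i, j) = B $$ (i, j)" using col c by metis
qed

lemma represents_mult:
  assumes "represents n A F" "represents n B G"
  shows "represents n (A * B) (\<lambda>v. F (G v))"
  using assms unfolding represents_def by (auto simp: assoc_mult_mat_vec[of _ n n _ n])

lemma represents_one: "represents n (1\<^sub>m n) (\<lambda>v. v)"
  unfolding represents_def by auto

lemma represents_pow: "represents n A F \<Longrightarrow> represents n (A ^\<^sub>m k) (F ^^ k)"
proof (induction k)
  case 0
  thus ?case using represents_one[of n] by (auto simp: represents_def id_def)
next
  case (Suc k)
  from represents_mult[OF Suc.IH Suc.prems] Suc.prems show ?case
    by (simp add: funpow_swap1 comp_def)
qed

section \<open>Pauli and gate matrices\<close>

definition pauli_mat :: "nat \<Rightarrow> nat \<Rightarrow> nat \<Rightarrow> (nat \<Rightarrow> complex) \<Rightarrow> complex mat" where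
  "pauli_mat m k a \<chi> = mat (2 ^ m) (2 ^ m) (\<lambda>(i, j). if i = xor j a then \<i> ^ k * \<chi> j else 0)"

definition tmat :: "nat \<Rightarrow> nat \<Rightarrow> nat \<Rightarrow> (nat \<Rightarrow> complex) \<Rightarrow> complex mat" where
  "tmat m k a \<chi> = mat (2 ^ m) (2 ^ m)
     (\<lambda>(i, j). ((if i = j then 1 else 0) + \<i> * pauli_mat m k a \<chi> $$ (i, j)) * (1 / s2))"

lemma pauli_mat_carrier [simp]: "pauli_mat m k a \<chi> \<in> carrier_mat (2 ^ m) (2 ^ m)"
  unfolding pauli_mat_def by auto

lemma tmat_carrier [simp]: "tmat m k a \<chi> \<in> carrier_mat (2 ^ m) (2 ^ m)"
  unfolding tmat_def by auto

lemma pauli_mat_sum: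
  assumes "a < 2 ^ m" "i < 2 ^ m"
  shows "(\<Sum>j<2 ^ m. pauli_mat m k a \<chi> $$ (i, j) * v j) = pauli_act k a \<chi> v i"
proof -
  have "(\<Sum>j<2 ^ m. pauli_mat m k a \<chi> $$ (i, j) * v j)
      = (\<Sum>j<2 ^ m. if j = xor i a then \<i> ^ k * \<chi> j * v j else 0)"
    using assms by (intro sum.cong) (auto simp: pauli_mat_def)
  also have "\<dots> = pauli_act k a \<chi> v i"
    using xor_less_2pow[OF assms(2,1)] by (simp add: pauli_act_def)
  finally show ?thesis .
qed

lemma represents_pauli: "a < 2 ^ m \<Longrightarrow> represents (2 ^ m) (pauli_mat m k a \<chi>) (pauli_act k a \<chi>)"
  unfolding represents_def using pauli_mat_sum[of a m _ k \<chi>]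
  by (auto intro!: eq_vecI simp: scalar_prod_def atLeast0LessThan pauli_mat_def)

lemma represents_tmat:
  assumes "a < 2 ^ m" shows "represents (2 ^ m) (tmat m k a \<chi>) (tgate k a \<chi>)"
  unfolding represents_def
proof safe
  fix v :: "nat \<Rightarrow> complex"
  show "tmat m k a \<chi> *\<^sub>v vec (2 ^ m) v = vec (2 ^ m) (tgate k a \<chi> v)"
  proof (rule eq_vecI)
    fix i assume "i < dim_vec (vec (2 ^ m) (tgate k a \<chi> v))"
    hence i: "i < 2 ^ m" by simp
    have "(tmat m k a \<chi> *\<^sub>v vec (2 ^ m) v) $ i
        = (\<Sum>j<2 ^ m. ((if i = j then 1 else 0) + \<i> * pauli_mat m k a \<chi> $$ (i, j)) * (1 / s2) * v j)"
      using i by (simp add: tmat_def scalar_prod_def atLeast0LessThan)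
    also have "\<dots> = (\<Sum>j<2 ^ m. (if j = i then v j / s2 else 0) + \<i> / s2 * (pauli_mat m k a \<chi> $$ (i, j) * v j))"
      by (intro sum.cong) (auto simp: algebra_simps add_divide_distrib)
    also have "\<dots> = v i / s2 + \<i> / s2 * pauli_act k a \<chi> v i"
      using i by (simp only: sum.distrib pauli_mat_sum[OF assms i] flip: sum_distrib_left) simp
    also have "\<dots> = tgate k a \<chi> v i" unfolding tgate_def by (simp add: add_divide_distrib)
    finally show "(tmat m k a \<chi> *\<^sub>v vec (2 ^ m) v) $ i = vec (2 ^ m) (tgate k a \<chi> v) $ i" using i by simp
  qed (simp add: tmat_def)
qed simp

lemma pm_character_mult: "pm_character m \<chi> \<Longrightarrow> pm_character m \<psi> \<Longrightarrow> pm_character m (\<lambda>j. \<chi> j * \<psi> j)"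
  unfolding pm_character_def[of m "\<lambda>j. \<chi> j * \<psi> j"]
  using pm_characterD(1,2,3)[of m \<chi>] pm_characterD(1,2,3)[of m \<psi>]
  by (auto simp: mult_ac) (metis minus_minus mult.right_neutral mult_minus1_right)+

lemma pm_sign_power:
  assumes "pm_character m \<chi>"
  obtains s where "\<chi> j = \<i> ^ (2 * s)"
  using pm_characterD(2)[OF assms, of j] that[of 0] that[of 1] by auto

text \<open>Moving \<chi> past the shift by b costs the sign \<chi> b; written as an even power of i
  it is absorbed into the exponent.\<close>

lemma pauli_act_compose:
  assumes "pm_character m \<chi>" "pm_character m \<psi>" "\<chi> b = \<i> ^ (2 * s)"
  shows "pauli_act k a \<chi> (pauli_act l b \<psi> v) = pauli_act (k + l + 2 * s) (xor a b) (\<lambda>j. \<chi> j * \<psi> j) v"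
proof
  fix j
  have x: "xor j (xor a b) = xor (xor j a) b" by (simp add: xor.assoc)
  have "\<chi> (xor j a) = \<chi> (xor (xor j a) b) * \<i> ^ (2 * s)"
    using pm_characterD(1)[OF assms(1), of "xor (xor j a) b" b] assms(3) by simp
  thus "pauli_act k a \<chi> (pauli_act l b \<psi> v) j = pauli_act (k + l + 2 * s) (xor a b) (\<lambda>j. \<chi> j * \<psi> j) v j"
    unfolding pauli_act_def x by (simp add: power_add mult_ac)
qed

lemma pauli_mat_cong:
  assumes "\<And>j. j < 2 ^ m \<Longrightarrow> \<i> ^ k * \<chi> j = \<i> ^ l * \<psi> j"
  shows "pauli_mat m k a \<chi> = pauli_mat m l a \<psi>"
  by (rule eq_matI) (use assms in \<open>auto simp: pauli_mat_def\<close>)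

definition paulis :: "nat \<Rightarrow> complex mat set" where
  "paulis m = {pauli_mat m k a \<chi> | k a \<chi>. a < 2 ^ m \<and> pm_character m \<chi>}"

text \<open>Even powers of i are signs: these are the real Pauli matrices, to be identified with
  E(m).\<close>

definition real_paulis :: "nat \<Rightarrow> complex mat set" where
  "real_paulis m = {pauli_mat m (2 * k) a \<chi> | k a \<chi>. a < 2 ^ m \<and> pm_character m \<chi>}"

lemma pauli_mat_mult:
  assumes "pm_character m \<chi>" "pm_character m \<psi>" "\<chi> b = \<i> ^ (2 * s)" "a < 2 ^ m" "b < 2 ^ m"
  shows "pauli_mat m k a \<chi> * pauli_mat m l b \<psi> = pauli_mat m (k + l + 2 * s) (xor a b) (\<lambda>j. \<chi> j * \<psi> j)"
  using represents_mult[OF represents_pauli[OF assms(4)] represents_pauli[OF assms(5)]]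
    represents_pauli[OF xor_less_2pow[OF assms(4,5)]]
  by (rule represents_unique) (simp add: pauli_act_compose[OF assms(1-3)])

lemma pauli_mat_adjoint:
  assumes "pm_character m \<chi>" "\<chi> a = \<i> ^ (2 * s)" "a < 2 ^ m"
  shows "mat_adjoint (pauli_mat m k a \<chi>) = pauli_mat m (3 * k + 2 * s) a \<chi>"
proof (rule eq_matI)
  fix i j assume "i < dim_row (pauli_mat m (3 * k + 2 * s) a \<chi>)" "j < dim_col (pauli_mat m (3 * k + 2 * s) a \<chi>)"
  hence ij: "i < 2 ^ m" "j < 2 ^ m" by (auto simp: pauli_mat_def)
  \<comment> \<open>Conjugation inverts i, whose inverse is i^3; the transposed shift contributes
    the sign \<chi> a, hence the exponent 3 * k + 2 * s.\<close>
  have "cnj (\<i> ^ k) = \<i> ^ (3 * k)"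
    by (simp add: power_mult power3_eq_cube)
  moreover have "\<chi> (xor j a) = \<chi> j * \<i> ^ (2 * s)" using pm_characterD(1)[OF assms(1)] assms(2) by simp
  ultimately show "mat_adjoint (pauli_mat m k a \<chi>) $$ (i, j) = pauli_mat m (3 * k + 2 * s) a \<chi> $$ (i, j)"
    using ij pm_characterD(7)[OF assms(1)]
    by (auto simp: pauli_mat_def power_add)
qed (auto simp: pauli_mat_def)

lemma paulis_mult: "A \<in> paulis m \<Longrightarrow> B \<in> paulis m \<Longrightarrow> A * B \<in> paulis m"
proof -
  assume "A \<in> paulis m" "B \<in> paulis m"
  then obtain k a \<chi> l b \<psi> where *: "A = pauli_mat m k a \<chi>" "a < 2 ^ m" "pm_character m \<chi>"
    "B = pauli_mat m l b \<psi>" "b < 2 ^ m" "pm_character m \<psi>" unfolding paulis_def by blast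
  obtain s where s: "\<chi> b = \<i> ^ (2 * s)" using pm_sign_power[OF *(3)] .
  show ?thesis unfolding *(1,4) pauli_mat_mult[OF *(3,6) s *(2,5)] paulis_def
    using xor_less_2pow[OF *(2,5)] pm_character_mult[OF *(3,6)] by blast
qed

lemma real_paulis_mult: "A \<in> real_paulis m \<Longrightarrow> B \<in> real_paulis m \<Longrightarrow> A * B \<in> real_paulis m"
proof -
  assume "A \<in> real_paulis m" "B \<in> real_paulis m"
  then obtain k a \<chi> l b \<psi> where *: "A = pauli_mat m (2 * k) a \<chi>" "a < 2 ^ m" "pm_character m \<chi>"
    "B = pauli_mat m (2 * l) b \<psi>" "b < 2 ^ m" "pm_character m \<psi>" unfolding real_paulis_def by blast
  obtain s where s: "\<chi> b = \<i> ^ (2 * s)" using pm_sign_power[OF *(3)] .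
  have "2 * k + 2 * l + 2 * s = 2 * (k + l + s)" by simp
  thus ?thesis unfolding *(1,4) pauli_mat_mult[OF *(3,6) s *(2,5)] real_paulis_def
    using xor_less_2pow[OF *(2,5)] pm_character_mult[OF *(3,6)] by (metis (mono_tags, lifting) mem_Collect_eq)
qed

lemma paulis_adjoint: "A \<in> paulis m \<Longrightarrow> mat_adjoint A \<in> paulis m"
  unfolding paulis_def by safe (metis pauli_mat_adjoint pm_sign_power)

lemma real_paulis_adjoint: "A \<in> real_paulis m \<Longrightarrow> mat_adjoint A \<in> real_paulis m"
proof -
  assume "A \<in> real_paulis m"
  then obtain k a \<chi> where *: "A = pauli_mat m (2 * k) a \<chi>" "a < 2 ^ m" "pm_character m \<chi>"
    unfolding real_paulis_def by blast
  obtain s where s: "\<chi> a = \<i> ^ (2 * s)" using pm_sign_power[OF *(3)] .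
  have "3 * (2 * k) + 2 * s = 2 * (3 * k + s)" by simp
  thus ?thesis unfolding *(1) pauli_mat_adjoint[OF *(3) s *(2)] real_paulis_def using *
    by (metis (mono_tags, lifting) mem_Collect_eq)
qed

lemma real_paulis_subset: "real_paulis m \<subseteq> paulis m"
  unfolding real_paulis_def paulis_def by blast

lemma real_paulisI: "a < 2 ^ m \<Longrightarrow> pm_character m \<chi> \<Longrightarrow> pauli_mat m (2 * k) a \<chi> \<in> real_paulis m"
  unfolding real_paulis_def by blast

lemma paulisI: "a < 2 ^ m \<Longrightarrow> pm_character m \<chi> \<Longrightarrow> pauli_mat m k a \<chi> \<in> paulis m"
  unfolding paulis_def by blast

lemma pauli_one: "pauli_mat m 0 0 (\<lambda>_. 1) = 1\<^sub>m (2 ^ m)"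
  by (rule eq_matI) (auto simp: pauli_mat_def)

lemma one_in_real_paulis: "1\<^sub>m (2 ^ m) \<in> real_paulis m"
  unfolding pauli_one[symmetric] using real_paulisI[OF _ pm_character_one, of 0 m 0] by simp

lemma paulis_unitary:
  assumes "A \<in> paulis m"
  shows "A \<in> carrier (unitary_group (2 ^ m) Q_zeta8)"
proof -
  obtain k a \<chi> where *: "A = pauli_mat m k a \<chi>" "a < 2 ^ m" "pm_character m \<chi>"
    using assms unfolding paulis_def by blast
  obtain s where s: "\<chi> a = \<i> ^ (2 * s)" using pm_sign_power[OF *(3)] .
  have "k + (3 * k + 2 * s) + 2 * s = 4 * (k + s)" by simp
  hence "A * mat_adjoint A = pauli_mat m (4 * (k + s)) (xor a a) (\<lambda>j. \<chi> j * \<chi> j)"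
    unfolding *(1) pauli_mat_adjoint[OF *(3) s *(2)] by (simp only: pauli_mat_mult[OF *(3,3) s *(2,2)])
  also have "\<dots> = pauli_mat m 0 0 (\<lambda>_. 1)"
    unfolding xor_self_eq
    by (rule pauli_mat_cong) (simp add: pm_characterD(4)[OF *(3)] power_mult power_add)
  finally have "A * mat_adjoint A = 1\<^sub>m (2 ^ m)" unfolding pauli_one .
  moreover have "\<chi> j \<in> Q_zeta8" for j
    using pm_characterD(2)[OF *(3), of j] Q8.K01 Q8_minus[of 1] by auto
  hence "A $$ (i, j) \<in> Q_zeta8" if "i < 2 ^ m" "j < 2 ^ m" for i j
    using that Q8.K01 Q8.K_mult Q8_i_power unfolding *(1) pauli_mat_def by auto
  ultimately show ?thesis unfolding unitary_group_carrier_iff using *(1) by auto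
qed

lemma unitary_Q8_UNIV: "A \<in> carrier (unitary_group n Q_zeta8) \<Longrightarrow> A \<in> carrier (unitary_group n UNIV)"
  unfolding unitary_group_carrier_iff by auto

section \<open>E(m) and its central product with Z4 as groups of Pauli matrices\<close>

lemma sigma_pauli:
  "sigma1 = pauli_mat 1 0 1 (\<lambda>_. 1)" "sigma2 = pauli_mat 1 0 0 (\<lambda>j. if bit j 0 then -1 else 1)"
proof -
  show "sigma1 = pauli_mat 1 0 1 (\<lambda>_. 1)" unfolding sigma1_def pauli_mat_def
    by (rule eq_matI) (auto simp: mat_of_rows_list_def less_2_cases_iff)
  show "sigma2 = pauli_mat 1 0 0 (\<lambda>j. if bit j 0 then -1 else 1)" unfolding sigma2_def pauli_mat_def
    by (rule eq_matI) (auto simp: mat_of_rows_list_def less_2_cases_iff bit_0)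
qed

text \<open>With X = \<open>sigma1\<close> and Z = \<open>sigma2\<close>, both sides consist of 1,
  X, Z, Z X and their negatives; the sign comes from (Z X)^2 = -1.\<close>

lemma E1_eq: "E1 = real_paulis 1"
proof
  let ?U = "unitary_group 2 UNIV"
  have s1: "sigma1 \<in> real_paulis 1" unfolding sigma_pauli using real_paulisI[OF _ pm_character_one, of 1 1 0] by simp
  have s2': "sigma2 \<in> real_paulis 1" unfolding sigma_pauli using real_paulisI[OF _ pm_character_bit[of 0 1], of 0 0] by simp
  have U: "A \<in> carrier ?U" if "A \<in> real_paulis 1" for A
    using paulis_unitary[of A 1] real_paulis_subset that unitary_Q8_UNIV by auto
  have inv: "inv\<^bsub>?U\<^esub> A \<in> real_paulis 1" if "A \<in> real_paulis 1" for A
    using UNIV_ring.unitary_inv[OF U[OF that]] real_paulis_adjoint[OF that] by simp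
  show "E1 \<subseteq> real_paulis 1"
  proof
    fix A assume "A \<in> E1"
    thus "A \<in> real_paulis 1" unfolding E1_def
      by (induction rule: generate.induct)
        (use s1 s2' inv real_paulis_mult one_in_real_paulis[of 1] in auto)
  qed
  have one: "1\<^sub>m 2 \<in> E1" unfolding E1_def using generate.one[of ?U] by simp
  have g1: "sigma1 \<in> E1" and g2: "sigma2 \<in> E1" unfolding E1_def by (auto intro: generate.incl)
  have gm: "A * B \<in> E1" if "A \<in> E1" "B \<in> E1" for A B
    using generate.eng[of A ?U _ B] that unfolding E1_def by simp
  define Z where "Z = (\<lambda>j::nat. if bit j 0 then -1 else 1 :: complex)"
  have Z: "pm_character 1 Z" unfolding Z_def using pm_character_bit[of 0 1] by simp
  have Z1: "Z 1 = \<i> ^ (2 * 1)" unfolding Z_def by (simp add: bit_0)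
  have ZX: "sigma2 * sigma1 = pauli_mat 1 2 1 Z"
    using pauli_mat_mult[OF Z pm_character_one Z1, of 0 0 0] unfolding sigma_pauli Z_def
    by (simp add: numeral_2_eq_2)
  have m1: "sigma2 * sigma1 * (sigma2 * sigma1) = pauli_mat 1 2 0 (\<lambda>_. 1)"
    using pauli_mat_mult[OF Z Z Z1, of 1 2 2] unfolding ZX
    by (auto simp: pm_characterD(4)[OF Z] intro!: pauli_mat_cong)
  have i0: "(1::complex) = \<i> ^ (2 * 0)" by simp
  have one1: "1\<^sub>m 2 = pauli_mat 1 0 0 (\<lambda>_. 1)" using pauli_one[of 1] by (metis power_one_right)
  have neg: "pauli_mat 1 2 0 (\<lambda>_. 1) * pauli_mat 1 k a \<chi> = pauli_mat 1 (k + 2) a \<chi>"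
    if "pm_character 1 \<chi>" "a < 2" for k a \<chi>
    using pauli_mat_mult[OF pm_character_one that(1) i0, of 0 a 2 k] that(2) by (simp add: add.commute)
  show "real_paulis 1 \<subseteq> E1"
  proof
    fix A assume "A \<in> real_paulis 1"
    then obtain k a \<chi> where A: "A = pauli_mat 1 (2 * k) a \<chi>" "a < 2" "pm_character 1 \<chi>"
      unfolding real_paulis_def by auto
    have base: "\<exists>l. pauli_mat 1 (2 * l) a \<chi> \<in> E1 \<and> l < 2"
    proof -
      have c1: "\<chi> j = 1" if "\<chi> 1 = 1" "j < 2 ^ 1" for j
        using that pm_characterD(6)[OF A(3)] by (auto simp: less_2_cases_iff)
      have cZ: "\<chi> j = Z j" if "\<chi> 1 \<noteq> 1" "j < 2 ^ 1" for j
        using that pm_characterD(2)[OF A(3), of 1] pm_characterD(6)[OF A(3)] unfolding Z_def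
        by (auto simp: less_2_cases_iff bit_0)
      consider "a = 0" "\<chi> 1 = 1" | "a = 1" "\<chi> 1 = 1" | "a = 0" "\<chi> 1 \<noteq> 1" | "a = 1" "\<chi> 1 \<noteq> 1"
        using A(2) by (auto simp: less_2_cases_iff)
      thus ?thesis
      proof cases
        case 1
        have "pauli_mat 1 (2 * 0) a \<chi> = 1\<^sub>m 2" unfolding one1 1(1)
          by (rule pauli_mat_cong) (simp add: c1[OF 1(2)] del: One_nat_def)
        thus ?thesis using one by (intro exI[of _ 0]) simp
      next
        case 2
        have "pauli_mat 1 (2 * 0) a \<chi> = sigma1" unfolding sigma_pauli 2(1)
          by (rule pauli_mat_cong) (simp add: c1[OF 2(2)] del: One_nat_def)
        thus ?thesis using g1 by (intro exI[of _ 0]) simp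
      next
        case 3
        have "pauli_mat 1 (2 * 0) a \<chi> = sigma2" unfolding sigma_pauli 3(1) Z_def[symmetric]
          by (rule pauli_mat_cong) (simp add: cZ[OF 3(2)] del: One_nat_def)
        thus ?thesis using g2 by (intro exI[of _ 0]) simp
      next
        case 4
        have "pauli_mat 1 (2 * 1) a \<chi> = sigma2 * sigma1" unfolding ZX 4(1)
          by (rule pauli_mat_cong) (simp add: cZ[OF 4(2)] del: One_nat_def)
        thus ?thesis using gm[OF g2 g1] by (intro exI[of _ 1]) simp
      qed
    qed
    then obtain l where l: "pauli_mat 1 (2 * l) a \<chi> \<in> E1" "l < 2" by blast
    have l2: "pauli_mat 1 (2 * l + 2) a \<chi> \<in> E1"
      using gm[OF gm[OF gm[OF g2 g1] gm[OF g2 g1]] l(1)] unfolding m1 neg[OF A(3,2)] .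
    have "\<i> ^ (2 * k) = \<i> ^ (2 * l) \<or> \<i> ^ (2 * k) = \<i> ^ (2 * l + 2)"
      by (cases "even k"; cases "even l") (simp_all add: power_mult power_add)
    thus "A \<in> E1"
    proof
      assume "\<i> ^ (2 * k) = \<i> ^ (2 * l)"
      hence "A = pauli_mat 1 (2 * l) a \<chi>" unfolding A(1) by (intro pauli_mat_cong) (simp only:)
      thus ?thesis using l(1) by (simp only:)
    next
      assume "\<i> ^ (2 * k) = \<i> ^ (2 * l + 2)"
      hence "A = pauli_mat 1 (2 * l + 2) a \<chi>" unfolding A(1) by (intro pauli_mat_cong) (simp only:)
      thus ?thesis using l2 by (simp only:)
    qed
  qed
qed

text \<open>The left tensor factor acts on the top bit of the index, the right one on the low m
  bits.\<close>

lemma kronecker_pauli: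
  assumes "a < 2" "b < 2 ^ m"
  shows "pauli_mat 1 k a \<chi> \<otimes>\<^sub>k pauli_mat m l b \<psi>
    = pauli_mat (Suc m) (k + l) (a * 2 ^ m + b) (\<lambda>j. \<chi> (j div 2 ^ m) * \<psi> (j mod 2 ^ m))"
proof (rule eq_matI)
  let ?N = "(2::nat) ^ m"
  fix i j assume "i < dim_row (pauli_mat (Suc m) (k + l) (a * ?N + b) (\<lambda>j. \<chi> (j div ?N) * \<psi> (j mod ?N)))"
    "j < dim_col (pauli_mat (Suc m) (k + l) (a * ?N + b) (\<lambda>j. \<chi> (j div ?N) * \<psi> (j mod ?N)))"
  hence ij: "i < 2 * ?N" "j < 2 * ?N" by (auto simp: pauli_mat_def)
  have d: "i div ?N < 2" "j div ?N < 2" "i mod ?N < ?N" "j mod ?N < ?N"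
    using ij by (auto simp: less_mult_imp_div_less)
  have "take_bit m (a * ?N + b) = b" "drop_bit m (a * ?N + b) = a"
    using assms(2) by (auto simp: take_bit_eq_mod drop_bit_eq_div)
  hence "xor j (a * ?N + b) mod ?N = xor (j mod ?N) b" "xor j (a * ?N + b) div ?N = xor (j div ?N) a"
    unfolding take_bit_eq_mod[symmetric] drop_bit_eq_div[symmetric] by simp_all
  hence "i = xor j (a * ?N + b) \<longleftrightarrow> i div ?N = xor (j div ?N) a \<and> i mod ?N = xor (j mod ?N) b"
    by (metis div_mult_mod_eq)
  thus "(pauli_mat 1 k a \<chi> \<otimes>\<^sub>k pauli_mat m l b \<psi>) $$ (i, j)
      = pauli_mat (Suc m) (k + l) (a * ?N + b) (\<lambda>j. \<chi> (j div ?N) * \<psi> (j mod ?N)) $$ (i, j)"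
    using ij d unfolding kronecker_def pauli_mat_def by (auto simp: power_add)
qed (auto simp: kronecker_def pauli_mat_def)

lemma pm_character_div_mod:
  assumes "pm_character 1 \<chi>" "pm_character m \<psi>"
  shows "pm_character (Suc m) (\<lambda>j. \<chi> (j div 2 ^ m) * \<psi> (j mod 2 ^ m))"
proof -
  have "\<chi> (take_bit (Suc m) j div 2 ^ m) = \<chi> (j div 2 ^ m)" for j
  proof -
    have "take_bit (Suc m) j div 2 ^ m = take_bit 1 (j div 2 ^ m)"
      unfolding drop_bit_eq_div[symmetric] by (simp add: drop_bit_take_bit)
    thus ?thesis using pm_characterD(3)[OF assms(1)] by simp
  qed
  moreover have "take_bit (Suc m) j mod 2 ^ m = j mod 2 ^ m" for j :: nat
    unfolding take_bit_eq_mod[symmetric] by simp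
  moreover have "\<chi> (xor i j div 2 ^ m) = \<chi> (i div 2 ^ m) * \<chi> (j div 2 ^ m)"
    "\<psi> (xor i j mod 2 ^ m) = \<psi> (i mod 2 ^ m) * \<psi> (j mod 2 ^ m)" for i j
    unfolding take_bit_eq_mod[symmetric] drop_bit_eq_div[symmetric]
    by (simp_all add: pm_characterD(1)[OF assms(1)] pm_characterD(1)[OF assms(2)])
  moreover have "\<chi> i * \<psi> j = 1 \<or> \<chi> i * \<psi> j = -1" for i j
    using pm_characterD(2)[OF assms(1), of i] pm_characterD(2)[OF assms(2), of j] by auto
  ultimately show ?thesis unfolding pm_character_def by (simp add: mult_ac image_subset_iff)
qed

lemma real_paulis_Suc: "real_paulis (Suc m) = {A \<otimes>\<^sub>k B | A B. A \<in> real_paulis 1 \<and> B \<in> real_paulis m}"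
proof safe
  fix A B assume "A \<in> real_paulis 1" "B \<in> real_paulis m"
  then obtain k a \<chi> l b \<psi> where *: "A = pauli_mat 1 (2 * k) a \<chi>" "a < 2" "pm_character 1 \<chi>"
    "B = pauli_mat m (2 * l) b \<psi>" "b < 2 ^ m" "pm_character m \<psi>" unfolding real_paulis_def by auto
  have "a * 2 ^ m + b < 2 ^ Suc m" using *(2,5) by (auto simp: less_2_cases_iff)
  thus "A \<otimes>\<^sub>k B \<in> real_paulis (Suc m)"
    unfolding *(1,4) kronecker_pauli[OF *(2,5)] add_mult_distrib2[symmetric]
    by (rule real_paulisI) (rule pm_character_div_mod[OF *(3,6)])
next
  fix C assume "C \<in> real_paulis (Suc m)"
  then obtain k a \<chi> where C: "C = pauli_mat (Suc m) (2 * k) a \<chi>" "a < 2 ^ Suc m" "pm_character (Suc m) \<chi>"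
    unfolding real_paulis_def by auto
  let ?N = "(2::nat) ^ m"
  \<comment> \<open>\<psi> and \<phi> restrict \<chi> to the top bit and to the low m bits; the
    phase goes entirely to the right factor.\<close>
  define \<psi> where "\<psi> = (\<lambda>i. \<chi> (push_bit m i))"
  define \<phi> where "\<phi> = (\<lambda>i. \<chi> (take_bit m i))"
  have "pm_character 1 \<psi>" unfolding pm_character_def \<psi>_def
  proof safe
    fix j
    have "\<chi> (push_bit m (take_bit 1 j)) = \<chi> (take_bit (Suc m) (push_bit m j))"
      by (simp add: take_bit_push_bit)
    thus "\<chi> (push_bit m (take_bit 1 j)) = \<chi> (push_bit m j)" using pm_characterD(3)[OF C(3)] by simp
  qed (use pm_characterD(1,2)[OF C(3)] in auto)
  moreover have "pm_character m \<phi>" unfolding pm_character_def \<phi>_def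
    using pm_characterD(1,2)[OF C(3)] by auto
  moreover have a: "a div ?N < 2" "a mod ?N < ?N" using C(2) by (auto simp: less_mult_imp_div_less)
  moreover have "C = pauli_mat 1 (2 * 0) (a div ?N) \<psi> \<otimes>\<^sub>k pauli_mat m (2 * k) (a mod ?N) \<phi>"
    unfolding kronecker_pauli[OF a] C(1) div_mult_mod_eq
  proof (subst mult_0_right, subst add_0, rule pauli_mat_cong)
    fix j :: nat
    have "xor (push_bit m (drop_bit m j)) (take_bit m j) = j"
      by (rule bit_eqI) (auto simp: bit_simps)
    hence "\<chi> j = \<chi> (push_bit m (drop_bit m j)) * \<chi> (take_bit m j)" 
      by (metis pm_characterD(1)[OF C(3)])
    thus "\<i> ^ (2 * k) * \<chi> j = \<i> ^ (2 * k) * (\<psi> (j div ?N) * \<phi> (j mod ?N))"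
      unfolding \<psi>_def \<phi>_def drop_bit_eq_div[symmetric] take_bit_eq_mod[symmetric] by simp
  qed
  ultimately show "\<exists>A B. C = A \<otimes>\<^sub>k B \<and> A \<in> real_paulis 1 \<and> B \<in> real_paulis m"
    using real_paulisI[of "a div ?N" 1 \<psi> 0] real_paulisI[of "a mod ?N" m \<phi> k] by auto
qed

lemma extraspecial_Suc:
  "extraspecial (Suc m) = {A \<otimes>\<^sub>k B | A B. A \<in> E1 \<and> B \<in> extraspecial m}"
    unfolding extraspecial_def
  proof safe
    fix As :: "complex mat list" assume As: "length As = Suc m" "set As \<subseteq> E1"
    then obtain A Bs where "As = A # Bs" by (cases As) auto
    thus "\<exists>A B. foldr (\<otimes>\<^sub>k) As (1\<^sub>m 1) = A \<otimes>\<^sub>k B \<and> A \<in> E1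
        \<and> B \<in> {foldr (\<otimes>\<^sub>k) As (1\<^sub>m 1) |As. length As = m \<and> set As \<subseteq> E1}"
      using As by (intro exI[of _ A] exI[of _ "foldr (\<otimes>\<^sub>k) Bs (1\<^sub>m 1)"]) auto
  next
    fix A :: "complex mat" and As :: "complex mat list"
    assume "A \<in> E1" "m = length As" "set As \<subseteq> E1"
    thus "\<exists>As'. A \<otimes>\<^sub>k foldr (\<otimes>\<^sub>k) As (1\<^sub>m 1) = foldr (\<otimes>\<^sub>k) As' (1\<^sub>m 1) \<and> length As' = Suc (length As) \<and> set As' \<subseteq> E1"
      by (intro exI[of _ "A # As"]) auto
  qed

lemma kronecker_one: "A \<otimes>\<^sub>k 1\<^sub>m 1 = A"
  by (rule eq_matI) (auto simp: kronecker_def)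

text \<open>The induction starts at 1: \<open>extraspecial 0\<close> lacks -1, which enters with the
  first factor from E(1).\<close>

lemma extraspecial_eq:
  assumes "m \<ge> 1" shows "extraspecial m = real_paulis m"
  using assms
proof (induction m rule: nat_induct_at_least)
  case base
  have "extraspecial 0 = {1\<^sub>m 1}" unfolding extraspecial_def by auto
  thus ?case using extraspecial_Suc[of 0] E1_eq by (simp add: kronecker_one[simplified])
next
  case (Suc m)
  show ?case unfolding extraspecial_Suc E1_eq Suc.IH real_paulis_Suc ..
qed

lemma extraspecial_Z4_eq:
  assumes "m \<ge> 1" shows "extraspecial_Z4 m = paulis m"
proof
  let ?U = "unitary_group (2 ^ m) UNIV"
  have i: "\<i> \<cdot>\<^sub>m 1\<^sub>m (2 ^ m) = pauli_mat m 1 0 (\<lambda>_. 1)"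
    by (rule eq_matI) (auto simp: pauli_mat_def)
  have iP: "\<i> \<cdot>\<^sub>m 1\<^sub>m (2 ^ m) \<in> paulis m" unfolding i using paulisI[OF _ pm_character_one, of 0 m 1] by simp
  have U: "A \<in> carrier ?U" if "A \<in> paulis m" for A using paulis_unitary[OF that] unitary_Q8_UNIV by auto
  have inv: "inv\<^bsub>?U\<^esub> A \<in> paulis m" if "A \<in> paulis m" for A
    using UNIV_ring.unitary_inv[OF U[OF that]] paulis_adjoint[OF that] by simp
  show "extraspecial_Z4 m \<subseteq> paulis m"
  proof
    fix A assume "A \<in> extraspecial_Z4 m"
    thus "A \<in> paulis m" unfolding extraspecial_Z4_def extraspecial_eq[OF assms]
      by (induction rule: generate.induct)
        (use iP inv inv[OF subsetD[OF real_paulis_subset]] paulis_mult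
          subsetD[OF real_paulis_subset one_in_real_paulis[of m]] subsetD[OF real_paulis_subset] in auto)
  qed
  show "paulis m \<subseteq> extraspecial_Z4 m"
  proof
    fix A assume "A \<in> paulis m"
    then obtain k a \<chi> where A: "A = pauli_mat m k a \<chi>" "a < 2 ^ m" "pm_character m \<chi>" unfolding paulis_def by auto
    have r: "pauli_mat m (2 * l) a \<chi> \<in> extraspecial_Z4 m" for l
      using real_paulisI[OF A(2,3), of l] unfolding extraspecial_Z4_def extraspecial_eq[OF assms]
      by (auto intro: generate.incl)
    have g: "\<i> \<cdot>\<^sub>m 1\<^sub>m (2 ^ m) \<in> extraspecial_Z4 m" unfolding extraspecial_Z4_def by (auto intro: generate.incl)
    show "A \<in> extraspecial_Z4 m"
    proof (cases "even k")
      case True thus ?thesis using r A(1) by (auto elim: evenE)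
    next
      case False
      then obtain l where l: "k = 2 * l + 1" by (auto elim: oddE)
      have "A = \<i> \<cdot>\<^sub>m 1\<^sub>m (2 ^ m) * pauli_mat m (2 * l) a \<chi>"
        unfolding A(1) l by (rule eq_matI) (auto simp: pauli_mat_def)
      thus ?thesis using generate.eng[OF g[unfolded extraspecial_Z4_def] r[unfolded extraspecial_Z4_def]]
        unfolding extraspecial_Z4_def by simp
    qed
  qed
qed

section \<open>Gates and Paulis belong to the Clifford group\<close>

lemma clifford_normalizer_iff:
  assumes "m \<ge> 1"
  shows "A \<in> clifford_normalizer m \<longleftrightarrow>
    A \<in> carrier (unitary_group (2 ^ m) Q_zeta8) \<and> (\<lambda>P. A * P * mat_adjoint A) ` paulis m = paulis m"
proof -
  let ?U = "unitary_group (2 ^ m) Q_zeta8"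
  have sub: "paulis m \<subseteq> carrier ?U" using paulis_unitary by blast
  have "A <#\<^bsub>?U\<^esub> paulis m #>\<^bsub>?U\<^esub> inv\<^bsub>?U\<^esub> A = (\<lambda>P. A * P * mat_adjoint A) ` paulis m"
    if "A \<in> carrier ?U"
    unfolding l_coset_def r_coset_def Q8.unitary_inv[OF that] by auto
  thus ?thesis unfolding clifford_normalizer_def normalizer_def stabilizer_def extraspecial_Z4_eq[OF assms]
    using sub by auto
qed

lemma square_mat_assoc:
  "A \<in> carrier_mat n n \<Longrightarrow> B \<in> carrier_mat n n \<Longrightarrow> C \<in> carrier_mat n n \<Longrightarrow> A * B * C = A * (B * (C :: complex mat))"
  by (rule assoc_mult_mat)

text \<open>Normalizing means equality of sets; conjugation by the adjoint supplies the
  preimages.\<close>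

lemma clifford_normalizerI:
  assumes "m \<ge> 1" "A \<in> carrier (unitary_group (2 ^ m) Q_zeta8)"
    and "\<And>P. P \<in> paulis m \<Longrightarrow> A * P * mat_adjoint A \<in> paulis m"
    and "\<And>P. P \<in> paulis m \<Longrightarrow> mat_adjoint A * P * A \<in> paulis m"
  shows "A \<in> clifford_normalizer m"
proof -
  let ?n = "2 ^ m :: nat"
  have "P \<in> (\<lambda>P. A * P * mat_adjoint A) ` paulis m" if P: "P \<in> paulis m" for P
  proof (rule image_eqI)
    have c: "A \<in> carrier_mat ?n ?n" "mat_adjoint A \<in> carrier_mat ?n ?n" "P \<in> carrier_mat ?n ?n"
      and u: "A * mat_adjoint A = 1\<^sub>m ?n"
      using assms(2) paulis_unitary[OF P] unfolding unitary_group_carrier_iff by auto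
    have c': "mat_adjoint A * P \<in> carrier_mat ?n ?n" "mat_adjoint A * P * A \<in> carrier_mat ?n ?n"
      using c by auto
    have "A * (mat_adjoint A * P * A) * mat_adjoint A = A * (mat_adjoint A * P * A * mat_adjoint A)"
      using square_mat_assoc c c' by blast
    also have "mat_adjoint A * P * A * mat_adjoint A = mat_adjoint A * P * (A * mat_adjoint A)"
      using square_mat_assoc c c' by blast
    also have "\<dots> = mat_adjoint A * P" unfolding u by (rule right_mult_one_mat[OF c'(1)])
    also have "A * (mat_adjoint A * P) = A * mat_adjoint A * P" using square_mat_assoc c by metis
    also have "\<dots> = P" unfolding u using c by simp
    finally show "P = A * (mat_adjoint A * P * A) * mat_adjoint A" by simp
  qed (rule assms(4)[OF P])
  thus ?thesis unfolding clifford_normalizer_iff[OF assms(1)] using assms(2,3) by auto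
qed

lemma tmat_adjoint:
  assumes "herm_pauli m k a \<chi>"
  shows "mat_adjoint (tmat m k a \<chi>) = tmat m (k + 2) a \<chi>"
proof (rule eq_matI)
  note h = herm_pauliD[OF assms]
  fix i j assume "i < dim_row (tmat m (k + 2) a \<chi>)" "j < dim_col (tmat m (k + 2) a \<chi>)"
  hence ij: "i < 2 ^ m" "j < 2 ^ m" by (auto simp: tmat_def)
  have x: "\<chi> (xor j a) = \<chi> j * (-1) ^ k" using pm_characterD(1)[OF h(1)] h(3) by simp
  have c: "cnj (\<i> ^ k) * (-1) ^ k = \<i> ^ k" by (simp flip: power_mult_distrib)
  hence c: "cnj (\<i> ^ k) * (\<chi> j * (-1) ^ k) = \<i> ^ k * \<chi> j" by (metis mult.assoc mult.commute)
  have "cnj (pauli_mat m k a \<chi> $$ (j, i)) = pauli_mat m k a \<chi> $$ (i, j)"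
    using ij c x pm_characterD(7)[OF h(1)] by (auto simp: pauli_mat_def)
  moreover have "pauli_mat m (k + 2) a \<chi> $$ (i, j) = - pauli_mat m k a \<chi> $$ (i, j)"
    using ij by (simp add: pauli_mat_def power_add)
  ultimately show "mat_adjoint (tmat m k a \<chi>) $$ (i, j) = tmat m (k + 2) a \<chi> $$ (i, j)"
    using ij by (auto simp: tmat_def)
qed (auto simp: tmat_def)

lemma herm_pauli_less: "herm_pauli m k a \<chi> \<Longrightarrow> a < 2 ^ m"
  unfolding herm_pauli_def by auto

lemma tmat_inverse:
  assumes "herm_pauli m k a \<chi>"
  shows "tmat m (k + 2) a \<chi> * tmat m k a \<chi> = 1\<^sub>m (2 ^ m)"
  using represents_mult[OF represents_tmat represents_tmat, OF herm_pauli_less[OF assms] herm_pauli_less[OF assms]] represents_one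
  by (rule represents_unique) (simp only: tgate_inverse[OF assms])

lemma tmat_unitary:
  assumes "herm_pauli m k a \<chi>"
  shows "tmat m k a \<chi> \<in> carrier (unitary_group (2 ^ m) Q_zeta8)"
proof -
  have "tmat m k a \<chi> * tmat m (k + 2) a \<chi> = 1\<^sub>m (2 ^ m)"
    using tmat_inverse[OF assms] mat_mult_left_right_inverse[of "tmat m (k + 2) a \<chi>" "2 ^ m" "tmat m k a \<chi>"] by simp
  moreover have p: "pauli_mat m k a \<chi> $$ (i, j) \<in> Q_zeta8" if "i < 2 ^ m" "j < 2 ^ m" for i j
    using paulis_unitary[OF paulisI[OF herm_pauliD(2,1)[OF assms]]] that unfolding unitary_group_carrier_iff by auto
  hence "tmat m k a \<chi> $$ (i, j) \<in> Q_zeta8" if "i < 2 ^ m" "j < 2 ^ m" for i j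
  proof -
    have "((if i = j then 1 else 0) + \<i> * pauli_mat m k a \<chi> $$ (i, j)) * (1 / s2) \<in> Q_zeta8"
      using Q8_i_power[of 1] Q8.K01
      by (intro Q8.K_mult Q8.K_add Q8_inverse_s2 p that) (simp_all split: if_splits)
    thus ?thesis using that by (simp only: tmat_def index_mat case_prod_conv)
  qed
  ultimately show ?thesis unfolding unitary_group_carrier_iff tmat_adjoint[OF assms] by simp
qed

text \<open>Paulis P and Q commute up to the sign s = \<chi> b * \<psi> a. If s = 1, the gate T of P
  commutes with Q. If s = -1, then T Q = Q T^-1, so T Q T^-1 = Q T^-2 = -i Q P, again a
  Pauli.\<close>

lemma tmat_conj_pauli:
  assumes h: "herm_pauli m k a \<chi>" and P: "P \<in> paulis m"
  shows "tmat m k a \<chi> * P * mat_adjoint (tmat m k a \<chi>) \<in> paulis m"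
proof -
  note hd = herm_pauliD[OF h]
  obtain l b \<psi> where Pm: "P = pauli_mat m l b \<psi>" "b < 2 ^ m" "pm_character m \<psi>" using P unfolding paulis_def by blast
  have h2: "herm_pauli m (k + 2) a \<chi>" using herm_pauli_add2[OF h] .
  have h4: "tgate (k + 2 + 2) a \<chi> = tgate k a \<chi>" by (intro ext) (simp add: tgate_def pauli_act_def power_add)
  have TT: "tgate k a \<chi> (tgate (k + 2) a \<chi> v) = v" for v using tgate_inverse[OF h2] unfolding h4 .
  let ?T = "tgate k a \<chi>" and ?T' = "tgate (k + 2) a \<chi>" and ?P = "pauli_act k a \<chi>" and ?Q = "pauli_act l b \<psi>"
  define s where "s = \<chi> b * \<psi> a"
  have PQ: "?P (?Q v) j = s * ?Q (?P v) j" for v j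
  proof -
    have e: "xor (xor j a) b = xor (xor j b) a" by (metis xor.assoc xor.commute)
    have "\<chi> (xor j a) = \<chi> (xor (xor j a) b) * \<chi> b" "\<psi> (xor (xor j a) b) = \<psi> (xor j b) * \<psi> a"
      by (metis pm_characterD(1)[OF hd(1)] xor_cancel(1), metis pm_characterD(1)[OF Pm(3)] e)
    thus ?thesis unfolding pauli_act_def s_def e by (simp add: mult_ac)
  qed
  have s: "s = 1 \<or> s = -1" unfolding s_def using pm_characterD(2)[OF hd(1), of b] pm_characterD(2)[OF Pm(3), of a] by auto
  have rep: "represents (2 ^ m) (tmat m k a \<chi> * P * mat_adjoint (tmat m k a \<chi>)) (\<lambda>v. ?T (?Q (?T' v)))"
    unfolding tmat_adjoint[OF h] Pm(1)
    using represents_mult[OF represents_mult[OF represents_tmat[OF hd(2)] represents_pauli[OF Pm(2)]] represents_tmat[OF hd(2)]] .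
  show ?thesis
  proof (cases "s = 1")
    case True
    have "?T (?Q v) = ?Q (?T v)" for v
    proof
      fix j
      have "?T (?Q v) j = (?Q v j + \<i> * ?Q (?P v) j) / s2" unfolding tgate_def PQ True by simp
      also have "\<dots> = ?Q (?T v) j" by (simp add: tgate_def pauli_act_def field_simps)
      finally show "?T (?Q v) j = ?Q (?T v) j" .
    qed
    hence rep': "represents (2 ^ m) (tmat m k a \<chi> * P * mat_adjoint (tmat m k a \<chi>)) (\<lambda>v. ?Q v)"
      using rep by (simp only: TT)
    have "tmat m k a \<chi> * P * mat_adjoint (tmat m k a \<chi>) = P"
      by (rule represents_unique[OF rep' represents_pauli[OF Pm(2), of l \<psi>, folded Pm(1)]]) simp
    thus ?thesis using P by simp
  next
    case False
    hence sm: "s = -1" using s by auto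
    have "?T (?Q v) = ?Q (?T' v)" for v
    proof
      fix j
      have "?T (?Q v) j = (?Q v j - \<i> * ?Q (?P v) j) / s2" unfolding tgate_def PQ sm by simp
      also have "\<dots> = ?Q (?T' v) j" by (simp add: tgate_def pauli_act_def field_simps power_add)
      finally show "?T (?Q v) j = ?Q (?T' v) j" .
    qed
    moreover have "?T' (?T' v) = pauli_act (k + 3) a \<chi> v" for v
      using tgate_twice[OF h2] by (intro ext) (simp add: pauli_act_def power_add power3_eq_cube mult_ac)
    ultimately have "tmat m k a \<chi> * P * mat_adjoint (tmat m k a \<chi>) = P * pauli_mat m (k + 3) a \<chi>"
      using rep represents_mult[OF represents_pauli[OF Pm(2)] represents_pauli[OF hd(2)]]
      unfolding Pm(1) by (intro represents_unique) auto
    thus ?thesis using paulis_mult[OF P paulisI[OF hd(2,1)]] by simp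
  qed
qed

lemma tmat_finite_clifford:
  assumes m: "m \<ge> 1" and h: "herm_pauli m k a \<chi>"
  shows "tmat m k a \<chi> \<in> finite_clifford m"
proof -
  note hd = herm_pauliD[OF h]
  have h2: "herm_pauli m (k + 2) a \<chi>" using herm_pauli_add2[OF h] .
  have "mat_adjoint (tmat m k a \<chi>) * P * tmat m k a \<chi> \<in> paulis m" if "P \<in> paulis m" for P
    using tmat_conj_pauli[OF h2 that] unfolding tmat_adjoint[OF h, symmetric] by simp
  hence "tmat m k a \<chi> \<in> clifford_normalizer m"
    by (intro clifford_normalizerI m tmat_unitary[OF h] tmat_conj_pauli[OF h]) auto
  \<comment> \<open>T^2 = i P gives T^4 = -1.\<close>
  moreover have "tmat m k a \<chi> ^\<^sub>m 8 = 1\<^sub>m (2 ^ m)"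
  proof -
    let ?T = "tgate k a \<chi>"
    have tt: "?T (?T v) = (\<lambda>j. \<i> * pauli_act k a \<chi> v j)" for v using tgate_twice[OF h] by blast
    have "pauli_act k a \<chi> (\<lambda>j. \<i> * w j) = (\<lambda>j. \<i> * pauli_act k a \<chi> w j)" for w
      using pauli_act_linear[of k a \<chi> \<i> w 0 w] by simp
    hence t4: "?T (?T (?T (?T v))) = (\<lambda>j. - v j)" for v
      unfolding tt by (simp add: pauli_act_twice[OF h])
    have "(?T ^^ 8) v = ?T (?T (?T (?T (?T (?T (?T (?T v)))))))" for v by (simp add: eval_nat_numeral)
    hence "(?T ^^ 8) v = v" for v by (simp add: t4)
    thus ?thesis using represents_pow[OF represents_tmat[OF hd(2)]] represents_one by (intro represents_unique) auto
  qed
  ultimately show ?thesis unfolding finite_clifford_def by (intro CollectI conjI exI[of _ 8]) auto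
qed

lemma paulis_finite_clifford:
  assumes m: "m \<ge> 1" and P: "P \<in> paulis m"
  shows "P \<in> finite_clifford m"
proof -
  have "mat_adjoint P \<in> paulis m" using paulis_adjoint[OF P] .
  hence "P \<in> clifford_normalizer m"
    by (intro clifford_normalizerI m paulis_unitary P) (auto intro: paulis_mult P)
  moreover have "P ^\<^sub>m 8 = 1\<^sub>m (2 ^ m)"
  proof -
    obtain k a \<chi> where *: "P = pauli_mat m k a \<chi>" "a < 2 ^ m" "pm_character m \<chi>"
      using P unfolding paulis_def by blast
    have tt: "pauli_act k a \<chi> (pauli_act k a \<chi> v) = (\<lambda>j. (-1) ^ k * \<chi> a * v j)" for v
    proof
      fix j
      have "pauli_act k a \<chi> (pauli_act k a \<chi> v) j = (\<i> ^ k * \<i> ^ k) * (\<chi> (xor j a) * \<chi> j) * v j"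
        unfolding pauli_act_def by simp
      also have "\<chi> (xor j a) * \<chi> j = \<chi> a"
        using pm_characterD(1,4)[OF *(3), of j] by (simp add: mult_ac)
      also have "\<i> ^ k * \<i> ^ k = (-1) ^ k" by (simp flip: power_mult_distrib)
      finally show "pauli_act k a \<chi> (pauli_act k a \<chi> v) j = (-1) ^ k * \<chi> a * v j" .
    qed
    have "(-1) ^ k * \<chi> a = 1 \<or> (-1) ^ k * \<chi> a = -1"
      using pm_characterD(2)[OF *(3), of a] by (cases "even k") auto
    then obtain s :: complex where s: "(-1) ^ k * \<chi> a = s" "s = 1 \<or> s = -1" by blast
    have lin: "pauli_act k a \<chi> (\<lambda>j. s * w j) = (\<lambda>j. s * pauli_act k a \<chi> w j)" for w
      using pauli_act_linear[of k a \<chi> s w 0 w] by simp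
    have "(pauli_act k a \<chi> ^^ 8) v = v" for v using s(2)
      by (auto simp: eval_nat_numeral tt s(1))
    thus ?thesis unfolding *(1) using represents_pow[OF represents_pauli[OF *(2)]] represents_one
      by (intro represents_unique) auto
  qed
  ultimately show ?thesis unfolding finite_clifford_def by (intro CollectI conjI exI[of _ 8]) auto
qed

section \<open>Finite groups containing the Clifford group\<close>

lemma trace_comm:
  fixes A B :: "complex mat"
  assumes "A \<in> carrier_mat n k" "B \<in> carrier_mat k n"
  shows "(\<Sum>i<n. (A * B) $$ (i, i)) = (\<Sum>i<k. (B * A) $$ (i, i))"
proof -
  have "(\<Sum>i<n. (A * B) $$ (i, i)) = (\<Sum>i<n. \<Sum>j<k. A $$ (i, j) * B $$ (j, i))"
    using assms by (intro sum.cong) (auto simp: scalar_prod_def atLeast0LessThan)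
  also have "\<dots> = (\<Sum>j<k. \<Sum>i<n. A $$ (i, j) * B $$ (j, i))" by (rule sum.swap)
  also have "\<dots> = (\<Sum>i<k. (B * A) $$ (i, i))"
    using assms by (intro sum.cong) (auto simp: scalar_prod_def atLeast0LessThan mult.commute)
  finally show ?thesis .
qed

text \<open>A triangular form is enough: the trace is the sum of its diagonal entries, and these are
  eigenvalues, hence k-th roots of unity.\<close>

lemma trace_finite_order:
  fixes A :: "complex mat"
  assumes A: "A \<in> carrier_mat n n" and k: "A ^\<^sub>m k = 1\<^sub>m n"
    and S: "0 \<in> S" "\<And>x y. x \<in> S \<Longrightarrow> y \<in> S \<Longrightarrow> x + y \<in> S" "\<And>x. x ^ k = 1 \<Longrightarrow> x \<in> S"
  shows "(\<Sum>i<n. A $$ (i, i)) \<in> S"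
proof -
  obtain es where es: "char_poly A = (\<Prod>e\<leftarrow>es. [:- e, 1:])" using char_poly_factorized[OF A] by blast
  obtain B P Q where "schur_decomposition A es = (B, P, Q)" by (metis surj_pair)
  from schur_decomposition[OF A es this] have w: "similar_mat_wit A B P Q" and d: "diag_mat B = es" by auto
  note D = similar_mat_witD2[OF A w]
  have "(\<Sum>i<n. A $$ (i, i)) = (\<Sum>i<n. (P * B * Q) $$ (i, i))" using D(3) by simp
  also have "\<dots> = (\<Sum>i<n. (Q * (P * B)) $$ (i, i))" by (rule trace_comm) (use D in auto)
  also have "Q * (P * B) = Q * P * B" by (rule assoc_mult_mat[symmetric]) (use D in auto)
  also have "\<dots> = B" using D by simp
  also have "(\<Sum>i<n. B $$ (i, i)) = sum_list es"
    unfolding d[symmetric] diag_mat_def using D(5) by (simp add: sum_list_distinct_conv_sum_set atLeast0LessThan)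
  finally have tr: "(\<Sum>i<n. A $$ (i, i)) = sum_list es" .
  have "e \<in> S" if "e \<in> set es" for e
  proof -
    have "poly (char_poly A) e = 0" unfolding es poly_prod_list using that by (auto simp: prod_list_zero_iff)
    hence "eigenvalue A e" using eigenvalue_root_char_poly[OF A] by simp
    then obtain v where v: "eigenvector A v e" unfolding eigenvalue_def by blast
    have vc: "v \<in> carrier_vec n" "v \<noteq> 0\<^sub>v n" using v A unfolding eigenvector_def by auto
    have "v = e ^ k \<cdot>\<^sub>v v" using eigenvector_pow[OF A v, of k] vc unfolding k by simp
    moreover obtain i where i: "i < n" "v $ i \<noteq> 0" using vc by (metis carrier_vecD eq_vecI index_zero_vec)
    ultimately have "v $ i = e ^ k * v $ i" using vc by (metis carrier_vecD index_smult_vec(1))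
    thus ?thesis using i by (intro S(3)) simp
  qed
  hence "sum_list es \<in> S" by (induction es) (auto simp: S(1,2))
  thus ?thesis unfolding tr .
qed

lemma i_power_cases: "\<i> ^ k = 1 \<or> \<i> ^ k = \<i> \<or> \<i> ^ k = -1 \<or> \<i> ^ k = -\<i>"
  by (induction k) auto

text \<open>The exponent 3 cancels the factor i of the gate, at the price of \<chi> b = -1. Such
  gates build the vectors supported on four coordinates with real signs.\<close>

lemma tgate_swap:
  assumes "b \<noteq> 0" "b < 2 ^ m"
  obtains l \<chi> where "herm_pauli m l b \<chi>" "pm_character m \<chi>"
    "\<And>v j. tgate l b \<chi> v j = (v j + \<chi> (xor j b) * v (xor j b)) / s2"
proof -
  obtain \<chi> where c: "pm_character m \<chi>" "\<chi> b = -1" using pm_character_exists[OF assms, of "-1"] by auto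
  have "herm_pauli m 3 b \<chi>" unfolding herm_pauli_def using c assms by simp
  thus ?thesis using that[of 3 \<chi>] c(1) by (simp add: tgate_def pauli_act_def power3_eq_cube mult.assoc)
qed

definition act :: "nat \<Rightarrow> complex mat \<Rightarrow> (nat \<Rightarrow> complex) \<Rightarrow> nat \<Rightarrow> complex" where
  "act n g v i = (\<Sum>j<n. g $$ (i, j) * v j)"

lemma act_linear: "act n g (\<lambda>j. x * u j + y * v j) i = x * act n g u i + y * act n g v i"
  unfolding act_def by (simp add: sum.distrib sum_distrib_left algebra_simps)

lemma act_scale: "act n g (\<lambda>j. x * u j) i = x * act n g u i"
  unfolding act_def by (simp add: sum_distrib_left mult.left_commute)

lemma act_add: "act n g (\<lambda>j. u j + v j) i = act n g u i + act n g v i"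
  unfolding act_def by (simp add: sum.distrib algebra_simps)

lemma act_diff: "act n g (\<lambda>j. u j - v j) i = act n g u i - act n g v i"
  unfolding act_def by (simp add: sum_subtractf algebra_simps)

lemma act_divide: "act n g (\<lambda>j. u j / x) i = act n g u i / x"
  unfolding act_def by (simp add: sum_divide_distrib)

lemma act_cong: "(\<And>j. j < n \<Longrightarrow> u j = v j) \<Longrightarrow> act n g u i = act n g v i"
  unfolding act_def by simp

lemma act_mult:
  assumes "g \<in> carrier_mat n n" "h \<in> carrier_mat n n" "i < n"
  shows "act n (g * h) v i = act n g (act n h v) i"
proof -
  have "act n (g * h) v i = (\<Sum>j<n. \<Sum>l<n. g $$ (i, l) * h $$ (l, j) * v j)"
    unfolding act_def using assms
    by (intro sum.cong) (auto simp: scalar_prod_def atLeast0LessThan sum_distrib_right)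
  also have "\<dots> = (\<Sum>l<n. \<Sum>j<n. g $$ (i, l) * h $$ (l, j) * v j)" by (rule sum.swap)
  also have "\<dots> = act n g (act n h v) i" unfolding act_def by (simp add: sum_distrib_left mult.assoc)
  finally show ?thesis .
qed

lemma act_one: "i < n \<Longrightarrow> act n (1\<^sub>m n) v i = v i"
  unfolding act_def by (simp add: if_distrib[of "\<lambda>x. x * _"] cong: if_cong)

lemma act_represents: "represents n A F \<Longrightarrow> i < n \<Longrightarrow> act n A v i = F v i"
proof -
  assume a: "represents n A F" "i < n"
  hence "A \<in> carrier_mat n n" unfolding represents_def by blast
  hence "act n A v i = (A *\<^sub>v vec n v) $ i"
    using a(2) by (simp add: act_def scalar_prod_def atLeast0LessThan)
  also have "\<dots> = F v i" using a unfolding represents_def by simp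
  finally show ?thesis .
qed

lemma act_sum_squares:
  assumes "g \<in> carrier (unitary_group n K)"
  shows "(\<Sum>i<n. act n g v i * cnj (act n g v i)) = (\<Sum>i<n. v i * cnj (v i))"
proof -
  have c: "g \<in> carrier_mat n n" using assms unfolding unitary_group_carrier_iff by auto
  have o: "(\<Sum>i<n. g $$ (i, j) * cnj (g $$ (i, l))) = (if j = l then 1 else 0)" if "j < n" "l < n" for j l
  proof -
    have "(mat_adjoint g * g) $$ (l, j) = (\<Sum>i<n. cnj (g $$ (i, l)) * g $$ (i, j))"
      using c that by (simp add: scalar_prod_def atLeast0LessThan)
    thus ?thesis unfolding unitary_adjoint_left[OF assms] using that by (auto simp: mult.commute)
  qed
  have "(\<Sum>i<n. act n g v i * cnj (act n g v i))
      = (\<Sum>i<n. \<Sum>j<n. \<Sum>l<n. v j * cnj (v l) * (g $$ (i, j) * cnj (g $$ (i, l))))"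
    unfolding act_def by (simp add: sum_product mult_ac)
  also have "\<dots> = (\<Sum>j<n. \<Sum>i<n. \<Sum>l<n. v j * cnj (v l) * (g $$ (i, j) * cnj (g $$ (i, l))))"
    by (rule sum.swap)
  also have "\<dots> = (\<Sum>j<n. \<Sum>l<n. \<Sum>i<n. v j * cnj (v l) * (g $$ (i, j) * cnj (g $$ (i, l))))"
    by (intro sum.cong refl sum.swap)
  also have "\<dots> = (\<Sum>j<n. \<Sum>l<n. v j * cnj (v l) * (if j = l then 1 else 0))"
    by (intro sum.cong refl) (simp add: o flip: sum_distrib_left)
  also have "\<dots> = (\<Sum>i<n. v i * cnj (v i))"
    by (intro sum.cong refl) (simp add: if_distrib cong: if_cong)
  finally show ?thesis .
qed

lemma clifford_normalizer_subgroup: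
  assumes "m \<ge> 1" shows "subgroup (clifford_normalizer m) (unitary_group (2 ^ m) Q_zeta8)"
  unfolding clifford_normalizer_def extraspecial_Z4_eq[OF assms]
  by (rule Q8.unitary.normalizer_imp_subgroup) (use paulis_unitary in blast)

lemma smult_smult_mat: "c \<cdot>\<^sub>m (d \<cdot>\<^sub>m A) = (c * d) \<cdot>\<^sub>m (A :: complex mat)"
  by (rule eq_matI) auto

lemma one_smult_mat: "1 \<cdot>\<^sub>m A = (A :: complex mat)"
  by (rule eq_matI) auto

lemma pow_mat_smult:
  assumes "A \<in> carrier_mat n n"
  shows "(c \<cdot>\<^sub>m A) ^\<^sub>m k = c ^ k \<cdot>\<^sub>m (A ^\<^sub>m k :: complex mat)"
proof (induction k)
  case 0
  thus ?case using assms by auto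
next
  case (Suc k)
  have p: "A ^\<^sub>m k \<in> carrier_mat n n" using assms by (rule pow_carrier_mat)
  show ?case using Suc mult_smult_assoc_mat[OF p, of "c \<cdot>\<^sub>m A" n "c ^ k"] mult_smult_distrib[OF p assms, of c] assms
    by (simp add: smult_smult_mat mult.commute)
qed

lemma finite_unitary_subgroup_order:
  assumes "subgroup G (unitary_group n UNIV)" "finite G" "g \<in> G"
  shows "g ^\<^sub>m card G = 1\<^sub>m n"
proof -
  let ?H = "unitary_group n UNIV\<lparr>carrier := G\<rparr>"
  interpret H: group ?H by (rule subgroup.subgroup_is_group[OF assms(1) UNIV_ring.unitary.is_group])
  have c: "g \<in> carrier_mat n n"
    using subgroup.mem_carrier[OF assms(1,3)] unfolding unitary_group_carrier_iff by simp
  have "g [^]\<^bsub>?H\<^esub> (k::nat) = g ^\<^sub>m k" for k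
    by (induction k) (use c in \<open>auto simp: unitary_group_def\<close>)
  thus ?thesis using H.pow_order_eq_1[of g] assms(2,3) by (simp add: Coset.order_def)
qed

text \<open>Integrality of traces is the only arithmetic condition on G; it holds for finite G once
  R contains enough roots of unity.\<close>

locale clifford_overgroup = trace_ring R \<tau> for R \<tau> +
  fixes m :: nat and G :: "complex mat set"
  assumes m: "m \<ge> 1"
    and G_subgroup: "subgroup G (unitary_group (2 ^ m) UNIV)"
    and G_finite: "finite G"
    and G_clifford: "finite_clifford m \<subseteq> G"
    and G_trace: "\<And>g. g \<in> G \<Longrightarrow> (\<Sum>i<2 ^ m. g $$ (i, i)) \<in> R"
begin

abbreviation N :: nat where "N \<equiv> 2 ^ m"

abbreviation ev :: "nat \<Rightarrow> nat \<Rightarrow> complex" where "ev J j \<equiv> e0 m (xor j J)"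

lemma G_unitary: "g \<in> G \<Longrightarrow> g \<in> carrier (unitary_group N UNIV)"
  using subgroup.subset[OF G_subgroup] by blast

lemma G_carrier [simp]: "g \<in> G \<Longrightarrow> g \<in> carrier_mat N N"
  using G_unitary unfolding unitary_group_carrier_iff by blast

lemma G_mult [simp]: "g \<in> G \<Longrightarrow> h \<in> G \<Longrightarrow> g * h \<in> G"
  using subgroup.m_closed[OF G_subgroup] by simp

lemma G_adjoint [simp]: "g \<in> G \<Longrightarrow> mat_adjoint g \<in> G"
  using subgroup.m_inv_closed[OF G_subgroup] UNIV_ring.unitary_inv[OF G_unitary] by metis

lemma G_inverse: "g \<in> G \<Longrightarrow> g * mat_adjoint g = 1\<^sub>m N" "g \<in> G \<Longrightarrow> mat_adjoint g * g = 1\<^sub>m N"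
  using G_unitary unitary_adjoint_left unfolding unitary_group_carrier_iff by blast+

lemma G_one: "1\<^sub>m N \<in> G"
  using subgroup.one_closed[OF G_subgroup] by simp

lemma ev_index: "ev J j = (if j = J then s2 ^ m else 0)"
  unfolding e0_def by (auto simp: xor_eq_0_iff)

text \<open>The lattice L of the overview. Invariance under G is built in, and as G contains the
  gates, its vectors satisfy \<open>latt\<close>, where short vectors are under control.\<close>

definition inL :: "(nat \<Rightarrow> complex) \<Rightarrow> bool" where
  "inL v \<longleftrightarrow> (\<forall>g\<in>G. act N g v 0 \<in> R)"

lemma inL_cong: "(\<And>j. j < N \<Longrightarrow> u j = v j) \<Longrightarrow> inL u \<Longrightarrow> inL v"
  unfolding inL_def using act_cong[of N u v] by auto

lemma inL_linear: "inL u \<Longrightarrow> inL v \<Longrightarrow> x \<in> R \<Longrightarrow> y \<in> R \<Longrightarrow> inL (\<lambda>j. x * u j + y * v j)"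
  unfolding inL_def act_linear by auto

lemma inL_add: "inL u \<Longrightarrow> inL v \<Longrightarrow> inL (\<lambda>j. u j + v j)"
  using inL_linear[of u v 1 1] by simp

lemma inL_diff: "inL u \<Longrightarrow> inL v \<Longrightarrow> inL (\<lambda>j. u j - v j)"
  using inL_linear[of u v 1 "-1"] by simp

lemma inL_scale: "inL u \<Longrightarrow> x \<in> R \<Longrightarrow> inL (\<lambda>j. x * u j)"
  using inL_linear[of u u x 0] by simp

lemma inL_act:
  assumes "inL v" "g \<in> G" shows "inL (act N g v)"
  unfolding inL_def
proof
  fix h assume h: "h \<in> G"
  have "act N h (act N g v) 0 = act N (h * g) v 0" using act_mult[of h N g 0 v] h assms(2) by simp
  thus "act N h (act N g v) 0 \<in> R" using assms h unfolding inL_def by simp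
qed

lemma clifford_op_matrix:
  assumes "clifford_op m W"
  obtains A where "A \<in> G" "A \<in> clifford_normalizer m" "represents N A W"
proof -
  have "\<exists>A\<in>G \<inter> clifford_normalizer m. represents N A W" using assms
  proof (induction rule: clifford_op.induct)
    case id
    have "1\<^sub>m N \<in> clifford_normalizer m"
      using subgroup.one_closed[OF clifford_normalizer_subgroup[OF m]] by simp
    thus ?case using represents_one[of N] G_one by blast
  next
    case (step W k a \<chi>)
    then obtain A where A: "A \<in> G" "A \<in> clifford_normalizer m" "represents N A W" by blast
    have T: "tmat m k a \<chi> \<in> finite_clifford m" using tmat_finite_clifford[OF m step(2)] .
    have "tmat m k a \<chi> * A \<in> clifford_normalizer m"
      using subgroup.m_closed[OF clifford_normalizer_subgroup[OF m], of "tmat m k a \<chi>" A] T A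
      unfolding finite_clifford_def by simp
    moreover have "tmat m k a \<chi> * A \<in> G" using T G_clifford A(1) by auto
    moreover have "represents N (tmat m k a \<chi> * A) (\<lambda>v. tgate k a \<chi> (W v))"
      by (rule represents_mult[OF represents_tmat[OF herm_pauliD(2)[OF step(2)]] A(3)])
    ultimately show ?case by blast
  qed
  thus ?thesis using that by blast
qed

lemma inL_latt: "inL v \<Longrightarrow> latt m v"
  unfolding latt_def
proof safe
  fix W assume v: "inL v" and W: "clifford_op m W"
  obtain A where A: "A \<in> G" "represents N A W" by (rule clifford_op_matrix[OF W])
  show "W v 0 \<in> R" using v A(1) act_represents[OF A(2), of 0 v] unfolding inL_def by auto
qed

lemma inL_clifford_op:
  assumes "clifford_op m W" "inL v" shows "inL (W v)"
proof -
  obtain A where A: "A \<in> G" "represents N A W" by (rule clifford_op_matrix[OF assms(1)])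
  show ?thesis
    by (rule inL_cong[OF _ inL_act[OF assms(2) A(1)]]) (rule act_represents[OF A(2)])
qed

text \<open>Since \<open>\<surd>2\<close> times the projection \<open>diag(1, 0)\<close> is \<open>-\<i> (T - \<zeta>\<^sub>8\<^sup>-\<^sup>1)\<close> for a Clifford gate \<open>T\<close>,
  traces over the first half of the coordinates lose only a factor \<open>\<surd>2\<close>.\<close>

lemma partial_trace:
  "k \<le> m \<Longrightarrow> g \<in> G \<Longrightarrow> s2 ^ k * (\<Sum>j<2 ^ (m - k). g $$ (j, j)) \<in> R"
proof (induction k arbitrary: g)
  case 0
  thus ?case using G_trace by simp
next
  case (Suc k)
  define n where "n = m - Suc k"
  have mk: "m - k = Suc n" "n < m" using Suc.prems unfolding n_def by auto
  define \<chi> :: "nat \<Rightarrow> complex" where "\<chi> = (\<lambda>j. if bit j n then -1 else 1)"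
  have h: "herm_pauli m 0 0 \<chi>" unfolding herm_pauli_def \<chi>_def using pm_character_bit[OF mk(2)] by simp
  define T where "T = tmat m 0 0 \<chi>"
  have TG: "T \<in> G" using tmat_finite_clifford[OF m h] G_clifford unfolding T_def by blast
  have gT: "(g * T) $$ (j, j) = g $$ (j, j) * ((1 + \<i> * \<chi> j) / s2)" if "j < N" for j
  proof -
    have "(g * T) $$ (j, j) = (\<Sum>l<N. g $$ (j, l) * T $$ (l, j))"
      using that G_carrier[OF Suc.prems(2)] G_carrier[OF TG] by (simp add: scalar_prod_def atLeast0LessThan)
    also have "\<dots> = (\<Sum>l<N. if l = j then g $$ (j, j) * ((1 + \<i> * \<chi> j) / s2) else 0)"
      using that by (intro sum.cong) (auto simp: T_def tmat_def pauli_mat_def)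
    finally show ?thesis using that by simp
  qed
  define A where "A = (\<Sum>j<2 ^ n. g $$ (j, j))"
  define B where "B = (\<Sum>j<2 ^ n. g $$ (xor j (2 ^ n), xor j (2 ^ n)))"
  have le: "(2::nat) ^ Suc n \<le> N" using mk(2) by (intro power_increasing) auto
  have c: "\<chi> j = 1" "\<chi> (xor j (2 ^ n)) = -1" "j < N" "xor j (2 ^ n) < N" if "j < 2 ^ n" for j
  proof -
    have nb: "\<not> bit j n" using that by (metis bit_take_bit_iff less_irrefl take_bit_nat_eq_self_iff)
    thus "\<chi> j = 1" "\<chi> (xor j (2 ^ n)) = -1" unfolding \<chi>_def by (auto simp: bit_simps)
    show "j < N" "xor j (2 ^ n) < N" using that le by (auto simp: xor_2pow_eq_add)
  qed
  have S: "(\<Sum>j<2 ^ Suc n. g $$ (j, j)) = A + B" unfolding A_def B_def by (rule sum_lessThan_2pow_Suc)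
  have "(\<Sum>j<2 ^ Suc n. (g * T) $$ (j, j)) = (\<Sum>j<2 ^ n. g $$ (j, j) * ((1 + \<i>) / s2))
      + (\<Sum>j<2 ^ n. g $$ (xor j (2 ^ n), xor j (2 ^ n)) * ((1 - \<i>) / s2))"
    unfolding sum_lessThan_2pow_Suc by (intro arg_cong2[of _ _ _ _ "(+)"] sum.cong refl) (simp_all add: gT c)
  also have "\<dots> = A * ((1 + \<i>) / s2) + B * ((1 - \<i>) / s2)" unfolding A_def B_def by (simp only: sum_distrib_right)
  finally have S': "(\<Sum>j<2 ^ Suc n. (g * T) $$ (j, j)) = A * ((1 + \<i>) / s2) + B * ((1 - \<i>) / s2)" .
  have r: "s2 ^ k * (A + B) \<in> R" "s2 ^ k * (A * ((1 + \<i>) / s2) + B * ((1 - \<i>) / s2)) \<in> R"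
    using Suc.IH[OF _ Suc.prems(2)] Suc.IH[OF _ G_mult[OF Suc.prems(2) TG]] Suc.prems(1) S S' mk(1) by auto
  have "cnj zeta8 = (1 - \<i>) / s2" unfolding zeta8_alt by simp
  hence "(1 - \<i>) / s2 \<in> R" using cnj_R[OF zeta8_R] by simp
  hence "- \<i> * (s2 ^ k * (A * ((1 + \<i>) / s2) + B * ((1 - \<i>) / s2)) - (1 - \<i>) / s2 * (s2 ^ k * (A + B))) \<in> R"
    using r by (intro mult_R[OF uminus_R[OF i_R]] diff_R mult_R[OF \<open>(1 - \<i>) / s2 \<in> R\<close>])
  also have "- \<i> * (s2 ^ k * (A * ((1 + \<i>) / s2) + B * ((1 - \<i>) / s2)) - (1 - \<i>) / s2 * (s2 ^ k * (A + B)))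
      = s2 ^ k * (2 / s2) * A" by (simp add: field_simps)
  also have "2 / s2 = s2" by (simp add: field_simps)
  finally show ?case unfolding A_def n_def by (simp add: mult_ac)
qed

text \<open>Coordinate 0 of g applied to \<open>e0 m\<close> is s2^m times the corner entry of g,
  which is the partial trace left after m halvings.\<close>

lemma inL_e0: "inL (e0 m)"
  unfolding inL_def
proof
  fix g assume "g \<in> G"
  have "act N g (e0 m) 0 = (\<Sum>j<N. if j = 0 then g $$ (0, 0) * s2 ^ m else 0)"
    unfolding act_def e0_def by (intro sum.cong) auto
  also have "\<dots> = s2 ^ m * g $$ (0, 0)" by simp
  finally show "act N g (e0 m) 0 \<in> R" using partial_trace[of m g] \<open>g \<in> G\<close> by simp
qed

lemma nrm_act: "inL v \<Longrightarrow> g \<in> G \<Longrightarrow> nrm m (act N g v) = nrm m v"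
  using nrm_eq_\<tau>[of m v] nrm_eq_\<tau>[of m "act N g v"] latt_R[OF inL_latt] inL_act act_sum_squares[OF G_unitary]
  by simp

lemma nrm_ev: "J < N \<Longrightarrow> nrm m (ev J) = 2 ^ m"
proof -
  assume J: "J < N"
  have "nrm m (ev J) = (\<Sum>j<N. if j = J then \<tau> (s2 ^ m * cnj (s2 ^ m)) else 0)"
    unfolding nrm_def by (intro sum.cong) (auto simp: ev_index)
  also have "s2 ^ m * cnj (s2 ^ m) = 2 ^ m" by (simp flip: power_mult_distrib)
  finally show ?thesis using J by (simp add: \<tau>_two_power)
qed

lemma inL_e0_plus_ev: "J \<noteq> 0 \<Longrightarrow> J < N \<Longrightarrow> inL (\<lambda>j. (e0 m j + \<i> ^ k * ev J j) / s2)"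
proof -
  assume "J \<noteq> 0" "J < N"
  then obtain l \<chi> where T: "herm_pauli m l J \<chi>"
    "\<And>j. tgate l J \<chi> (e0 m) j = (e0 m j + \<i> ^ k * e0 m (xor j J)) / s2"
    using tgate_e0[of J m k] by blast
  show ?thesis using inL_clifford_op[OF clifford_op_tgate[OF T(1)] inL_e0] unfolding T(2)[abs_def] .
qed

lemma inL_e0_minus_ev: "J < N \<Longrightarrow> inL (\<lambda>j. (e0 m j - ev J j) / s2)"
proof (cases "J = 0")
  case True
  thus ?thesis using inL_scale[OF inL_e0, of 0] by simp
next
  case False
  assume "J < N"
  thus ?thesis using inL_e0_plus_ev[OF False, of 2] by simp
qed

lemma inL_ev: "J < N \<Longrightarrow> inL (ev J)"
  by (rule inL_cong[OF _ inL_diff[OF inL_e0 inL_scale[OF inL_e0_minus_ev[of J] s2_R]]]) auto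

text \<open>The lattice contains (e0 - ev J) / sqrt 2 and its image under g. So the image of
  \<open>ev J\<close>, divided by c, is a minimal vector congruent to \<open>e0\<close>, and
  \<open>frame\<close> applies.\<close>

lemma frame_image:
  assumes g: "g \<in> G" and c: "c \<in> R" "c * cnj c = 1"
    and ge: "\<And>j. j < N \<Longrightarrow> act N g (e0 m) j = c * e0 m j" and J: "J < N"
  obtains p k where "p < N" "\<And>i. i < N \<Longrightarrow> cnj c * act N g (ev J) i = \<i> ^ k * ev p i"
proof -
  define y where "y = (\<lambda>i. cnj c * act N g (ev J) i)"
  have y: "inL y" unfolding y_def by (intro inL_scale inL_act inL_ev g J cnj_R c)
  have "y j * cnj (y j) = act N g (ev J) j * cnj (act N g (ev J) j)" for j
  proof -
    have "y j * cnj (y j) = (c * cnj c) * (act N g (ev J) j * cnj (act N g (ev J) j))" by (simp add: y_def mult_ac)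
    thus ?thesis by (simp add: c)
  qed
  hence n: "nrm m y = 2 ^ m"
    using nrm_act[OF inL_ev[OF J] g] nrm_ev[OF J] unfolding nrm_def by simp
  have "inL (\<lambda>j. (y j - e0 m j) / s2)"
  proof (rule inL_cong[OF _ inL_scale[OF inL_act[OF inL_e0_minus_ev[OF J] g], of "- cnj c"]])
    fix j assume j: "j < N"
    have cc: "cnj c * (c * z) = z" for z using c(2) by (metis mult.assoc mult.commute mult_1)
    show "- cnj c * act N g (\<lambda>j. (e0 m j - ev J j) / s2) j = (y j - e0 m j) / s2"
      unfolding act_divide act_diff y_def ge[OF j] by (simp add: diff_divide_distrib right_diff_distrib cc)
  qed (use c in auto)
  from frame[OF inL_latt[OF inL_e0] inL_latt[OF y] n inL_latt[OF this]] obtain p k where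
    pk: "p < N" "\<forall>j<N. y j = (if j = p then \<i> ^ k * s2 ^ m else 0)" by blast
  show ?thesis by (rule that[of p k]) (use pk in \<open>auto simp: y_def ev_index\<close>)
qed

section \<open>Elements acting trivially modulo sqrt 2\<close>

lemma one_plus_i_power_R: "(1 + \<i> ^ k) / s2 \<in> R"
proof -
  have "(1 - \<i>) / s2 \<in> R" using cnj_R[OF zeta8_R] unfolding zeta8_alt by simp
  moreover have "(1 + 1) / s2 = s2" by (simp add: field_simps)
  ultimately show ?thesis using i_power_cases[of k] one_plus_i_R s2_R zero_R by auto
qed

text \<open>sqrt 2 times a gate is 1 + i P. Hence a power of i times a gate, minus a scalar from R,
  is (P' - 1) / sqrt 2 for the given Pauli operator P'.\<close>

lemma pauli_trivial_mod:
  assumes "pm_character m \<chi>" "a < N" "inL v"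
  shows "inL (\<lambda>j. (pauli_act k a \<chi> v j - v j) / s2)"
proof -
  define l :: nat where "l = (if \<chi> a = 1 then 0 else 1)"
  have h: "herm_pauli m l a \<chi>" using assms(1,2) pm_characterD(2)[OF assms(1), of a]
    unfolding herm_pauli_def l_def by auto
  \<comment> \<open>Chosen so that q + l + 1 is congruent to k modulo 4, where l makes the triple
    Hermitian.\<close>
  define q where "q = k + 3 * (l + 1)"
  have "\<i> ^ q * (\<i> * \<i> ^ l) = \<i> ^ (q + Suc l)" by (simp only: power_add power_Suc)
  also have "q + Suc l = k + 4 * (l + 1)" unfolding q_def by simp
  also have "\<i> ^ (k + 4 * (l + 1)) = \<i> ^ k" by (simp only: power_add power_mult) simp
  finally have q: "\<i> ^ q * (\<i> * \<i> ^ l) = \<i> ^ k" .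
  have "inL (\<lambda>j. \<i> ^ q * tgate l a \<chi> v j + (- ((1 + \<i> ^ q) / s2)) * v j)"
    by (rule inL_linear[OF inL_clifford_op[OF clifford_op_tgate[OF h] assms(3)] assms(3)
          power_R[OF i_R] uminus_R[OF one_plus_i_power_R]])
  moreover have "\<i> ^ q * tgate l a \<chi> v j + (- ((1 + \<i> ^ q) / s2)) * v j = (pauli_act k a \<chi> v j - v j) / s2" for j
  proof -
    have "pauli_act k a \<chi> v j = \<i> ^ q * (\<i> * pauli_act l a \<chi> v j)"
      unfolding pauli_act_def q[symmetric] by (simp add: mult_ac)
    thus ?thesis unfolding tgate_def by (simp add: algebra_simps add_divide_distrib diff_divide_distrib)
  qed
  ultimately show ?thesis by simp
qed

text \<open>\<tau> is only known to be additive, so its value at half of 2^m is recovered by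
  doubling.\<close>

lemma \<tau>_half: "x \<in> R \<Longrightarrow> 2 * x = 2 ^ m \<Longrightarrow> \<tau> x = 2 ^ m / 2"
  using \<tau>_double[of x] \<tau>_two_power[of m] by simp

lemma \<tau>_quarter: "x \<in> R \<Longrightarrow> 4 * x = 2 ^ m \<Longrightarrow> \<tau> x = 2 ^ m / 4"
  using \<tau>_double[of x] \<tau>_double[of "2 * x"] \<tau>_two_power[of m] add_R[of x x] by simp

lemma s2_power_square: "s2 ^ m * s2 ^ m = 2 ^ m"
  by (simp flip: power_mult_distrib)

text \<open>Such a vector is nonzero of norm 2^m / 2, half the minimum.\<close>

lemma not_latt_half:
  assumes J: "J < N" and u: "u * cnj u = 1"
  shows "\<not> latt m (\<lambda>j. u * ev J j / s2)"
proof
  define z where "z = (\<lambda>j. u * ev J j / s2)"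
  assume "latt m (\<lambda>j. u * ev J j / s2)"
  hence z: "latt m z" unfolding z_def .
  have "z J * cnj (z J) = (u * cnj u) * (s2 ^ m * s2 ^ m) / 2"
    unfolding z_def ev_index by simp
  hence "z J * cnj (z J) = 2 ^ m / 2" unfolding u s2_power_square by (simp only: mult_1)
  hence zz: "2 * (z J * cnj (z J)) = 2 ^ m" by (simp only:) simp
  have zR: "z J \<in> R" using latt_R[OF z J] .
  have "nrm m z = (\<Sum>j<N. if j = J then \<tau> (z J * cnj (z J)) else 0)"
    unfolding nrm_def by (intro sum.cong) (auto simp: z_def ev_index)
  also have "\<dots> = 2 ^ m / 2" using J \<tau>_half[OF _ zz] zR by simp
  finally have "nrm m z < 2 ^ m" using zero_less_power[of "2 :: real" m] by linarith
  from nrm_less_zero[OF z this J] have "z J = 0" .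
  thus False using zz by simp
qed

text \<open>Two coordinates contribute 2^m / 4 each, again below the minimum.\<close>

lemma not_latt_diff:
  assumes "J < N" "p < N" "p \<noteq> J"
  shows "\<not> latt m (\<lambda>j. (\<i> ^ k * ev p j - ev J j) / 2)"
proof
  define z where "z = (\<lambda>j. (\<i> ^ k * ev p j - ev J j) / 2)"
  assume "latt m (\<lambda>j. (\<i> ^ k * ev p j - ev J j) / 2)"
  hence z: "latt m z" unfolding z_def .
  have ik: "\<i> ^ k * cnj (\<i> ^ k) = 1" by (simp flip: power_mult_distrib)
  have "z p * cnj (z p) = (\<i> ^ k * cnj (\<i> ^ k)) * (s2 ^ m * s2 ^ m) / 4"
    unfolding z_def ev_index using assms(3) by simp
  hence "z p * cnj (z p) = 2 ^ m / 4" unfolding ik s2_power_square by (simp only: mult_1)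
  hence zp: "4 * (z p * cnj (z p)) = 2 ^ m" by (simp only:) simp
  have "z J * cnj (z J) = (s2 ^ m * s2 ^ m) / 4"
    unfolding z_def ev_index using assms(3) by simp
  hence "z J * cnj (z J) = 2 ^ m / 4" unfolding s2_power_square .
  hence zJ: "4 * (z J * cnj (z J)) = 2 ^ m" by (simp only:) simp
  have zR: "z J \<in> R" "z p \<in> R" using latt_R[OF z] assms by auto
  have "nrm m z = (\<Sum>j<N. (if j = J then \<tau> (z J * cnj (z J)) else 0) + (if j = p then \<tau> (z p * cnj (z p)) else 0))"
    unfolding nrm_def using assms(3) by (intro sum.cong) (auto simp: z_def ev_index)
  also have "\<dots> = 2 ^ m / 2" using assms \<tau>_quarter[OF _ zp] \<tau>_quarter[OF _ zJ] zR by (simp add: sum.distrib)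
  finally have "nrm m z < 2 ^ m" using zero_less_power[of "2 :: real" m] by linarith
  from nrm_less_zero[OF z this assms(1)] have "z J = 0" .
  thus False using zJ by simp
qed

text \<open>If \<open>h\<close> acts trivially modulo \<open>\<surd>2\<close>, then \<open>(h w - w) / \<surd>2\<close> is a lattice vector for every minimal
  \<open>w\<close>. Supports of size two force \<open>h\<close> to be diagonal with entries \<open>\<plusminus>1\<close>, supports of size four force
  these signs to be multiplicative: otherwise this vector, or its sum with \<open>\<surd>2 w\<close>, is too short.\<close>

lemma trivial_mod_normalized:
  assumes h: "h \<in> G" and triv: "\<And>v. inL v \<Longrightarrow> inL (\<lambda>j. (act N h v j - v j) / s2)"
    and he: "\<And>j. j < N \<Longrightarrow> act N h (e0 m) j = e0 m j"
  shows "h \<in> paulis m"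
proof -
  have diag: "\<exists>s. (s = 1 \<or> s = -1) \<and> (\<forall>i<N. act N h (ev J) i = s * ev J i)" if J: "J < N" for J
  proof (cases "J = 0")
    case True
    thus ?thesis using he by (intro exI[of _ 1]) simp
  next
    case False
    obtain p k where pk: "p < N" "\<And>i. i < N \<Longrightarrow> act N h (ev J) i = \<i> ^ k * ev p i"
      using frame_image[OF h one_R _ _ J] he by auto
    have "inL (\<lambda>j. (e0 m j + ev J j) / s2)" using inL_e0_plus_ev[OF False J, of 0] by simp
    \<comment> \<open>The fixed vector \<open>e0\<close> cancels from the difference, leaving only
      \<open>ev J\<close> and its image.\<close>
    from triv[OF this] have "inL (\<lambda>j. (\<i> ^ k * ev p j - ev J j) / 2)"
      by (rule inL_cong[rotated])
        (simp add: act_divide act_add he pk(2) diff_divide_distrib[symmetric])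
    hence l: "latt m (\<lambda>j. (\<i> ^ k * ev p j - ev J j) / 2)" by (rule inL_latt)
    have pJ: "p = J" using not_latt_diff[OF J pk(1)] l by blast
    \<comment> \<open>If i^k is i or -i, then (i^k - 1) / sqrt 2 has absolute value 1 and the vector
      is excluded by \<open>not_latt_half\<close>.\<close>
    have "\<i> ^ k = 1 \<or> \<i> ^ k = -1"
    proof (rule ccontr)
      assume n: "\<not> ?thesis"
      define u where "u = (\<i> ^ k - 1) / s2"
      have "\<i> ^ k = \<i> \<or> \<i> ^ k = - \<i>" using i_power_cases[of k] n by blast
      hence "u * cnj u = 1" unfolding u_def by (elim disjE; simp only:) (simp_all add: field_simps)
      moreover have "(\<i> ^ k * ev p j - ev J j) / 2 = u * ev J j / s2" for j
        unfolding u_def pJ by (simp add: left_diff_distrib)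
      ultimately show False using not_latt_half[OF J] l by simp
    qed
    thus ?thesis using pk(2) pJ by auto
  qed
  define d where "d = (\<lambda>J. SOME s. (s = 1 \<or> s = -1) \<and> (\<forall>i<N. act N h (ev J) i = s * ev J i))"
  have d: "d J = 1 \<or> d J = -1" "\<And>i. i < N \<Longrightarrow> act N h (ev J) i = d J * ev J i" if "J < N" for J
  proof -
    have "(d J = 1 \<or> d J = -1) \<and> (\<forall>i<N. act N h (ev J) i = d J * ev J i)"
      unfolding d_def by (rule someI_ex[OF diag[OF that]])
    thus "d J = 1 \<or> d J = -1" "\<And>i. i < N \<Longrightarrow> act N h (ev J) i = d J * ev J i" by blast+
  qed
  have "d 0 * e0 m 0 = e0 m 0" using d(2)[of 0 0] he[of 0] by simp
  hence d0: "d 0 = 1" by (simp add: e0_def)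
  have dmult: "d (xor a b) = d a * d b" if ab: "a < N" "b < N" for a b
  proof -
    consider "a = 0" | "b = 0" | "a = b" | "a \<noteq> 0" "b \<noteq> 0" "a \<noteq> b" by blast
    thus ?thesis
    proof cases
      case 4
      define c where "c = xor a b"
      have c: "c < N" unfolding c_def using xor_less_2pow ab by blast
      obtain l \<chi> where T: "herm_pauli m l b \<chi>" "pm_character m \<chi>"
        "\<And>v j. tgate l b \<chi> v j = (v j + \<chi> (xor j b) * v (xor j b)) / s2"
        using tgate_swap[OF 4(2) ab(2)] by blast
      define \<epsilon> where "\<epsilon> = \<chi> a"
      have \<epsilon>: "\<epsilon> = 1 \<or> \<epsilon> = -1" unfolding \<epsilon>_def using pm_characterD(2)[OF T(2)] .
      \<comment> \<open>The gate along b doubles the pair of coordinates 0, a to the four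
        coordinates 0, a, b, c.\<close>
      define w where "w = (\<lambda>j. (e0 m j + ev a j + ev b j + \<epsilon> * ev c j) / 2)"
      have "inL (tgate l b \<chi> (\<lambda>j. (e0 m j + ev a j) / s2))"
        using inL_clifford_op[OF clifford_op_tgate[OF T(1)] inL_e0_plus_ev[OF 4(1) ab(1), of 0]] by simp
      moreover have "tgate l b \<chi> (\<lambda>j. (e0 m j + ev a j) / s2) j = w j" for j
      proof -
        have x: "xor (xor j b) a = xor j c" unfolding c_def by (metis xor.assoc xor.commute)
        have "\<chi> (xor j b) * e0 m (xor j b) = ev b j"
          using pm_characterD(6)[OF T(2)] by (simp add: e0_def)
        moreover have "\<chi> (xor j b) * ev a (xor j b) = \<epsilon> * ev c j"
          using ev_index[of a "xor j b"] unfolding x[symmetric] \<epsilon>_def by (auto simp: e0_def xor_eq_0_iff)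
        ultimately show ?thesis unfolding T(3) w_def by (simp add: algebra_simps add_divide_distrib)
      qed
      hence "tgate l b \<chi> (\<lambda>j. (e0 m j + ev a j) / s2) = w" by (rule ext)
      ultimately have w: "inL w" by (simp only:)
      have hw: "act N h w j = (e0 m j + d a * ev a j + d b * ev b j + \<epsilon> * (d c * ev c j)) / 2" if "j < N" for j
        unfolding w_def act_divide act_add act_scale using he[OF that] d(2)[OF _ that] ab c by simp
      define z where "z = (\<lambda>j. (act N h w j - w j) / s2)"
      have z: "inL z" unfolding z_def using triv[OF w] .
      have nh: False if "x < N" "u = 1 \<or> u = -1" "inL y" "\<And>j. j < N \<Longrightarrow> y j = u * ev x j / s2" for x u y
      proof -
        have "latt m (\<lambda>j. u * ev x j / s2)" by (rule latt_cong[OF _ inL_latt[OF that(3)]]) (rule that(4))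
        thus False using not_latt_half[OF that(1), of u] that(2) by auto
      qed
      show "d (xor a b) = d a * d b"
      proof (rule ccontr)
        assume "d (xor a b) \<noteq> d a * d b"
        hence ne: "d c \<noteq> d a * d b" unfolding c_def .
        have z1: "z j = ((d a - 1) * ev a j + (d b - 1) * ev b j + \<epsilon> * ((d c - 1) * ev c j)) / 2 / s2"
          if "j < N" for j
          unfolding z_def hw[OF that] unfolding w_def by (simp add: algebra_simps diff_divide_distrib add_divide_distrib)
        \<comment> \<open>The sign patterns violating multiplicativity. In the first three only one
          coordinate of z survives; in the fourth, adding sqrt 2 * w cancels the three that survive
          and leaves coordinate 0.\<close>
        consider "d a = -1" "d b = 1" "d c = 1" | "d a = 1" "d b = -1" "d c = 1"
          | "d a = 1" "d b = 1" "d c = -1" | "d a = -1" "d b = -1" "d c = -1"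
          using d(1)[OF ab(1)] d(1)[OF ab(2)] d(1)[OF c] ne by auto
        thus False
        proof cases
          case 1
          show False by (rule nh[OF ab(1) _ z, of "-1"]) (simp_all add: z1 1)
        next
          case 2
          show False by (rule nh[OF ab(2) _ z, of "-1"]) (simp_all add: z1 2)
        next
          case 3
          show False by (rule nh[OF c _ z, of "- \<epsilon>"]) (use \<epsilon> in \<open>auto simp: z1 3\<close>)
        next
          case A: 4
          have "inL (\<lambda>j. z j + s2 * w j)" using inL_add[OF z inL_scale[OF w s2_R]] .
          moreover have "z j + s2 * w j = 1 * ev 0 j / s2" if "j < N" for j
            unfolding z1[OF that] w_def A by (simp add: field_simps)
          ultimately show False using nh[of 0 1 "\<lambda>j. z j + s2 * w j"] by simp
        qed
      qed
    qed (use d0 d(1)[OF ab(1)] in auto)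
  qed
  \<comment> \<open>\<open>d\<close> is meaningful only below N; truncation extends it to a
    character on all naturals.\<close>
  define \<chi> where "\<chi> = (\<lambda>j. d (take_bit m j))"
  have tb: "take_bit m j < N" for j :: nat by simp
  have \<chi>: "pm_character m \<chi>" unfolding pm_character_def \<chi>_def
    using dmult[OF tb tb] d(1)[OF tb] by auto
  have "h = pauli_mat m 0 0 \<chi>"
  proof (rule eq_matI)
    fix i J assume "i < dim_row (pauli_mat m 0 0 \<chi>)" "J < dim_col (pauli_mat m 0 0 \<chi>)"
    hence ij: "i < N" "J < N" by (auto simp: pauli_mat_def)
    have "act N h (ev J) i = (\<Sum>j<N. if j = J then h $$ (i, J) * s2 ^ m else 0)"
      unfolding act_def ev_index by (intro sum.cong) auto
    also have "\<dots> = h $$ (i, J) * s2 ^ m" using ij by simp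
    finally have "h $$ (i, J) * s2 ^ m = d J * (if i = J then s2 ^ m else 0)"
      using d(2)[OF ij(2,1)] by (simp add: ev_index)
    thus "h $$ (i, J) = pauli_mat m 0 0 \<chi> $$ (i, J)"
      using ij by (auto simp: pauli_mat_def \<chi>_def take_bit_nat_eq_self split: if_splits)
  qed (use G_carrier[OF h] in \<open>auto simp: pauli_mat_def\<close>)
  thus ?thesis using paulisI[OF _ \<chi>, of 0 0] by simp
qed

lemma paulis_G: "P \<in> paulis m \<Longrightarrow> P \<in> G"
  using paulis_finite_clifford[OF m] G_clifford by blast

lemma trivial_mod_pauli:
  assumes h: "h \<in> G" and triv: "\<And>v. inL v \<Longrightarrow> inL (\<lambda>j. (act N h v j - v j) / s2)"
  shows "h \<in> paulis m"
proof -
  obtain p k where pk: "p < N" "\<forall>j<N. act N h (e0 m) j = (if j = p then \<i> ^ k * s2 ^ m else 0)"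
    using frame[OF inL_latt[OF inL_e0] inL_latt[OF inL_act[OF inL_e0 h]] _ inL_latt[OF triv[OF inL_e0]]]
      nrm_act[OF inL_e0 h] nrm_ev[of 0] by auto
  \<comment> \<open>h maps \<open>e0\<close> to i^k * \<open>ev p\<close>; shifting by p with the
    phase i^(3 * k) brings it back, as i^(4 * k) = 1.\<close>
  define P where "P = pauli_mat m (3 * k) p (\<lambda>_. 1)"
  have P: "P \<in> paulis m" unfolding P_def by (rule paulisI[OF pk(1) pm_character_one])
  have PG: "P \<in> G" using paulis_G[OF P] .
  have aP: "act N P v j = pauli_act (3 * k) p (\<lambda>_. 1) v j" if "j < N" for v j
    unfolding P_def by (rule act_represents[OF represents_pauli[OF pk(1)] that])
  have "P * h \<in> paulis m"
  proof (rule trivial_mod_normalized)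
    show "P * h \<in> G" using PG h by simp
    fix v assume v: "inL v"
    have "inL (\<lambda>j. act N P (\<lambda>j. (act N h v j - v j) / s2) j + (pauli_act (3 * k) p (\<lambda>_. 1) v j - v j) / s2)"
      by (intro inL_add inL_act triv v PG pauli_trivial_mod pk(1) pm_character_one)
    thus "inL (\<lambda>j. (act N (P * h) v j - v j) / s2)"
      by (rule inL_cong[rotated])
        (simp add: act_mult[OF G_carrier[OF PG] G_carrier[OF h]] act_divide act_diff aP diff_divide_distrib)
  next
    fix j assume j: "j < N"
    have xj: "xor j p < N" using xor_less_2pow[OF j pk(1)] .
    have "act N (P * h) (e0 m) j = \<i> ^ (3 * k) * act N h (e0 m) (xor j p)"
      unfolding act_mult[OF G_carrier[OF PG] G_carrier[OF h] j] aP[OF j] pauli_act_def by simp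
    also have "\<dots> = (\<i> ^ (3 * k) * \<i> ^ k) * e0 m j"
    proof -
      have "xor j p = p \<longleftrightarrow> j = 0" by (metis xor_cancel(1) xor.left_neutral xor_self_eq)
      thus ?thesis using pk(2) xj by (simp add: e0_def)
    qed
    also have "\<i> ^ (3 * k) * \<i> ^ k = \<i> ^ (4 * k)" by (simp flip: power_add)
    also have "\<dots> = 1" by (simp add: power_mult)
    finally show "act N (P * h) (e0 m) j = e0 m j" by simp
  qed
  hence "mat_adjoint P * (P * h) \<in> paulis m" using paulis_mult[OF paulis_adjoint[OF P]] by blast
  moreover have "mat_adjoint P * (P * h) = mat_adjoint P * P * h"
    using square_mat_assoc[of "mat_adjoint P" N P h] PG h by simp
  moreover have "\<dots> = h"
    unfolding G_inverse(2)[OF PG] by (rule left_mult_one_mat[OF G_carrier[OF h]])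
  ultimately show ?thesis by simp
qed

text \<open>Within G the Paulis are exactly the elements acting trivially modulo sqrt 2, and this
  property is stable under conjugation because g preserves the lattice.\<close>

lemma G_normalizes_paulis:
  assumes g: "g \<in> G" and P: "P \<in> paulis m"
  shows "g * P * mat_adjoint g \<in> paulis m"
proof (rule trivial_mod_pauli)
  have PG: "P \<in> G" using paulis_G[OF P] .
  obtain k a \<chi> where Pm: "P = pauli_mat m k a \<chi>" "a < N" "pm_character m \<chi>" using P unfolding paulis_def by blast
  show hG: "g * P * mat_adjoint g \<in> G" using g PG by simp
  fix v assume v: "inL v"
  define u where "u = act N (mat_adjoint g) v"
  have u: "inL u" unfolding u_def using inL_act[OF v] g by simp
  have "inL (act N g (\<lambda>j. (pauli_act k a \<chi> u j - u j) / s2))"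
    by (intro inL_act pauli_trivial_mod Pm u g)
  thus "inL (\<lambda>j. (act N (g * P * mat_adjoint g) v j - v j) / s2)"
  proof (rule inL_cong[rotated])
    fix j assume j: "j < N"
    have "act N (g * P * mat_adjoint g) v j = act N (g * P) u j"
      unfolding u_def using act_mult[of "g * P" N "mat_adjoint g" j v] g PG j by (simp only: G_carrier G_mult G_adjoint)
    also have "\<dots> = act N g (act N P u) j" using act_mult[of g N P j u] g PG j by simp
    also have "\<dots> = act N g (pauli_act k a \<chi> u) j"
      by (rule act_cong) (simp add: Pm(1) act_represents[OF represents_pauli[OF Pm(2)]])
    finally have 1: "act N (g * P * mat_adjoint g) v j = act N g (pauli_act k a \<chi> u) j" .
    have "act N g u j = act N (g * mat_adjoint g) v j" unfolding u_def
      using act_mult[of g N "mat_adjoint g" j v] g j by simp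
    also have "\<dots> = v j" unfolding G_inverse(1)[OF g] using act_one[OF j] .
    finally show "act N g (\<lambda>j. (pauli_act k a \<chi> u j - u j) / s2) j = (act N (g * P * mat_adjoint g) v j - v j) / s2"
      unfolding 1 by (simp add: act_divide act_diff)
  qed
qed

lemma G_factorization:
  assumes g: "g \<in> G"
  obtains c f where "f \<in> G" "f \<in> clifford_normalizer m" "g = c \<cdot>\<^sub>m f"
proof -
  have e: "inL (act N g (e0 m))" using inL_act[OF inL_e0 g] .
  have "nrm m (act N g (e0 m)) = 2 ^ m" using nrm_act[OF inL_e0 g] nrm_ev[of 0] by simp
  then obtain W c where W: "clifford_op m W" "c \<in> R" "c * cnj c = 1" "\<forall>j<N. W (act N g (e0 m)) j = c * e0 m j"
    using minimal_transitive[OF inL_latt[OF inL_e0] inL_latt[OF e]] by blast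
  obtain A where A: "A \<in> G" "A \<in> clifford_normalizer m" "represents N A W" by (rule clifford_op_matrix[OF W(1)])
  define g1 where "g1 = A * g"
  have g1: "g1 \<in> G" unfolding g1_def using A g by simp
  have ge: "act N g1 (e0 m) j = c * e0 m j" if "j < N" for j
    unfolding g1_def using that W(4) act_mult[OF G_carrier[OF A(1)] G_carrier[OF g] that] act_represents[OF A(3) that] by simp
  define f where "f = cnj c \<cdot>\<^sub>m g1"
  have c1: "cnj c * c = 1" using W(3) by (simp add: mult.commute)
  have fc: "f \<in> carrier_mat N N" unfolding f_def using g1 by simp
  \<comment> \<open>Each column of f is a single power of i; this brings f into matrices over
    Q(zeta8), although G was only assumed complex.\<close>
  have entries: "\<exists>p k. \<forall>i<N. f $$ (i, J) = (if i = p then \<i> ^ k else 0)" if J: "J < N" for J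
  proof -
    obtain p k where pk: "p < N" "\<And>i. i < N \<Longrightarrow> cnj c * act N g1 (ev J) i = \<i> ^ k * ev p i"
      by (rule frame_image[OF g1 W(2,3) ge J]) (assumption, rule that)
    have "f $$ (i, J) = (if i = p then \<i> ^ k else 0)" if i: "i < N" for i
    proof -
      have "act N g1 (ev J) i = (\<Sum>j<N. if j = J then g1 $$ (i, J) * s2 ^ m else 0)"
        unfolding act_def ev_index by (intro sum.cong) auto
      also have "\<dots> = g1 $$ (i, J) * s2 ^ m" using J by simp
      finally have "(cnj c * g1 $$ (i, J)) * s2 ^ m = (if i = p then \<i> ^ k else 0) * s2 ^ m"
        using pk(2)[OF i] by (simp add: ev_index mult.assoc)
      thus ?thesis unfolding f_def using i J G_carrier[OF g1] by simp
    qed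
    thus ?thesis by blast
  qed
  have fK: "f $$ (i, J) \<in> Q_zeta8" if "i < N" "J < N" for i J
    using entries[OF that(2)] that(1) Q8_i_power Q8.K01 by (metis (full_types))
  have smult_conj: "f * P * mat_adjoint f = g1 * P * mat_adjoint g1" "mat_adjoint f * P * f = mat_adjoint g1 * P * g1"
    if P: "P \<in> carrier_mat N N" for P
    unfolding f_def mat_adjoint_smult using G_carrier[OF g1] P c1 W(3)
    by (auto simp: mult_smult_assoc_mat[of _ N N _ N] mult_smult_distrib[of _ N N _ N] smult_smult_mat)
  have "f * mat_adjoint f = 1\<^sub>m N"
    using smult_conj(1)[of "1\<^sub>m N"] fc G_inverse(1)[OF g1] G_carrier[OF g1] by simp
  hence fU: "f \<in> carrier (unitary_group N Q_zeta8)" unfolding unitary_group_carrier_iff using fc fK by blast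
  have f_norm: "f \<in> clifford_normalizer m"
  proof (rule clifford_normalizerI[OF m fU])
    fix P assume P: "P \<in> paulis m"
    have Pc: "P \<in> carrier_mat N N" using G_carrier[OF paulis_G[OF P]] .
    show "f * P * mat_adjoint f \<in> paulis m" unfolding smult_conj(1)[OF Pc] using G_normalizes_paulis[OF g1 P] .
    show "mat_adjoint f * P * f \<in> paulis m" unfolding smult_conj(2)[OF Pc]
      using G_normalizes_paulis[OF G_adjoint[OF g1] P] by simp
  qed
  have K: "card G > 0" using G_finite g by (auto simp: card_gt_0_iff)
  have f0: "act N f (e0 m) j = e0 m j" if j: "j < N" for j
  proof -
    have "act N f (e0 m) j = cnj c * act N g1 (e0 m) j"
      unfolding act_def sum_distrib_left using j G_carrier[OF g1] by (intro sum.cong) (auto simp: f_def)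
    thus ?thesis unfolding ge[OF j] using c1 by (simp flip: mult.assoc)
  qed
  have fk: "act N (f ^\<^sub>m k) (e0 m) j = e0 m j" if "j < N" for k j
    using that
  proof (induction k arbitrary: j)
    case 0
    thus ?case using act_one[of j N "e0 m"] fc by simp
  next
    case (Suc k)
    have "act N (f ^\<^sub>m k * f) (e0 m) j = act N (f ^\<^sub>m k) (act N f (e0 m)) j"
      by (rule act_mult[OF pow_carrier_mat[OF fc] fc Suc.prems])
    also have "\<dots> = act N (f ^\<^sub>m k) (e0 m) j" by (rule act_cong) (rule f0)
    finally show ?case using Suc by simp
  qed
  \<comment> \<open>This scalar matrix fixes \<open>e0\<close>, so it is the identity; thus f lies
    in the finite Clifford group and not only in the normalizer.\<close>
  have fp: "f ^\<^sub>m card G = cnj c ^ card G \<cdot>\<^sub>m 1\<^sub>m N"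
    unfolding f_def pow_mat_smult[OF G_carrier[OF g1]] finite_unitary_subgroup_order[OF G_subgroup G_finite g1] ..
  have "cnj c ^ card G * s2 ^ m = s2 ^ m"
  proof -
    have "act N (f ^\<^sub>m card G) (e0 m) 0 = (\<Sum>j<N. if j = 0 then cnj c ^ card G * s2 ^ m else 0)"
      unfolding act_def fp e0_def by (intro sum.cong) auto
    also have "\<dots> = cnj c ^ card G * s2 ^ m" by simp
    finally show ?thesis using fk[of 0 "card G"] by (simp add: e0_def)
  qed
  hence "cnj c ^ card G = 1" by simp
  hence "f ^\<^sub>m card G = 1\<^sub>m N" unfolding fp by (simp add: one_smult_mat)
  hence "f \<in> finite_clifford m" using f_norm K unfolding finite_clifford_def by blast
  hence fG: "f \<in> G" using G_clifford by blast
  have "mat_adjoint A \<in> clifford_normalizer m"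
    using subgroup.m_inv_closed[OF clifford_normalizer_subgroup[OF m] A(2)] Q8.unitary_inv[of A N]
      subgroup.subset[OF clifford_normalizer_subgroup[OF m]] A(2) by auto
  hence n': "mat_adjoint A * f \<in> clifford_normalizer m"
    using subgroup.m_closed[OF clifford_normalizer_subgroup[OF m] _ f_norm] by simp
  have "c \<cdot>\<^sub>m f = g1" unfolding f_def using G_carrier[OF g1] W(3) by (simp add: smult_smult_mat one_smult_mat)
  hence "c \<cdot>\<^sub>m (mat_adjoint A * f) = mat_adjoint A * g1"
    using mult_smult_distrib[OF G_carrier[OF G_adjoint[OF A(1)]] fc, of c] by simp
  also have "\<dots> = mat_adjoint A * A * g" unfolding g1_def
    using square_mat_assoc[OF G_carrier[OF G_adjoint[OF A(1)]] G_carrier[OF A(1)] G_carrier[OF g]] by simp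
  also have "\<dots> = g" unfolding G_inverse(2)[OF A(1)] using G_carrier[OF g] by simp
  finally show ?thesis using that[of "mat_adjoint A * f" c] n' A(1) fG by simp
qed

end

section \<open>Scalars of G, choice of the ring and conclusion\<close>

lemma finite_unitary_scalars_cyclic:
  assumes G: "subgroup G (unitary_group n UNIV)" "finite G" and n: "n > 0"
  obtains \<zeta> :: complex and k :: nat where "k > 0" "\<zeta> ^ k = 1" "\<zeta> \<cdot>\<^sub>m 1\<^sub>m n \<in> G"
    "\<And>c. c \<cdot>\<^sub>m 1\<^sub>m n \<in> G \<Longrightarrow> \<exists>j. c = \<zeta> ^ j"
proof -
  define S where "S = {c :: complex. c \<cdot>\<^sub>m 1\<^sub>m n \<in> G}"
  have inj: "inj_on (\<lambda>c. c \<cdot>\<^sub>m 1\<^sub>m n :: complex mat) S"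
  proof (rule inj_onI)
    fix c d :: complex assume "c \<cdot>\<^sub>m 1\<^sub>m n = d \<cdot>\<^sub>m 1\<^sub>m n"
    from arg_cong[OF this, of "\<lambda>A. A $$ (0, 0)"] show "c = d" using n by simp
  qed
  have finS: "finite S" by (rule finite_imageD[OF _ inj]) (rule finite_subset[OF _ G(2)], auto simp: S_def)
  have one: "1 \<in> S"
  proof -
    have "1 \<cdot>\<^sub>m 1\<^sub>m n = (1\<^sub>m n :: complex mat)" by (rule eq_matI) auto
    thus ?thesis using subgroup.one_closed[OF G(1)] unfolding S_def by simp
  qed
  have mult: "c * d \<in> S" if "c \<in> S" "d \<in> S" for c d
  proof -
    have "c \<cdot>\<^sub>m 1\<^sub>m n * (d \<cdot>\<^sub>m 1\<^sub>m n) = (c * d) \<cdot>\<^sub>m (1\<^sub>m n :: complex mat)" by (rule eq_matI) auto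
    thus ?thesis using subgroup.m_closed[OF G(1), of "c \<cdot>\<^sub>m 1\<^sub>m n" "d \<cdot>\<^sub>m 1\<^sub>m n"] that unfolding S_def by simp
  qed
  have nz: "c \<noteq> 0" if "c \<in> S" for c
  proof
    assume "c = 0"
    hence "(0 \<cdot>\<^sub>m 1\<^sub>m n :: complex mat) \<in> carrier (unitary_group n UNIV)"
      using subgroup.mem_carrier[OF G(1)] that unfolding S_def by simp
    hence "(0 \<cdot>\<^sub>m 1\<^sub>m n :: complex mat) * mat_adjoint (0 \<cdot>\<^sub>m 1\<^sub>m n) = 1\<^sub>m n" unfolding unitary_group_carrier_iff by blast
    from arg_cong[OF this, of "\<lambda>A. A $$ (0, 0)"] show False using n by (simp add: scalar_prod_def)
  qed
  define k where "k = card S"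
  have k: "k > 0" unfolding k_def using finS one by (auto simp: card_gt_0_iff)
  \<comment> \<open>Multiplication by c permutes S, so the nonzero product of all elements of S
    equals c^k times itself.\<close>
  have root: "c ^ k = 1" if c: "c \<in> S" for c
  proof -
    have i: "inj_on ((*) c) S" using nz[OF c] by (auto intro: inj_onI)
    have "(*) c ` S \<subseteq> S" using mult[OF c] by auto
    hence "(*) c ` S = S" using endo_inj_surj[OF finS _ i] by simp
    hence "prod (\<lambda>x. x) S = prod (\<lambda>x. c * x) S" using prod.reindex[OF i, of "\<lambda>x. x"] by simp
    also have "\<dots> = c ^ k * prod (\<lambda>x. x) S" unfolding k_def by (simp add: prod.distrib)
    finally show ?thesis using nz finS by simp
  qed
  \<comment> \<open>S consists of k roots of x^k - 1, hence of all of them, and these are the powers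
    of one root.\<close>
  have "S = {c. c ^ k = 1}"
  proof (rule card_subset_eq)
    show "finite {c :: complex. c ^ k = 1}" by (rule finite_roots_unity) (use k in simp)
    show "S \<subseteq> {c. c ^ k = 1}" using root by auto
    show "card S = card {c :: complex. c ^ k = 1}" using card_roots_unity_eq[OF k] k_def by simp
  qed
  hence S: "c \<in> S \<longleftrightarrow> c ^ k = 1" for c by auto
  define \<zeta> where "\<zeta> = cis (2 * pi / k)"
  have z: "\<zeta> ^ k = 1" unfolding \<zeta>_def using k by (simp add: DeMoivre)
  have "\<exists>j. c = \<zeta> ^ j" if "c ^ k = 1" for c
  proof -
    have "c \<in> (\<lambda>j. cis (2 * pi * real j / real k)) ` {..<k}"
      using bij_betw_roots_unity[OF k] that by (auto simp: bij_betw_def)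
    then obtain j where "c = cis (2 * pi * real j / real k)" by auto
    hence "c = \<zeta> ^ j" unfolding \<zeta>_def by (simp add: DeMoivre mult_ac)
    thus ?thesis by blast
  qed
  thus ?thesis using that[of k \<zeta>] k z S unfolding S_def by blast
qed

lemma clifford_overgroup_exists:
  assumes "m \<ge> 1" "subgroup G (unitary_group (2 ^ m) UNIV)" "finite G" "finite_clifford m \<subseteq> G"
  shows "\<exists>R \<tau>. clifford_overgroup R \<tau> m G"
proof -
  have G1: "G \<noteq> {}" using subgroup.one_closed[OF assms(2)] by auto
  define K where "K = card G"
  have K: "K > 0" unfolding K_def using G1 assms(3) by (simp add: card_gt_0_iff)
  \<comment> \<open>The factor 8 puts \<open>zeta8\<close> into R, the factor \<open>card G\<close>
    the eigenvalues of all elements of G.\<close>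
  define n where "n = 8 * K"
  have n: "n > 0" using K n_def by simp
  define \<zeta> where "\<zeta> = cis (2 * pi / n)"
  have z: "\<zeta> ^ n = 1" unfolding \<zeta>_def using n by (simp add: DeMoivre)
  define R where "R = range (\<lambda>p. ipoly p \<zeta>)"
  obtain \<tau> :: "complex \<Rightarrow> real" where \<tau>: "\<And>x y. x \<in> R \<Longrightarrow> y \<in> R \<Longrightarrow> \<tau> (x + y) = \<tau> x + \<tau> y" "\<tau> 1 = 1"
    "\<And>x. x \<in> R \<Longrightarrow> x \<noteq> 0 \<Longrightarrow> \<tau> (x * cnj x) \<ge> 1"
    "\<And>x. x \<in> R \<Longrightarrow> \<tau> (x * cnj x) = 1 \<Longrightarrow> x * cnj x = 1"
  proof (rule cyclotomic_normalized_trace[OF n z, folded R_def])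
    fix t assume a: "\<And>x y. x \<in> R \<Longrightarrow> y \<in> R \<Longrightarrow> t (x + y) = t x + t y" "t 1 = (1::real)"
      "\<And>x. x \<in> R \<Longrightarrow> x \<noteq> 0 \<Longrightarrow> t (x * cnj x) \<ge> 1"
      "\<And>x. x \<in> R \<Longrightarrow> t (x * cnj x) = 1 \<Longrightarrow> x * cnj x = 1"
    show thesis by (rule that[of t]) (fact a)+
  qed
  have RI: "ipoly p \<zeta> \<in> R" for p unfolding R_def by blast
  have R_add: "x + y \<in> R" if xy: "x \<in> R" "y \<in> R" for x y
  proof -
    obtain p q where "x = ipoly p \<zeta>" "y = ipoly q \<zeta>" using xy unfolding R_def by blast
    hence "x + y = ipoly (p + q) \<zeta>" by (simp add: hom_distribs)
    thus ?thesis using RI by metis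
  qed
  have R_mult: "x * y \<in> R" if xy: "x \<in> R" "y \<in> R" for x y
  proof -
    obtain p q where "x = ipoly p \<zeta>" "y = ipoly q \<zeta>" using xy unfolding R_def by blast
    hence "x * y = ipoly (p * q) \<zeta>" by (simp add: hom_distribs)
    thus ?thesis using RI by metis
  qed
  have R_uminus: "- x \<in> R" if xy: "x \<in> R" for x
  proof -
    obtain p where "x = ipoly p \<zeta>" using xy unfolding R_def by auto
    hence "- x = ipoly (- p) \<zeta>" by (simp add: hom_distribs)
    thus ?thesis using RI by metis
  qed
  have R_cnj: "cnj x \<in> R" if xy: "x \<in> R" for x
  proof -
    obtain p where "x = ipoly p \<zeta>" using xy unfolding R_def by auto
    hence "cnj x = ipoly (pcompose p (monom 1 (n - 1))) \<zeta>"
      by (simp only: ipoly_pcompose ipoly_monom_cnj[OF n z] ipoly_cnj)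
    thus ?thesis using RI by metis
  qed
  have zp: "\<zeta> ^ j \<in> R" for j
    using RI[of "monom 1 j"] by (simp add: poly_monom hom_distribs)
  have root: "x \<in> R" if "x ^ n = 1" for x
  proof -
    have "x \<in> (\<lambda>j. cis (2 * pi * real j / real n)) ` {..<n}"
      using bij_betw_roots_unity[OF n] that by (auto simp: bij_betw_def)
    then obtain j where "x = cis (2 * pi * real j / real n)" by auto
    hence "x = \<zeta> ^ j" unfolding \<zeta>_def by (simp add: DeMoivre mult_ac)
    thus ?thesis using zp by simp
  qed
  have one: "1 \<in> R" using root[of 1] by simp
  have zero: "0 \<in> R" using R_add[OF one R_uminus[OF one]] by simp
  have "zeta8 * zeta8 = \<i>" unfolding zeta8_alt by (simp add: field_simps)
  moreover have "zeta8 ^ 8 = (zeta8 * zeta8) ^ 4"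
    by (simp flip: power2_eq_square power_mult)
  ultimately have z8: "zeta8 ^ 8 = 1" by simp
  have "zeta8 \<in> R" using root[of zeta8] z8 unfolding n_def by (simp add: power_mult)
  moreover have "(\<Sum>i<2 ^ m. g $$ (i, i)) \<in> R" if "g \<in> G" for g
  proof (rule trace_finite_order[OF _ finite_unitary_subgroup_order[OF assms(2,3) that] zero R_add])
    show "g \<in> carrier_mat (2 ^ m) (2 ^ m)"
      using subgroup.mem_carrier[OF assms(2) that] unfolding unitary_group_carrier_iff by simp
    fix x :: complex assume "x ^ card G = 1"
    thus "x \<in> R" by (intro root) (simp add: n_def K_def mult.commute[of 8] power_mult)
  qed
  ultimately have "clifford_overgroup R \<tau> m G"
    using one R_add R_mult R_uminus R_cnj \<tau> assms
    by (intro clifford_overgroup.intro trace_ring.intro clifford_overgroup_axioms.intro) simp_all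
  thus ?thesis by blast
qed

theorem theorem6p5:
  fixes m :: nat and G X :: "complex mat set"
  assumes "m \<ge> 1"
    and "X = clifford_normalizer m \<or> X = finite_clifford m"
    and "subgroup G (unitary_group (2 ^ m) UNIV)"
    and "finite G"
    and "X \<subseteq> G"
  shows "\<exists>\<zeta>::complex. (\<exists>k::nat. k > 0 \<and> \<zeta> ^ k = 1) \<and>
           G = generate (unitary_group (2 ^ m) UNIV) (X \<union> {\<zeta> \<cdot>\<^sub>m 1\<^sub>m (2 ^ m)})"
proof -
  let ?N = "2 ^ m :: nat" and ?U = "unitary_group (2 ^ m) UNIV"
  \<comment> \<open>Both choices of X contain the finite Clifford group, which together with the
    scalars already generates G.\<close>
  have fin: "finite_clifford m \<subseteq> X" using assms(2) unfolding finite_clifford_def by auto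
  then obtain R \<tau> where "clifford_overgroup R \<tau> m G"
    using clifford_overgroup_exists[OF assms(1,3,4)] assms(5) by blast
  then interpret clifford_overgroup R \<tau> m G .
  obtain \<zeta> :: complex and k :: nat where z: "k > 0" "\<zeta> ^ k = 1" "\<zeta> \<cdot>\<^sub>m 1\<^sub>m ?N \<in> G"
    "\<And>c. c \<cdot>\<^sub>m 1\<^sub>m ?N \<in> G \<Longrightarrow> \<exists>j. c = \<zeta> ^ j"
    using finite_unitary_scalars_cyclic[OF assms(3,4)] by (metis zero_less_numeral zero_less_power)
  let ?H = "generate ?U (X \<union> {\<zeta> \<cdot>\<^sub>m 1\<^sub>m ?N})"
  have "?H \<subseteq> G" by (rule UNIV_ring.unitary.generate_subgroup_incl[OF _ assms(3)]) (use z(3) assms(5) in auto)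
  moreover have "g \<in> ?H" if g: "g \<in> G" for g
  proof -
    obtain c f where f: "f \<in> G" "f \<in> clifford_normalizer m" "g = c \<cdot>\<^sub>m f" by (rule G_factorization[OF g])
    have "f \<in> finite_clifford m"
      using f(2) finite_unitary_subgroup_order[OF assms(3,4) f(1)] assms(4) f(1)
      unfolding finite_clifford_def by (auto intro!: exI[of _ "card G"] simp: card_gt_0_iff)
    hence fH: "f \<in> ?H" using fin by (auto intro: generate.incl)
    \<comment> \<open>Since f lies in G, so does the scalar c, which is therefore a power of
      \<zeta>.\<close>
    have "g * mat_adjoint f = c \<cdot>\<^sub>m 1\<^sub>m ?N"
      unfolding f(3) using mult_smult_assoc_mat[OF G_carrier[OF f(1)] G_carrier[OF G_adjoint[OF f(1)]], of c] G_inverse(1)[OF f(1)]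
      by simp
    hence "c \<cdot>\<^sub>m 1\<^sub>m ?N \<in> G" using G_mult[OF g G_adjoint[OF f(1)]] by simp
    then obtain j where j: "c = \<zeta> ^ j" using z(4) by blast
    have pow: "\<zeta> ^ j \<cdot>\<^sub>m f \<in> ?H" for j
    proof (induction j)
      case 0
      show ?case using fH by (simp add: one_smult_mat)
    next
      case (Suc j)
      have "\<zeta> \<cdot>\<^sub>m 1\<^sub>m ?N * (\<zeta> ^ j \<cdot>\<^sub>m f) = \<zeta> \<cdot>\<^sub>m (\<zeta> ^ j \<cdot>\<^sub>m f)"
        using mult_smult_assoc_mat[OF one_carrier_mat, of "\<zeta> ^ j \<cdot>\<^sub>m f" ?N ?N \<zeta>] G_carrier[OF f(1)] by simp
      also have "\<dots> = \<zeta> ^ Suc j \<cdot>\<^sub>m f" by (simp add: smult_smult_mat)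
      finally show ?case
        using generate.eng[OF generate.incl Suc, of "\<zeta> \<cdot>\<^sub>m 1\<^sub>m ?N"] by simp
    qed
    show ?thesis using pow[of j] f(3) j by simp
  qed
  ultimately have "G = ?H" by blast
  thus ?thesis using z(1,2) by blast
qed

end
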